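(* Let $n\ge2$ and let $X\subseteq\mathbb{P}^n$ be the (unique up to automorphism of $\mathbb{P}^n$) hypersurface of degree $n$ admitting an induced additive action. Then $X$ is normal if and only if $n\le2$.
   Context: The base field $\mathbb{K}$ is algebraically closed of characteristic zero; all varieties are over $\mathbb{K}$ and $\mathbb{G}_a^m=(\mathbb{K}^m,+)$. An additive action on an (irreducible) variety $X$ is an effective regular action of $\mathbb{G}_a^m$ on $X$ with an open orbit. An additive action $\mathbb{G}_a^{n-1}\times X\to X$ on a projective hypersurface $X\subseteq\mathbb{P}^n$ is called induced if it extends to a regular action of $\mathbb{G}_a^{n-1}$ on the ambient space $\mathbb{P}^n$. The hypersurface in question is $X=p(\overline{\mathbb{K}^\times\exp U_0})\subseteq\mathbb{P}(A)\cong\mathbb{P}^n$, where $A=\mathbb{K}[x]/(x^{n+1})$, $U_0=\langle x,x^2,\ldots,x^{n-1}\rangle$ and $p\colon A\setminus\{0\}\to\mathbb{P}(A)$ is the canonical projection, with $\exp U_0\cong\mathbb{G}_a^{n-1}$ acting by multiplication. *)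

theory Defs
  imports
    "HOL-Computational_Algebra.Computational_Algebra"
    "HOL-Analysis.Abstract_Limits"
    "HOL-Algebra.Ring"
    "HOL-Library.Poly_Mapping"
begin

section \<open>Polynomials in several variables\<close>

type_synonym ('v, 'a) mpoly = "('v \<Rightarrow>\<^sub>0 nat) \<Rightarrow>\<^sub>0 'a"

definition mvars :: "('v, 'a::zero) mpoly \<Rightarrow> 'v set" where
  "mvars f = (\<Union>\<mu>\<in>Poly_Mapping.keys f. Poly_Mapping.keys \<mu>)"

definition meval :: "('v, 'a::comm_ring_1) mpoly \<Rightarrow> ('v \<Rightarrow> 'a) \<Rightarrow> 'a" where
  "meval f z =
     (\<Sum>\<mu>\<in>Poly_Mapping.keys f. Poly_Mapping.lookup f \<mu> * (\<Prod>i\<in>Poly_Mapping.keys \<mu>. z i ^ Poly_Mapping.lookup \<mu> i))"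

text \<open>Forms of degree \<open>d\<close> in the homogeneous coordinates of \<open>n\<close>-dimensional projective space.\<close>

definition forms :: "nat \<Rightarrow> nat \<Rightarrow> (nat, 'a::zero) mpoly set" where
  "forms n d = {f. mvars f \<subseteq> {..n} \<and> (\<forall>\<mu>\<in>Poly_Mapping.keys f. (\<Sum>i\<le>n. Poly_Mapping.lookup \<mu> i) = d)}"

text \<open>Polynomials in affine coordinates \<open>Inl 0, \<dots>, Inl (m - 1)\<close> and homogeneous coordinates
  \<open>Inr 0, \<dots>, Inr n\<close>, homogeneous of degree \<open>d\<close> in the latter.\<close>

definition relative_forms :: "nat \<Rightarrow> nat \<Rightarrow> nat \<Rightarrow> (nat + nat, 'a::zero) mpoly set" where
  "relative_forms m n d =
     {f. mvars f \<subseteq> {..<m} <+> {..n} \<and> (\<forall>\<mu>\<in>Poly_Mapping.keys f. (\<Sum>j\<le>n. Poly_Mapping.lookup \<mu> (Inr j)) = d)}"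

section \<open>Affine and projective space with their Zariski topologies\<close>

text \<open>Vectors with \<open>N\<close> coordinates are functions on the naturals that vanish from \<open>N\<close> on; a point
  of projective space is the set of its vectors of homogeneous coordinates.\<close>

definition aff_space :: "nat \<Rightarrow> (nat \<Rightarrow> 'a::zero) set" where
  "aff_space N = {z. \<forall>i\<ge>N. z i = 0}"

definition proj_pt :: "(nat \<Rightarrow> 'a::field) \<Rightarrow> (nat \<Rightarrow> 'a) set" where
  "proj_pt z = {\<lambda>i. c * z i |c. c \<noteq> 0}"

definition proj_space :: "nat \<Rightarrow> (nat \<Rightarrow> 'a::field) set set" where
  "proj_space n = proj_pt ` (aff_space (n + 1) - {\<lambda>_. 0})"

definition zariski_aff :: "nat \<Rightarrow> (nat \<Rightarrow> 'a::comm_ring_1) topology" where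
  "zariski_aff N =
     topology_generated_by {{z \<in> aff_space N. meval f z \<noteq> 0} |f. mvars f \<subseteq> {..<N}}"

definition zariski_proj :: "nat \<Rightarrow> (nat \<Rightarrow> 'a::field) set topology" where
  "zariski_proj n =
     topology_generated_by {{p \<in> proj_space n. \<forall>z\<in>p. meval f z \<noteq> 0} |f d. f \<in> forms n d}"

text \<open>Irreducible hypersurfaces; their degree is that of the irreducible equation.\<close>

definition hypersurface_of_degree :: "nat \<Rightarrow> nat \<Rightarrow> (nat \<Rightarrow> 'a::field) set set \<Rightarrow> bool" where
  "hypersurface_of_degree n d X \<longleftrightarrow>
     (\<exists>f\<in>forms n d. irreducible f \<and> X = {p \<in> proj_space n. \<forall>z\<in>p. meval f z = 0})"

section \<open>Additive actions\<close>

text \<open>A map from the product of affine \<open>m\<close>-space and \<open>Y\<close> (inside projective \<open>n\<close>-space) to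
  projective \<open>n\<close>-space is a morphism if near every point it is given by \<open>n + 1\<close> relative forms of
  equal degree. Multiplying these by the equation of the complement of a neighbourhood, one may
  assume that they give the map wherever they do not all vanish.\<close>

definition is_morphism ::
  "nat \<Rightarrow> nat \<Rightarrow> (nat \<Rightarrow> 'a::field) set set \<Rightarrow>
   ((nat \<Rightarrow> 'a) \<Rightarrow> (nat \<Rightarrow> 'a) set \<Rightarrow> (nat \<Rightarrow> 'a) set) \<Rightarrow> bool" where
  "is_morphism m n Y \<alpha> \<longleftrightarrow>
     (\<forall>t0\<in>aff_space m. \<forall>p0\<in>Y. \<exists>d F.
        (\<forall>j\<le>n. F j \<in> relative_forms m n d) \<and>
        (\<forall>z\<in>p0. \<exists>j\<le>n. meval (F j) (case_sum t0 z) \<noteq> 0) \<and>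
        (\<forall>t\<in>aff_space m. \<forall>p\<in>Y. \<forall>z\<in>p. (\<exists>j\<le>n. meval (F j) (case_sum t z) \<noteq> 0) \<longrightarrow>
           \<alpha> t p = proj_pt (\<lambda>j. if j \<le> n then meval (F j) (case_sum t z) else 0)))"

text \<open>Regular actions of the vector group of dimension \<open>m\<close> on \<open>Y\<close>.\<close>

definition regular_action ::
  "nat \<Rightarrow> nat \<Rightarrow> (nat \<Rightarrow> 'a::field) set set \<Rightarrow>
   ((nat \<Rightarrow> 'a) \<Rightarrow> (nat \<Rightarrow> 'a) set \<Rightarrow> (nat \<Rightarrow> 'a) set) \<Rightarrow> bool" where
  "regular_action m n Y \<alpha> \<longleftrightarrow>
     is_morphism m n Y \<alpha> \<and>
     (\<forall>t\<in>aff_space m. \<forall>p\<in>Y. \<alpha> t p \<in> Y) \<and>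
     (\<forall>p\<in>Y. \<alpha> (\<lambda>_. 0) p = p) \<and>
     (\<forall>s\<in>aff_space m. \<forall>t\<in>aff_space m. \<forall>p\<in>Y. \<alpha> (\<lambda>i. s i + t i) p = \<alpha> s (\<alpha> t p))"

definition additive_action ::
  "nat \<Rightarrow> nat \<Rightarrow> (nat \<Rightarrow> 'a::field) set set \<Rightarrow>
   ((nat \<Rightarrow> 'a) \<Rightarrow> (nat \<Rightarrow> 'a) set \<Rightarrow> (nat \<Rightarrow> 'a) set) \<Rightarrow> bool" where
  "additive_action m n X \<alpha> \<longleftrightarrow>
     regular_action m n X \<alpha> \<and>
     (\<forall>t\<in>aff_space m. (\<forall>p\<in>X. \<alpha> t p = p) \<longrightarrow> t = (\<lambda>_. 0)) \<and>
     (\<exists>p\<in>X. openin (subtopology (zariski_proj n) X) ((\<lambda>t. \<alpha> t p) ` aff_space m))"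

definition admits_induced_additive_action :: "nat \<Rightarrow> (nat \<Rightarrow> 'a::field) set set \<Rightarrow> bool" where
  "admits_induced_additive_action n X \<longleftrightarrow>
     (\<exists>\<alpha> \<beta>. additive_action (n - 1) n X \<alpha> \<and> regular_action (n - 1) n (proj_space n) \<beta> \<and>
        (\<forall>t\<in>aff_space (n - 1). \<forall>p\<in>X. \<beta> t p = \<alpha> t p))"

section \<open>Local rings and normality\<close>

definition regular_at ::
  "nat \<Rightarrow> (nat \<Rightarrow> 'a::field) set set \<Rightarrow> (nat \<Rightarrow> 'a) set \<Rightarrow> ((nat \<Rightarrow> 'a) set \<Rightarrow> 'a) \<Rightarrow> bool" where
  "regular_at n X p \<phi> \<longleftrightarrow>
     (\<exists>d. \<exists>g\<in>forms n d. \<exists>h\<in>forms n d.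
        eventually (\<lambda>q. \<forall>z\<in>q. meval h z \<noteq> 0 \<and> \<phi> q = meval g z / meval h z)
          (nhdsin (subtopology (zariski_proj n) X) p))"

text \<open>Germs at \<open>p\<close> of functions on \<open>X\<close>, represented by functions on all of the ambient type.\<close>

definition germ ::
  "nat \<Rightarrow> (nat \<Rightarrow> 'a::field) set set \<Rightarrow> (nat \<Rightarrow> 'a) set \<Rightarrow>
   ((nat \<Rightarrow> 'a) set \<Rightarrow> 'a) \<Rightarrow> ((nat \<Rightarrow> 'a) set \<Rightarrow> 'a) set" where
  "germ n X p \<phi> =
     {\<psi>. eventually (\<lambda>q. \<psi> q = \<phi> q) (nhdsin (subtopology (zariski_proj n) X) p)}"

definition local_ring ::
  "nat \<Rightarrow> (nat \<Rightarrow> 'a::field) set set \<Rightarrow> (nat \<Rightarrow> 'a) set \<Rightarrow> ((nat \<Rightarrow> 'a) set \<Rightarrow> 'a) set ring" where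
  "local_ring n X p =
     \<lparr>carrier = germ n X p ` {\<phi>. regular_at n X p \<phi>},
      mult = (\<lambda>A B. \<Union>\<phi>\<in>A. \<Union>\<psi>\<in>B. germ n X p (\<lambda>q. \<phi> q * \<psi> q)),
      one = germ n X p (\<lambda>_. 1),
      zero = germ n X p (\<lambda>_. 0),
      add = (\<lambda>A B. \<Union>\<phi>\<in>A. \<Union>\<psi>\<in>B. germ n X p (\<lambda>q. \<phi> q + \<psi> q))\<rparr>"

text \<open>Every fraction \<open>a / b\<close> that is a root of a monic polynomial
  \<open>y\<^sup>k + c\<^sub>k\<^sub>-\<^sub>1 y\<^sup>k\<^sup>-\<^sup>1 + \<dots> + c\<^sub>0\<close> over \<open>R\<close> lies in \<open>R\<close>; the equation is written
  after multiplication by \<open>b\<^sup>k\<close>.\<close>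

definition integrally_closed_domain :: "('b, 'c) ring_scheme \<Rightarrow> bool" where
  "integrally_closed_domain R \<longleftrightarrow> domain R \<and>
     (\<forall>a\<in>carrier R. \<forall>b\<in>carrier R - {\<zero>\<^bsub>R\<^esub>}.
        (\<exists>k::nat. \<exists>c\<in>{..<k} \<rightarrow> carrier R.
           a [^]\<^bsub>R\<^esub> k \<oplus>\<^bsub>R\<^esub>
             (\<Oplus>\<^bsub>R\<^esub>i\<in>{..<k}. c i \<otimes>\<^bsub>R\<^esub> a [^]\<^bsub>R\<^esub> i \<otimes>\<^bsub>R\<^esub> b [^]\<^bsub>R\<^esub> (k - i)) = \<zero>\<^bsub>R\<^esub>) \<longrightarrow>
        (\<exists>r\<in>carrier R. a = r \<otimes>\<^bsub>R\<^esub> b))"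

definition normal_variety :: "nat \<Rightarrow> (nat \<Rightarrow> 'a::field) set set \<Rightarrow> bool" where
  "normal_variety n X \<longleftrightarrow> (\<forall>p\<in>X. integrally_closed_domain (local_ring n X p))"

section \<open>The hypersurface\<close>

text \<open>Elements of \<open>A = \<K>[x] / (x\<^sup>n\<^sup>+\<^sup>1)\<close> are represented by polynomials of degree at most \<open>n\<close>, and
  \<open>coeff\<close> identifies \<open>A\<close> with \<open>aff_space (n + 1)\<close> by means of the basis \<open>1, x, \<dots>, x\<^sup>n\<close>.\<close>

definition trunc_exp :: "nat \<Rightarrow> 'a::field_char_0 poly \<Rightarrow> 'a poly" where
  "trunc_exp n u = (\<Sum>k\<le>n. smult (1 / fact k) (u ^ k)) mod monom 1 (n + 1)"

definition U0 :: "nat \<Rightarrow> 'a::field_char_0 poly set" where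
  "U0 n = {\<Sum>i=1..n - 1. monom (c i) i |c. True}"

definition exp_cone :: "nat \<Rightarrow> (nat \<Rightarrow> 'a::field_char_0) set" where
  "exp_cone n = {coeff (smult c (trunc_exp n u)) |c u. c \<noteq> 0 \<and> u \<in> U0 n}"

definition exp_hypersurface :: "nat \<Rightarrow> (nat \<Rightarrow> 'a::field_char_0) set set" where
  "exp_hypersurface n = proj_pt ` ((zariski_aff (n + 1) closure_of exp_cone n) - {\<lambda>_. 0})"

end

theory Submission
  imports Defs
begin

text \<open>The hypersurface is cut out by the homogenization of the coefficient of \<open>x\<^sup>n\<close> in
  \<open>log z\<close>, namely
  \<open>f = \<Sum>k=1..n. (-1)\<^sup>k\<^sup>-\<^sup>1 / k z\<^sub>0\<^sup>n\<^sup>-\<^sup>k [x\<^sup>n] (z\<^sub>1 x + z\<^sub>2 x\<^sup>2 + \<dots>)\<^sup>k\<close>.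
  It is linear in \<open>z\<^sub>n\<close> with leading coefficient a power of \<open>z\<^sub>0\<close>, and its restriction to
  \<open>z\<^sub>0 = 0\<close> is a multiple of \<open>z\<^sub>1\<^sup>n\<close>; hence it is irreducible, and the boundary of the open orbit is
  \<open>z\<^sub>0 = z\<^sub>1 = 0\<close>.

  For \<open>n \<ge> 3\<close> normality fails at the point \<open>[0 : 0 : 1 : 0 : \<dots>]\<close>. Multiplying \<open>f\<close> by \<open>z\<^sub>1\<^sup>n\<close> shows that
  \<open>z\<^sub>1\<^sup>2 / (z\<^sub>0 z\<^sub>2)\<close> is integral over the local ring. For every \<open>\<zeta>\<close> with \<open>\<zeta>\<^sup>n = -1\<close> it is constant, equal
  to \<open>(1 + \<zeta>)\<^sup>2 / \<zeta>\<close>, along the curve \<open>[t\<^sup>2 : (1 + \<zeta>) t : \<zeta> : 0 : \<dots>]\<close> through this point (that is,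
  \<open>(1 + x / t) (1 + \<zeta> x / t)\<close> up to a scalar). These constants are not all equal, so the function is not
  regular there. For \<open>n = 2\<close> the hypersurface is a smooth conic, whose local rings are
  localizations of a polynomial ring in one variable, hence valuation rings.\<close>

section \<open>Truncated exponentials and logarithms\<close>

unbundle fps_syntax

text \<open>Two points shape the argument. The hypersurface is given as a Zariski closure, so
  knowing the equation on the cone is not enough: every zero with \<open>z 0 = 0\<close> must be
  shown to be a limit of the cone. No dimension theory is used for this. Instead \<open>z 0\<close>
  is perturbed to a parameter and \<open>z 1\<close> is solved for; as the leading coefficient in
  \<open>z 1\<close> does not depend on the parameter, vanishing of a polynomial on the perturbed
  solutions passes to the limit.

  The bound \<open>n \<ge> 3\<close> enters through a count. If z_1^2 / (z_0 z_2) had a value a/b at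
  the point, every root of \<zeta>^n = -1 would be a root of the nonzero quadratic b (1 + \<zeta>)^2
  - a \<zeta>. For n = 2 the two roots are inverse to each other and give the same value 2, in
  agreement with the conic z_1^2 = 2 z_0 z_2; for larger n there are too many roots.\<close>

definition fps_E :: "'a::field_char_0 fps \<Rightarrow> 'a fps" where
  "fps_E u = fps_exp 1 oo u"

definition fps_L :: "'a::field_char_0 fps \<Rightarrow> 'a fps" where
  "fps_L w = fps_ln 1 oo (w - 1)"

lemma fps_E_nth_0 [simp]: "fps_E u $ 0 = 1"
  by (simp add: fps_E_def)

lemma fps_L_nth_0 [simp]: "fps_L w $ 0 = 0"
  by (simp add: fps_L_def)

lemma fps_deriv_E: "u $ 0 = 0 \<Longrightarrow> fps_deriv (fps_E u) = fps_deriv u * fps_E u"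
  by (simp add: fps_E_def fps_compose_deriv)

lemma fps_deriv_L:
  assumes "w $ 0 = 1"
  shows "fps_deriv (fps_L w) = fps_deriv w * inverse w"
proof -
  have "(inverse (1 + fps_X) oo (w - 1)) * (1 + fps_X oo (w - 1)) =
      (inverse (1 + fps_X) * (1 + fps_X)) oo (w - 1)"
    using assms by (subst fps_compose_mult_distrib) (auto simp: fps_compose_add_distrib)
  also have "inverse (1 + fps_X) * (1 + fps_X) = (1 :: 'a fps)"
    by (rule inverse_mult_eq_1) auto
  finally have "(inverse (1 + fps_X) oo (w - 1)) * w = 1"
    using assms by (simp add: fps_compose_add_distrib)
  then have "inverse (1 + fps_X) oo (w - 1) = inverse w"
    by (metis fps_inverse_unique mult.commute)
  then show ?thesis
    using assms by (simp add: fps_L_def fps_compose_deriv fps_ln_deriv mult.commute)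
qed

text \<open>The equation expresses (k+1) times coefficient k+1 through coefficients up to k, and k+1
  is invertible in characteristic zero. The functional equations of exponential and logarithm below
  are obtained by comparing solutions instead of manipulating coefficients.\<close>

lemma fps_linear_ode_unique:
  fixes F G :: "'a::field_char_0 fps"
  assumes "fps_deriv F = w * F" "fps_deriv G = w * G" "F $ 0 = G $ 0"
  shows "F = G"
proof -
  define H where "H = F - G"
  have dH: "fps_deriv H = w * H" and H0: "H $ 0 = 0"
    using assms by (simp_all add: H_def algebra_simps)
  have "H $ m = 0" for m
  proof (induction m rule: less_induct)
    case (less m)
    show ?case
    proof (cases m)
      case (Suc k)
      have "of_nat (Suc k) * H $ Suc k = (w * H) $ k"
        using dH by (metis fps_deriv_nth Suc_eq_plus1)
      also have "\<dots> = 0"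
        unfolding fps_mult_nth by (rule sum.neutral) (use less Suc in auto)
      finally show ?thesis
        using Suc by (simp del: of_nat_Suc)
    qed (simp add: H0)
  qed
  then have "H = 0" by (simp add: fps_eq_iff)
  then show ?thesis by (simp add: H_def)
qed

lemma fps_E_add:
  assumes "u $ 0 = 0" "v $ 0 = 0"
  shows "fps_E (u + v) = fps_E u * fps_E v"
  by (rule fps_linear_ode_unique[where w = "fps_deriv (u + v)"])
    (use assms in \<open>simp_all add: fps_deriv_E algebra_simps\<close>)

lemma fps_E_0 [simp]: "fps_E 0 = 1"
  by (simp add: fps_E_def)

lemma fps_L_E: "u $ 0 = 0 \<Longrightarrow> fps_L (fps_E u) = u"
proof -
  assume u: "u $ 0 = 0"
  have "fps_E u * inverse (fps_E u) = 1"
    by (rule inverse_mult_eq_1') simp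
  then have "fps_deriv (fps_L (fps_E u)) = fps_deriv u"
    using u by (simp add: fps_deriv_L fps_deriv_E mult.assoc)
  then show ?thesis
    using u by (simp add: fps_deriv_eq_iff)
qed

text \<open>\<open>w\<close> solves the same linear equation F' = (w'/w) F as the exponential of its
  logarithm, with the same constant term.\<close>

lemma fps_E_L:
  assumes "w $ 0 = 1"
  shows "fps_E (fps_L w) = w"
proof (rule fps_linear_ode_unique)
  show "fps_deriv (fps_E (fps_L w)) = (fps_deriv w * inverse w) * fps_E (fps_L w)"
    using assms by (simp add: fps_deriv_E fps_deriv_L)
  have "inverse w * w = 1"
    by (rule inverse_mult_eq_1) (use assms in simp)
  then show "fps_deriv w = (fps_deriv w * inverse w) * w"
    by (simp add: mult.assoc)
qed (use assms in simp)

section \<open>Working modulo x^(n+1): coefficients up to n depend only on coefficients up to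
  n\<close>

lemma fps_mult_nth_cong:
  assumes "\<And>j. j \<le> n \<Longrightarrow> F $ j = F' $ j" "\<And>j. j \<le> n \<Longrightarrow> G $ j = G' $ j" "m \<le> n"
  shows "(F * G) $ m = (F' * G') $ m"
  unfolding fps_mult_nth by (rule sum.cong) (use assms in auto)

lemma fps_power_nth_cong:
  fixes F G :: "'a::comm_ring_1 fps"
  assumes "\<And>j. j \<le> n \<Longrightarrow> F $ j = G $ j" "m \<le> n"
  shows "(F ^ k) $ m = (G ^ k) $ m"
  using assms(2)
proof (induction k arbitrary: m)
  case (Suc k)
  show ?case
    unfolding power_Suc by (rule fps_mult_nth_cong[where n = n]) (use assms(1) Suc in auto)
qed simp

lemma fps_compose_nth_cong:
  fixes F G :: "'a::comm_ring_1 fps"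
  assumes "\<And>j. j \<le> n \<Longrightarrow> F $ j = G $ j" "m \<le> n"
  shows "(a oo F) $ m = (a oo G) $ m"
  unfolding fps_compose_nth
  by (intro sum.cong refl arg_cong2[where f = times] fps_power_nth_cong[where n = n] assms)

lemma fps_E_nth_cong:
  assumes "\<And>j. j \<le> n \<Longrightarrow> F $ j = G $ j" "m \<le> n"
  shows "fps_E F $ m = fps_E G $ m"
  unfolding fps_E_def using assms by (rule fps_compose_nth_cong)

lemma fps_L_nth_cong:
  assumes "\<And>j. j \<le> n \<Longrightarrow> F $ j = G $ j" "m \<le> n"
  shows "fps_L F $ m = fps_L G $ m"
  unfolding fps_L_def using assms by (intro fps_compose_nth_cong) auto

lemma fps_E_inj_nth:
  assumes "u $ 0 = 0" "v $ 0 = 0" "\<And>j. j \<le> n \<Longrightarrow> fps_E u $ j = fps_E v $ j" "m \<le> n"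
  shows "u $ m = v $ m"
  using fps_L_nth_cong[OF assms(3,4)] by (simp add: fps_L_E assms(1,2))

section \<open>The equation of the exponential cone\<close>

definition fps_tail :: "(nat \<Rightarrow> 'a::zero) \<Rightarrow> 'a fps" where
  "fps_tail z = Abs_fps (\<lambda>i. if i = 0 then 0 else z i)"

definition log_form :: "nat \<Rightarrow> (nat \<Rightarrow> 'a::field_char_0) \<Rightarrow> 'a" where
  "log_form n z = (\<Sum>k=1..n. (-1) ^ (k - 1) / of_nat k * z 0 ^ (n - k) * (fps_tail z ^ k) $ n)"

lemma log_form_eq:
  assumes "z 0 \<noteq> 0" "n \<ge> 1"
  shows "log_form n z = z 0 ^ n * fps_L (fps_const (1 / z 0) * Abs_fps z) $ n"
proof -
  have *: "fps_const (1 / z 0) * Abs_fps z - 1 = fps_const (1 / z 0) * fps_tail z"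
    using assms by (auto simp: fps_eq_iff fps_tail_def)
  have "fps_L (fps_const (1 / z 0) * Abs_fps z) $ n =
      (\<Sum>k=0..n. fps_ln 1 $ k * (1 / z 0) ^ k * (fps_tail z ^ k) $ n)"
    by (simp add: fps_L_def * fps_compose_nth power_mult_distrib fps_const_power mult.assoc)
  also have "\<dots> = (\<Sum>k=1..n. fps_ln 1 $ k * (1 / z 0) ^ k * (fps_tail z ^ k) $ n)"
    by (rule sum.mono_neutral_right) (auto simp: not_le)
  finally show ?thesis
    using assms unfolding log_form_def sum_distrib_left
    by (auto intro!: sum.cong simp: sum_distrib_left fps_ln_nth power_one_over power_diff field_simps)
qed

lemma coeff_mod_monom:
  fixes p :: "'a::field poly"
  shows "coeff (p mod monom 1 N) j = (if j < N then coeff p j else 0)"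
proof -
  define q where "q = (\<Sum>i<N. monom (coeff p i) i)"
  have cq: "coeff q j = (if j < N then coeff p j else 0)" for j
    by (auto simp: q_def coeff_sum)
  have "q = 0 \<or> degree q < N"
    using cq by (metis leading_coeff_0_iff)
  moreover have "monom 1 N dvd p - q"
    by (auto simp: monom_1_dvd_iff' cq)
  ultimately have "p mod monom 1 N = q"
    by (metis degree_monom_eq mod_eq_dvd_iff mod_poly_less one_neq_zero mod_0)
  then show ?thesis by (simp add: cq)
qed

text \<open>Since \<open>u\<close> has no constant term, \<open>u ^ k\<close> starts in degree k;
  hence the finite sum up to \<open>n\<close> and the composition of series agree in every degree up
  to \<open>n\<close>.\<close>

lemma coeff_trunc_exp:
  assumes "coeff u 0 = 0"
  shows "coeff (trunc_exp n u) j = (if j \<le> n then fps_E (fps_of_poly u) $ j else 0)"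
proof -
  have "coeff (\<Sum>k\<le>n. smult (1 / fact k) (u ^ k)) j = fps_E (fps_of_poly u) $ j" if "j \<le> n"
  proof -
    have "coeff (\<Sum>k\<le>n. smult (1 / fact k) (u ^ k)) j =
        (\<Sum>k\<le>n. 1 / fact k * (fps_of_poly u ^ k) $ j)"
      by (simp add: coeff_sum flip: fps_of_poly_power)
    also have "\<dots> = (\<Sum>k=0..j. 1 / fact k * (fps_of_poly u ^ k) $ j)"
      by (rule sum.mono_neutral_right)
        (use that assms in \<open>auto simp: startsby_zero_power_prefix\<close>)
    finally show ?thesis
      by (simp add: fps_E_def fps_compose_nth)
  qed
  then show ?thesis
    by (simp add: trunc_exp_def coeff_mod_monom)
qed

lemma U0_iff:
  assumes "n \<ge> 1"
  shows "u \<in> U0 n \<longleftrightarrow> coeff u 0 = 0 \<and> (\<forall>j\<ge>n. coeff u j = 0)"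
proof
  assume "u \<in> U0 n"
  then show "coeff u 0 = 0 \<and> (\<forall>j\<ge>n. coeff u j = 0)"
    using assms by (auto simp: U0_def coeff_sum intro!: sum.neutral)
next
  assume *: "coeff u 0 = 0 \<and> (\<forall>j\<ge>n. coeff u j = 0)"
  have "u = (\<Sum>i=1..n - 1. monom (coeff u i) i)"
  proof (rule poly_eqI)
    fix j
    show "coeff u j = coeff (\<Sum>i=1..n - 1. monom (coeff u i) i) j"
      using * assms by (cases "j = 0"; cases "j \<ge> n") (auto simp: coeff_sum)
  qed
  then show "u \<in> U0 n" unfolding U0_def by blast
qed

text \<open>The exponent may be any series, because its coefficients beyond \<open>n\<close> do not
  influence \<open>z\<close>. This admits logarithms, which are rarely polynomials; \<open>v\<close>
  is the truncation of \<open>u\<close> that lies in \<open>U0 n\<close>.\<close>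

lemma exp_coneI:
  assumes "n \<ge> 1" "z \<in> aff_space (n + 1)" "c \<noteq> 0" "u $ 0 = 0" "u $ n = 0"
    and z: "\<And>j. j \<le> n \<Longrightarrow> z j = c * fps_E u $ j"
  shows "z \<in> exp_cone n"
proof -
  define v where "v = (\<Sum>i=1..n - 1. monom (u $ i) i)"
  have v: "coeff v j = (if 1 \<le> j \<and> j < n then u $ j else 0)" for j
    using assms(1) by (auto simp: v_def coeff_sum)
  have "v \<in> U0 n"
    using v assms(1) by (auto simp: U0_iff)
  moreover have "z = coeff (smult c (trunc_exp n v))"
  proof
    fix j
    have uv: "u $ i = coeff v i" if "i \<le> n" for i
      using assms(4,5) v that by (cases "i = 0"; cases "i = n") auto
    have "fps_E u $ j = fps_E (fps_of_poly v) $ j" if "j \<le> n"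
      by (rule fps_E_nth_cong[OF _ that]) (simp add: uv)
    then show "z j = coeff (smult c (trunc_exp n v)) j"
      using assms v by (auto simp: coeff_trunc_exp aff_space_def)
  qed
  ultimately show ?thesis
    using assms(3) unfolding exp_cone_def by blast
qed

lemma exp_coneE:
  assumes "z \<in> exp_cone n" "n \<ge> 1"
  obtains c u where "z \<in> aff_space (n + 1)" "c \<noteq> 0" "u $ 0 = 0" "\<And>j. j \<ge> n \<Longrightarrow> u $ j = 0"
    "\<And>j. j \<le> n \<Longrightarrow> z j = c * fps_E u $ j"
proof -
  obtain c u where cu: "c \<noteq> 0" "u \<in> U0 n" "z = coeff (smult c (trunc_exp n u))"
    using assms unfolding exp_cone_def by auto
  have u: "coeff u 0 = 0" "\<forall>j\<ge>n. coeff u j = 0"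
    using cu(2) assms(2) by (auto simp: U0_iff)
  show thesis
    by (rule that[of c "fps_of_poly u"]) (use cu u in \<open>auto simp: aff_space_def coeff_trunc_exp\<close>)
qed

text \<open>Exponential and logarithm are mutually inverse modulo x^(n+1), so after scaling to
  constant term 1 the only condition left is that the logarithm has no x^n term.\<close>

lemma exp_cone_eq:
  assumes "n \<ge> 1"
  shows "exp_cone n = {z \<in> aff_space (n + 1). z 0 \<noteq> 0 \<and> log_form n z = 0}"
proof (intro equalityI subsetI)
  fix z assume "z \<in> exp_cone n"
  then obtain c u where *: "z \<in> aff_space (n + 1)" "c \<noteq> 0" "u $ 0 = 0" "\<And>j. j \<ge> n \<Longrightarrow> u $ j = 0"
      "\<And>j. j \<le> n \<Longrightarrow> z j = c * fps_E u $ j"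
    using assms by (rule exp_coneE) blast
  then have z0: "z 0 = c" by simp
  have "fps_L (fps_const (1 / z 0) * Abs_fps z) $ n = fps_L (fps_E u) $ n"
    by (rule fps_L_nth_cong[where n = n]) (use * z0 in auto)
  then have "log_form n z = 0"
    using assms * z0 by (simp add: log_form_eq fps_L_E)
  then show "z \<in> {z \<in> aff_space (n + 1). z 0 \<noteq> 0 \<and> log_form n z = 0}"
    using * z0 by auto
next
  fix z assume "z \<in> {z \<in> aff_space (n + 1). z 0 \<noteq> 0 \<and> log_form n z = 0}"
  then have z: "z \<in> aff_space (n + 1)" "z 0 \<noteq> 0" "log_form n z = 0" by auto
  define w where "w = fps_const (1 / z 0) * Abs_fps z"
  have "w $ 0 = 1" using z by (simp add: w_def)
  show "z \<in> exp_cone n"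
  proof (rule exp_coneI[OF assms z(1,2)])
    show "fps_L w $ n = 0"
      using z assms by (simp add: log_form_eq w_def)
    show "z j = z 0 * fps_E (fps_L w) $ j" for j
      unfolding fps_E_L[OF \<open>w $ 0 = 1\<close>] using z by (simp add: w_def)
  qed simp
qed

section \<open>Evaluation and homogeneity of polynomials\<close>

definition mono_eval :: "('v \<Rightarrow> 'b::comm_ring_1) \<Rightarrow> ('v \<Rightarrow>\<^sub>0 nat) \<Rightarrow> 'b" where
  "mono_eval w \<mu> = (\<Prod>i\<in>Poly_Mapping.keys \<mu>. w i ^ Poly_Mapping.lookup \<mu> i)"

text \<open>Coefficients are transported along \<open>h\<close> so that one construction covers
  evaluation at a point, restriction to a parametrized curve, passage to a univariate polynomial in
  one variable, and specialization of parameters. The locale \<open>coeff_hom\<close> proves the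
  homomorphism laws once for all of them.\<close>

definition mpoly_map_eval ::
  "('a::comm_ring_1 \<Rightarrow> 'b::comm_ring_1) \<Rightarrow> ('v \<Rightarrow> 'b) \<Rightarrow> ('v, 'a) mpoly \<Rightarrow> 'b" where
  "mpoly_map_eval h w f =
     (\<Sum>\<mu>\<in>Poly_Mapping.keys f. h (Poly_Mapping.lookup f \<mu>) * mono_eval w \<mu>)"

abbreviation mconst :: "'a::zero \<Rightarrow> ('v, 'a) mpoly" where
  "mconst c \<equiv> Poly_Mapping.single 0 c"

definition mvar :: "'v \<Rightarrow> ('v, 'a::comm_ring_1) mpoly" where
  "mvar i = Poly_Mapping.single (Poly_Mapping.single i 1) 1"

lemma meval_eq: "meval f z = mpoly_map_eval (\<lambda>c. c) z f"
  by (simp add: meval_def mpoly_map_eval_def mono_eval_def)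

lemma mono_eval_superset:
  assumes "finite S" "Poly_Mapping.keys \<mu> \<subseteq> S"
  shows "mono_eval w \<mu> = (\<Prod>i\<in>S. w i ^ Poly_Mapping.lookup \<mu> i)"
  unfolding mono_eval_def
  by (rule prod.mono_neutral_left) (use assms in \<open>auto simp: in_keys_iff\<close>)

lemma mono_eval_0 [simp]: "mono_eval w 0 = 1"
  by (simp add: mono_eval_def)

lemma mono_eval_single [simp]: "mono_eval w (Poly_Mapping.single i k) = w i ^ k"
  by (cases "k = 0") (simp_all add: mono_eval_def)

lemma mono_eval_add: "mono_eval w (\<mu> + \<nu>) = mono_eval w \<mu> * mono_eval w \<nu>"
proof -
  let ?S = "Poly_Mapping.keys \<mu> \<union> Poly_Mapping.keys \<nu>"
  have "Poly_Mapping.keys (\<mu> + \<nu>) \<subseteq> ?S" by (rule keys_add)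
  then show ?thesis
    by (subst (1 2 3) mono_eval_superset[of ?S])
      (auto simp: lookup_add power_add prod.distrib)
qed

lemma mpoly_sum_monomials:
  "f = (\<Sum>\<mu>\<in>Poly_Mapping.keys f. Poly_Mapping.single \<mu> (Poly_Mapping.lookup f \<mu>))"
  by (rule poly_mapping_eqI)
    (auto simp: lookup_sum lookup_single when_def in_keys_iff sum.delta)

lemma single_eq_const_mono:
  fixes c :: "'a::comm_ring_1" and \<mu> :: "'v \<Rightarrow>\<^sub>0 nat"
  shows "Poly_Mapping.single \<mu> c = mconst c * mono_eval mvar \<mu>"
proof -
  have pow: "mvar i ^ k = (Poly_Mapping.single (Poly_Mapping.single i k) 1 :: ('v, 'a) mpoly)" for i k
    by (induction k) (auto simp: mvar_def mult_single single_add[symmetric])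
  have "(\<Prod>i\<in>S. mvar i ^ Poly_Mapping.lookup \<mu> i) =
      (Poly_Mapping.single (\<Sum>i\<in>S. Poly_Mapping.single i (Poly_Mapping.lookup \<mu> i)) 1 :: ('v, 'a) mpoly)"
    if "finite S" for S
    using that by induction (auto simp: pow mult_single)
  moreover have "(\<Sum>i\<in>Poly_Mapping.keys \<mu>. Poly_Mapping.single i (Poly_Mapping.lookup \<mu> i)) = \<mu>"
    by (rule poly_mapping_eqI)
      (auto simp: lookup_sum lookup_single when_def in_keys_iff sum.delta)
  ultimately show ?thesis
    by (simp add: mono_eval_def mult_single)
qed

lemma mconst_mult: "(mconst (a * b) :: ('v, 'a::comm_ring_1) mpoly) = mconst a * mconst b"
  by (simp add: mult_single)

locale coeff_hom =
  fixes h :: "'a::comm_ring_1 \<Rightarrow> 'b::comm_ring_1"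
  assumes hom_0: "h 0 = 0" and hom_1: "h 1 = 1"
    and hom_add: "h (a + b) = h a + h b" and hom_mult: "h (a * b) = h a * h b"
begin

lemma eval_single: "mpoly_map_eval h w (Poly_Mapping.single \<mu> c) = h c * mono_eval w \<mu>"
  by (cases "c = 0") (simp_all add: mpoly_map_eval_def hom_0)

lemma eval_0: "mpoly_map_eval h w 0 = 0"
  by (simp add: mpoly_map_eval_def)

lemma eval_const: "mpoly_map_eval h w (mconst c) = h c"
  by (simp add: eval_single)

lemma eval_1: "mpoly_map_eval h w 1 = 1"
  using eval_const[of w 1] by (simp add: hom_1)

lemma eval_var: "mpoly_map_eval h w (mvar i) = w i"
  by (simp add: eval_single mvar_def hom_1)

lemma eval_add: "mpoly_map_eval h w (f + g) = mpoly_map_eval h w f + mpoly_map_eval h w g"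
  unfolding mpoly_map_eval_def
  by (rule setsum_keys_plus_distrib) (auto simp: hom_0 hom_add distrib_right)

lemma eval_sum: "mpoly_map_eval h w (\<Sum>i\<in>S. F i) = (\<Sum>i\<in>S. mpoly_map_eval h w (F i))"
  by (induction S rule: infinite_finite_induct) (auto simp: eval_0 eval_add)

lemma eval_mult: "mpoly_map_eval h w (f * g) = mpoly_map_eval h w f * mpoly_map_eval h w g"
proof -
  have "mpoly_map_eval h w (f * g) = mpoly_map_eval h w
      ((\<Sum>\<mu>\<in>Poly_Mapping.keys f. Poly_Mapping.single \<mu> (Poly_Mapping.lookup f \<mu>)) *
       (\<Sum>\<nu>\<in>Poly_Mapping.keys g. Poly_Mapping.single \<nu> (Poly_Mapping.lookup g \<nu>)))"
    by (simp flip: mpoly_sum_monomials)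
  also have "\<dots> = (\<Sum>\<mu>\<in>Poly_Mapping.keys f. \<Sum>\<nu>\<in>Poly_Mapping.keys g.
      (h (Poly_Mapping.lookup f \<mu>) * mono_eval w \<mu>) * (h (Poly_Mapping.lookup g \<nu>) * mono_eval w \<nu>))"
    unfolding sum_product eval_sum mult_single eval_single mono_eval_add hom_mult
    by (simp add: mult_ac)
  also have "\<dots> = mpoly_map_eval h w f * mpoly_map_eval h w g"
    by (simp add: mpoly_map_eval_def sum_product)
  finally show ?thesis .
qed

lemma eval_power: "mpoly_map_eval h w (f ^ k) = mpoly_map_eval h w f ^ k"
  by (induction k) (auto simp: eval_1 eval_mult)

lemma hom_sum: "h (\<Sum>i\<in>S. F i) = (\<Sum>i\<in>S. h (F i))"
  by (induction S rule: infinite_finite_induct) (auto simp: hom_0 hom_add)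

lemma hom_prod: "h (\<Prod>i\<in>S. F i) = (\<Prod>i\<in>S. h (F i))"
  by (induction S rule: infinite_finite_induct) (auto simp: hom_1 hom_mult)

lemma hom_power: "h (a ^ k) = h a ^ k"
  by (induction k) (auto simp: hom_1 hom_mult)

lemma hom_mpoly_map_eval:
  "h (mpoly_map_eval k w f) = mpoly_map_eval (\<lambda>c. h (k c)) (\<lambda>i. h (w i)) f"
  by (simp add: mpoly_map_eval_def mono_eval_def hom_sum hom_mult hom_prod hom_power)

lemma eval_fps_power_nth:
  "mpoly_map_eval h w ((F ^ k) $ m) = (Abs_fps (\<lambda>i. mpoly_map_eval h w (F $ i)) ^ k) $ m"
  by (induction k arbitrary: m) (auto simp: fps_mult_nth eval_0 eval_1 eval_sum eval_mult)

lemmas eval_simps = eval_0 eval_1 eval_const eval_var eval_add eval_sum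
  eval_mult eval_power

end

interpretation meval: coeff_hom "\<lambda>c::'a::comm_ring_1. c"
  by unfold_locales auto

interpretation mconst: coeff_hom "mconst :: 'a::comm_ring_1 \<Rightarrow> ('v, 'a) mpoly"
  by unfold_locales (simp_all only: single_add mconst_mult single_zero single_one)

interpretation pconst: coeff_hom "\<lambda>c::'a::comm_ring_1. [:c:]"
  by unfold_locales auto

interpretation mpconst: coeff_hom "\<lambda>c::'a::comm_ring_1. [:mconst c :: ('v, 'a) mpoly:]"
  by unfold_locales (auto simp: single_add mult_single mult.commute)

lemmas meval_simps = meval.eval_simps[folded meval_eq]

lemma poly_mono_eval: "poly (mono_eval w \<mu>) t = mono_eval (\<lambda>i. poly (w i) t) \<mu>"
  by (simp add: mono_eval_def poly_prod)

lemma poly_mpoly_map_eval: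
  "poly (mpoly_map_eval h w f) t = mpoly_map_eval (\<lambda>c. poly (h c) t) (\<lambda>i. poly (w i) t) f"
  by (simp add: mpoly_map_eval_def poly_sum poly_mono_eval)

lemma meval_poly_curve: "poly (mpoly_map_eval (\<lambda>c. [:c:]) w f) t = meval f (\<lambda>i. poly (w i) t)"
  by (simp add: poly_mpoly_map_eval meval_eq)

lemma mpoly_map_eval_mconst_mvar: "mpoly_map_eval mconst mvar f = f"
  unfolding mpoly_map_eval_def by (subst (3) mpoly_sum_monomials) (simp flip: single_eq_const_mono)

text \<open>Only the variables in \<open>J\<close> contribute to the degree. Forms take
  \<open>J = V\<close>, relative forms count the projective coordinates only, and
  \<open>J = {}\<close> with degree 0 expresses the bare condition that the variables lie in
  \<open>V\<close>.\<close>

definition homogeneous_mpolys :: "'v set \<Rightarrow> 'v set \<Rightarrow> nat \<Rightarrow> ('v, 'a::comm_ring_1) mpoly set" where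
  "homogeneous_mpolys V J d =
     {f. \<forall>\<mu>\<in>Poly_Mapping.keys f. Poly_Mapping.keys \<mu> \<subseteq> V \<and> (\<Sum>j\<in>J. Poly_Mapping.lookup \<mu> j) = d}"

lemma forms_eq: "forms n d = homogeneous_mpolys {..n} {..n} d"
  by (auto simp: forms_def homogeneous_mpolys_def mvars_def)

lemma relative_forms_eq:
  "relative_forms m n d = homogeneous_mpolys ({..<m} <+> {..n}) (Inr ` {..n}) d"
  by (auto simp: relative_forms_def homogeneous_mpolys_def mvars_def sum.reindex)

lemma homogeneous_0: "0 \<in> homogeneous_mpolys V J d"
  by (simp add: homogeneous_mpolys_def)

lemma homogeneous_const: "mconst c \<in> homogeneous_mpolys V J 0"
  by (simp add: homogeneous_mpolys_def)

lemma homogeneous_1: "1 \<in> homogeneous_mpolys V J 0"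
  using homogeneous_const[of 1] by simp

lemma homogeneous_var:
  assumes "i \<in> V" "finite J"
  shows "mvar i \<in> homogeneous_mpolys V J (if i \<in> J then 1 else 0)"
  using assms by (auto simp: homogeneous_mpolys_def mvar_def lookup_single when_def)

lemma homogeneous_add:
  "f \<in> homogeneous_mpolys V J d \<Longrightarrow> g \<in> homogeneous_mpolys V J d \<Longrightarrow> f + g \<in> homogeneous_mpolys V J d"
  using keys_add[of f g] unfolding homogeneous_mpolys_def by blast

lemma homogeneous_sum:
  "(\<And>i. i \<in> S \<Longrightarrow> F i \<in> homogeneous_mpolys V J d) \<Longrightarrow> (\<Sum>i\<in>S. F i) \<in> homogeneous_mpolys V J d"
  by (induction S rule: infinite_finite_induct) (auto simp: homogeneous_0 homogeneous_add)

lemma homogeneous_mult: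
  assumes "f \<in> homogeneous_mpolys V J d" "g \<in> homogeneous_mpolys V J e"
  shows "f * g \<in> homogeneous_mpolys V J (d + e)"
proof -
  have "Poly_Mapping.keys \<mu> \<subseteq> V \<and> (\<Sum>j\<in>J. Poly_Mapping.lookup \<mu> j) = d + e"
    if \<mu>: "\<mu> \<in> Poly_Mapping.keys (f * g)" for \<mu>
  proof -
    obtain a b where "a \<in> Poly_Mapping.keys f" "b \<in> Poly_Mapping.keys g" "\<mu> = a + b"
      using \<mu> keys_mult[of f g] by blast
    then show ?thesis
      using assms keys_add[of a b]
      by (auto simp: homogeneous_mpolys_def lookup_add sum.distrib) blast+
  qed
  then show ?thesis by (simp add: homogeneous_mpolys_def)
qed

lemma homogeneous_power:
  "f \<in> homogeneous_mpolys V J d \<Longrightarrow> f ^ k \<in> homogeneous_mpolys V J (k * d)"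
  by (induction k) (auto simp: homogeneous_1 homogeneous_mult)

lemma homogeneous_power_nth:
  assumes "\<And>i. i \<le> n \<Longrightarrow> F $ i \<in> homogeneous_mpolys V J d" "m \<le> n"
  shows "(F ^ k) $ m \<in> homogeneous_mpolys V J (k * d)"
  using assms(2)
proof (induction k arbitrary: m)
  case 0
  then show ?case by (auto simp: homogeneous_0 homogeneous_1)
next
  case (Suc k)
  then show ?case
    using assms(1) by (auto simp: fps_mult_nth intro!: homogeneous_sum homogeneous_mult)
qed

lemma meval_scale:
  assumes "f \<in> forms n d"
  shows "meval f (\<lambda>i. c * z i) = c ^ d * meval f z"
proof -
  have "mono_eval (\<lambda>i. c * z i) \<mu> = c ^ d * mono_eval z \<mu>" if "\<mu> \<in> Poly_Mapping.keys f" for \<mu>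
  proof -
    have "Poly_Mapping.keys \<mu> \<subseteq> {..n}" "(\<Sum>i\<le>n. Poly_Mapping.lookup \<mu> i) = d"
      using assms that by (auto simp: forms_eq homogeneous_mpolys_def)
    then show ?thesis
      by (simp add: mono_eval_superset[of "{..n}"] power_mult_distrib prod.distrib flip: power_sum)
  qed
  then show ?thesis
    by (simp add: meval_eq mpoly_map_eval_def sum_distrib_left mult.left_commute)
qed

definition log_mpoly :: "nat \<Rightarrow> (nat, 'a::field_char_0) mpoly" where
  "log_mpoly n =
     (\<Sum>k=1..n. mconst ((-1) ^ (k - 1) / of_nat k) * mvar 0 ^ (n - k) * (fps_tail mvar ^ k) $ n)"

lemma (in coeff_hom) eval_fps_tail_power:
  "mpoly_map_eval h w ((fps_tail mvar ^ k) $ m) = (fps_tail w ^ k) $ m"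
proof -
  have "Abs_fps (\<lambda>i. mpoly_map_eval h w (fps_tail mvar $ i)) = fps_tail w"
    by (auto simp: fps_tail_def fps_eq_iff eval_0 eval_var)
  then show ?thesis by (simp add: eval_fps_power_nth)
qed

lemma meval_log_mpoly: "meval (log_mpoly n) z = log_form n z"
  by (simp add: log_mpoly_def meval_simps log_form_def meval.eval_fps_tail_power flip: meval_eq)
    (simp add: meval_eq meval.eval_fps_tail_power)

lemma log_mpoly_in_forms: "log_mpoly n \<in> forms n n"
  unfolding forms_eq log_mpoly_def
proof (rule homogeneous_sum)
  fix k assume k: "k \<in> {1..n}"
  let ?H = "homogeneous_mpolys {..n} {..n} :: nat \<Rightarrow> (nat, 'a) mpoly set"
  have v: "mvar i \<in> ?H 1" if "i \<le> n" for i
    using homogeneous_var[of i "{..n}" "{..n}"] that by simp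
  have "(fps_tail mvar ^ k) $ n \<in> ?H (k * 1)"
    by (rule homogeneous_power_nth[of n]) (auto simp: fps_tail_def homogeneous_0 v[simplified])
  moreover have "mvar 0 ^ (n - k) \<in> ?H ((n - k) * 1)"
    by (rule homogeneous_power) (rule v, simp)
  ultimately have "mconst ((-1) ^ (k - 1) / of_nat k) * mvar 0 ^ (n - k) * (fps_tail mvar ^ k) $ n \<in>
      ?H (0 + (n - k) * 1 + k * 1)"
    by (intro homogeneous_mult homogeneous_const)
  then show "mconst ((-1) ^ (k - 1) / of_nat k) * mvar 0 ^ (n - k) * (fps_tail mvar ^ k) $ n \<in> ?H n"
    using k by simp
qed

section \<open>Polynomials viewed as univariate in one chosen variable\<close>

definition poly_in_var :: "'v \<Rightarrow> ('v, 'a::comm_ring_1) mpoly \<Rightarrow> ('v, 'a) mpoly poly" where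
  "poly_in_var v = mpoly_map_eval (\<lambda>c. [:mconst c:]) (\<lambda>i. if i = v then [:0, 1:] else [:mvar i:])"

lemma poly_in_var_mult: "poly_in_var v (f * g) = poly_in_var v f * poly_in_var v g"
  by (simp add: poly_in_var_def mpconst.eval_mult)

lemma poly_poly_in_var: "poly (poly_in_var v f) x = mpoly_map_eval mconst (mvar(v := x)) f"
  by (auto simp: poly_in_var_def poly_mpoly_map_eval fun_upd_def intro!: arg_cong2[where f = "mpoly_map_eval mconst"])

lemma poly_poly_in_var_self: "poly (poly_in_var v f) (mvar v) = f"
  by (simp add: poly_poly_in_var mpoly_map_eval_mconst_mvar)

text \<open>The coefficients of \<open>poly_in_var v f\<close> still live in the full polynomial
  ring, so absence of \<open>v\<close> has to be recovered: if the result is constant, substituting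
  0 for \<open>v\<close> does not change \<open>f\<close>, yet it deletes every monomial that
  contains \<open>v\<close>.\<close>

lemma degree_poly_in_var_0D:
  fixes v :: 'v and f :: "('v, 'a::comm_ring_1) mpoly"
  assumes "degree (poly_in_var v f) = 0"
  shows "poly_in_var v f = [:f:]" "v \<notin> mvars f"
proof -
  obtain a where a: "poly_in_var v f = [:a:]"
    using assms by (rule degree_eq_zeroE)
  then show f: "poly_in_var v f = [:f:]"
    using poly_poly_in_var_self[of v f] by simp
  have "mono_eval (mvar(v := 0)) \<mu> = (if v \<in> Poly_Mapping.keys \<mu> then 0 else mono_eval mvar \<mu> :: ('v, 'a) mpoly)"
    for \<mu> :: "'v \<Rightarrow>\<^sub>0 nat"
  proof (cases "v \<in> Poly_Mapping.keys \<mu>")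
    case True
    then show ?thesis
      unfolding mono_eval_def by (auto simp: in_keys_iff power_0_left intro!: prod_zero bexI[of _ v])
  next
    case False
    then show ?thesis
      unfolding mono_eval_def by (auto intro!: prod.cong)
  qed
  then have "mconst c * mono_eval (mvar(v := 0)) \<mu> =
      (if v \<in> Poly_Mapping.keys \<mu> then 0 else Poly_Mapping.single \<mu> c)" for \<mu> and c :: 'a
    by (simp add: single_eq_const_mono[of \<mu> c])
  then have "mpoly_map_eval mconst (mvar(v := 0)) f = (\<Sum>\<mu>\<in>Poly_Mapping.keys f.
      if v \<in> Poly_Mapping.keys \<mu> then 0 else Poly_Mapping.single \<mu> (Poly_Mapping.lookup f \<mu>))"
    by (simp add: mpoly_map_eval_def)
  moreover have "f = mpoly_map_eval mconst (mvar(v := 0)) f"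
    using poly_poly_in_var[of v f 0] f by simp
  ultimately have f_eq: "f = (\<Sum>\<mu>\<in>Poly_Mapping.keys f.
      if v \<in> Poly_Mapping.keys \<mu> then 0 else Poly_Mapping.single \<mu> (Poly_Mapping.lookup f \<mu>))"
    by simp
  have "Poly_Mapping.lookup f \<nu> = 0" if "v \<in> Poly_Mapping.keys \<nu>" for \<nu>
    by (subst f_eq) (use that in \<open>auto simp: lookup_sum lookup_single when_def intro!: sum.neutral\<close>)
  then show "v \<notin> mvars f"
    unfolding mvars_def by (auto simp: in_keys_iff)
qed

section \<open>Irreducibility of the equation\<close>

text \<open>In a product of at least two series without constant term, each factor contributes
  degree at least 1, so none can contribute its coefficient in degree \<open>n\<close>.\<close>

lemma fps_power_nth_cong_below:
  fixes F G :: "'a::comm_ring_1 fps"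
  assumes "k \<ge> 2" "F $ 0 = 0" "G $ 0 = 0" "\<And>j. j < n \<Longrightarrow> F $ j = G $ j"
  shows "(F ^ k) $ n = (G ^ k) $ n"
proof -
  obtain l where k: "k = Suc l" "l \<ge> 1"
    using assms(1) by (cases k) auto
  have "F $ i * (F ^ l) $ (n - i) = G $ i * (G ^ l) $ (n - i)" if "i \<le> n" for i
  proof (cases "i = 0 \<or> i = n")
    case True
    then show ?thesis
      using assms k by (auto simp: fps_nth_power_0 power_0_left)
  next
    case False
    then have "(F ^ l) $ (n - i) = (G ^ l) $ (n - i)"
      by (intro fps_power_nth_cong[where n = "n - 1"] assms(4)) (use that in auto)
    then show ?thesis
      using False that assms(4)[of i] by simp
  qed
  then show ?thesis
    by (auto simp: k(1) fps_mult_nth intro!: sum.cong)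
qed

lemma degree_fps_power_nth:
  fixes F :: "'a::comm_ring_1 poly fps"
  assumes "\<And>i. degree (F $ i) \<le> d"
  shows "degree ((F ^ k) $ m) \<le> k * d"
proof (induction k arbitrary: m)
  case (Suc k)
  have "degree (F $ i * (F ^ k) $ (m - i)) \<le> d + k * d" for i
    by (rule order_trans[OF degree_mult_le add_mono[OF assms Suc]])
  then show ?case
    by (auto simp: fps_mult_nth intro!: degree_sum_le)
qed simp

lemma const_poly_power: "[:a::'a::comm_ring_1:] ^ k = [:a ^ k:]"
  using pconst.hom_power[of a k] by simp

lemma mvar_neq_0: "(mvar i :: ('v, 'a::comm_ring_1) mpoly) \<noteq> 0"
  by (metis mvar_def lookup_single_eq lookup_zero zero_neq_one)

text \<open>The last variable enters through the term \<open>k = 1\<close> alone, where its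
  coefficient is a power of the variable 0.\<close>

lemma poly_in_var_log_mpoly:
  assumes "n \<ge> 1"
  obtains a where "poly_in_var n (log_mpoly n :: (nat, 'a::field_char_0) mpoly) = [:a, mvar 0 ^ (n - 1):]"
proof -
  define w :: "nat \<Rightarrow> (nat, 'a) mpoly poly" where
    "w = (\<lambda>i. if i = n then [:0, 1:] else [:mvar i:])"
  define T where "T k = [:mconst ((-1) ^ (k - 1) / of_nat k):] * w 0 ^ (n - k) * (fps_tail w ^ k) $ n" for k
  have "poly_in_var n (log_mpoly n) = (\<Sum>k=1..n. T k)"
    by (simp add: poly_in_var_def log_mpoly_def mpconst.eval_simps mpconst.eval_fps_tail_power
        T_def flip: w_def)
  also have "{1..n} = insert 1 {2..n}" using assms by auto
  also have "(\<Sum>k\<in>insert 1 {2..n}. T k) = T 1 + (\<Sum>k=2..n. T k)"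
    by (subst sum.insert) auto
  finally have 1: "poly_in_var n (log_mpoly n) = T 1 + (\<Sum>k=2..n. T k)" .
  have w0: "w 0 = [:mvar 0:]" using assms by (simp add: w_def)
  have T1: "T 1 = [:0, mvar 0 ^ (n - 1):]"
    using assms by (simp add: T_def w0 fps_tail_def const_poly_power) (simp add: w_def)
  have "degree (T k) = 0" if "k \<in> {2..n}" for k
  proof -
    \<comment> \<open>For \<open>k \<ge> 2\<close> the entry \<open>w n\<close> can be replaced by
      0, and the remaining entries are constant in the chosen variable.\<close>
    have "(fps_tail w ^ k) $ n = (fps_tail (w(n := 0)) ^ k) $ n"
      by (rule fps_power_nth_cong_below) (use that in \<open>auto simp: fps_tail_def\<close>)
    moreover have "degree ((fps_tail (w(n := 0)) ^ k) $ n) \<le> k * 0"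
      by (rule degree_fps_power_nth) (auto simp: fps_tail_def w_def)
    ultimately obtain b where "(fps_tail w ^ k) $ n = [:b:]"
      by (metis degree_eq_zeroE le_zero_eq mult_zero_right)
    then show ?thesis by (simp add: T_def w0 const_poly_power)
  qed
  then have "degree (\<Sum>k=2..n. T k) = 0"
    by (metis degree_sum_le finite_atLeastAtMost le_zero_eq)
  then obtain b where "(\<Sum>k=2..n. T k) = [:b:]" by (rule degree_eq_zeroE)
  then have "poly_in_var n (log_mpoly n) = [:b, mvar 0 ^ (n - 1):]"
    unfolding 1 T1 by simp
  then show thesis by (rule that)
qed

text \<open>The tail is \<open>fps_X\<close>, whose k-th power has an x^n coefficient only for
  \<open>k = n\<close>; there the power of z_0 is trivial. Since the equation is a nonzero constant
  along this line, no factor of it can have a zero there.\<close>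

lemma log_form_line:
  assumes "n \<ge> 1"
  shows "log_form n (\<lambda>i. if i = 0 then t else if i = 1 then 1 else 0) = (-1) ^ (n - 1) / of_nat n"
proof -
  have X: "fps_tail (\<lambda>i. if i = 0 then t else if i = 1 then 1 else 0) = fps_X"
    by (auto simp: fps_tail_def fps_eq_iff fps_X_def)
  have "log_form n (\<lambda>i. if i = 0 then t else if i = 1 then 1 else 0) =
      (\<Sum>k=1..n. if k = n then (-1) ^ (n - 1) / of_nat n else 0)"
    unfolding log_form_def X by (rule sum.cong) auto
  then show ?thesis using assms by (simp add: sum.delta)
qed

text \<open>A factor free of the last variable divides the leading coefficient, a power of z_0, and
  so is a polynomial in z_0 alone. Along the line of \<open>log_form_line\<close> it takes the same
  values as that polynomial and never vanishes, so over an algebraically closed field it is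
  constant.\<close>

lemma factor_of_log_mpoly_unit:
  fixes g h :: "(nat, 'a::{alg_closed_field, field_char_0}) mpoly"
  assumes n: "n \<ge> 1" and fact: "log_mpoly n = g * h" and deg: "degree (poly_in_var n h) = 0"
  shows "h dvd 1"
proof -
  obtain a where a: "poly_in_var n (log_mpoly n :: (nat, 'a) mpoly) = [:a, mvar 0 ^ (n - 1):]"
    using poly_in_var_log_mpoly[OF n] by blast
  have "poly_in_var n (log_mpoly n) = smult h (poly_in_var n g)"
    using degree_poly_in_var_0D(1)[OF deg] by (simp add: fact poly_in_var_mult)
  then have "h * coeff (poly_in_var n g) 1 = mvar 0 ^ (n - 1)"
    using a by (metis coeff_pCons_0 coeff_pCons_Suc coeff_smult One_nat_def)
  then obtain g1 where g1: "h * g1 = mvar 0 ^ (n - 1)" by blast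
  define \<eta> where "\<eta> = mpoly_map_eval (\<lambda>c. [:c:])
    (\<lambda>i::nat. if i = 0 then [:0, 1:] else [:if i = 1 then 1 else 0:]) h"
  have root: "poly \<eta> t \<noteq> 0" for t
  proof -
    define z where "z = (\<lambda>i::nat. if i = 0 then t else if i = 1 then 1 else 0)"
    have "poly \<eta> t = meval h z"
      unfolding \<eta>_def meval_poly_curve by (intro arg_cong[where f = "meval h"]) (auto simp: z_def)
    moreover have "meval g z * meval h z = (-1) ^ (n - 1) / of_nat n"
      unfolding z_def log_form_line[OF n, of t, symmetric] meval_log_mpoly[symmetric] fact
      by (simp only: meval_simps)
    ultimately show ?thesis using n by auto
  qed
  then have "degree \<eta> = 0"
    using alg_closed_imp_poly_has_root by blast
  \<comment> \<open>Degrees in \<open>v\<close> add, and a power of z_0 has degree 0 in every other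
    variable.\<close>
  have nv: "v \<notin> mvars h" if "v \<noteq> 0" for v
  proof -
    have "poly_in_var v h * poly_in_var v g1 = [:mvar 0 ^ (n - 1):]"
      unfolding poly_in_var_mult[symmetric] g1 unfolding poly_in_var_def mpconst.eval_power mpconst.eval_var
      using that by (simp add: const_poly_power)
    moreover have "(mvar 0 ^ (n - 1) :: (nat, 'a) mpoly) \<noteq> 0"
      by (simp add: mvar_neq_0)
    ultimately have "degree (poly_in_var v h) + degree (poly_in_var v g1) = 0"
      by (metis degree_mult_eq degree_pCons_0 mult_eq_0_iff pCons_eq_0_iff)
    then show ?thesis by (simp add: degree_poly_in_var_0D(2))
  qed
  have keys: "\<mu> = Poly_Mapping.single 0 (Poly_Mapping.lookup \<mu> 0)" if "\<mu> \<in> Poly_Mapping.keys h" for \<mu>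
  proof (rule poly_mapping_eqI)
    fix k
    have "Poly_Mapping.lookup \<mu> k = 0" if "k \<noteq> 0"
      using \<open>\<mu> \<in> Poly_Mapping.keys h\<close> nv[OF that]
      by (simp add: mvars_def in_keys_iff)
    then show "Poly_Mapping.lookup \<mu> k = Poly_Mapping.lookup (Poly_Mapping.single 0 (Poly_Mapping.lookup \<mu> 0)) k"
      by (cases "k = 0") (simp_all add: lookup_single)
  qed
  \<comment> \<open>As only z_0 occurs in \<open>h\<close>, restriction to the line loses no
    information: the coefficients of \<eta> are those of \<open>h\<close>.\<close>
  have "\<eta> = (\<Sum>\<mu>\<in>Poly_Mapping.keys h. monom (Poly_Mapping.lookup h \<mu>) (Poly_Mapping.lookup \<mu> 0))"
    unfolding \<eta>_def mpoly_map_eval_def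
  proof (rule sum.cong)
    fix \<mu> assume "\<mu> \<in> Poly_Mapping.keys h"
    then obtain k where k: "\<mu> = Poly_Mapping.single 0 k" using keys by blast
    show "[:Poly_Mapping.lookup h \<mu>:] *
        mono_eval (\<lambda>i. if i = 0 then [:0, 1:] else [:if i = 1 then 1 else 0:]) \<mu> =
        monom (Poly_Mapping.lookup h \<mu>) (Poly_Mapping.lookup \<mu> 0)"
      unfolding k mono_eval_single lookup_single_eq by (simp add: monom_altdef)
  qed simp
  moreover have "Poly_Mapping.lookup \<mu> 0 = k \<longleftrightarrow> \<mu> = Poly_Mapping.single 0 k" if "\<mu> \<in> Poly_Mapping.keys h" for \<mu> k
    by (metis keys[OF that] lookup_single_eq)
  ultimately have "coeff \<eta> k = (\<Sum>\<mu>\<in>Poly_Mapping.keys h.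
      if \<mu> = Poly_Mapping.single 0 k then Poly_Mapping.lookup h \<mu> else 0)" for k
    by (simp add: coeff_sum cong: sum.cong)
  then have coeff: "coeff \<eta> k = Poly_Mapping.lookup h (Poly_Mapping.single 0 k)" for k
    by (auto simp: sum.delta in_keys_iff)
  have "\<mu> = 0" if "\<mu> \<in> Poly_Mapping.keys h" for \<mu>
  proof -
    have "coeff \<eta> (Poly_Mapping.lookup \<mu> 0) \<noteq> 0"
      using that keys[OF that] by (simp add: coeff in_keys_iff)
    then have "Poly_Mapping.lookup \<mu> 0 = 0"
      using \<open>degree \<eta> = 0\<close> le_degree by fastforce
    then show ?thesis using keys[OF that] by simp
  qed
  then have h: "h = mconst (Poly_Mapping.lookup h 0)"
    by (intro poly_mapping_eqI) (auto simp: lookup_single when_def in_keys_iff)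
  have "h \<noteq> 0"
    using root[of 0] by (auto simp: \<eta>_def pconst.eval_0)
  then have "Poly_Mapping.lookup h 0 \<noteq> 0" using h by auto
  then have "1 = h * mconst (1 / Poly_Mapping.lookup h 0)"
    by (subst h) (simp add: mult_single)
  then show ?thesis by (rule dvdI)
qed

lemma irreducible_log_mpoly:
  assumes n: "n \<ge> 1"
  shows "irreducible (log_mpoly n :: (nat, 'a::{alg_closed_field, field_char_0}) mpoly)"
proof (rule irreducibleI)
  let ?f = "log_mpoly n :: (nat, 'a) mpoly"
  have "log_form n (\<lambda>i. if i = 0 then 1 else if i = 1 then 1 else 0) \<noteq> (0::'a)"
    using log_form_line[OF n, of "1::'a"] n by auto
  then show f0: "?f \<noteq> 0"
    by (metis meval_log_mpoly meval_simps(1))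
  show "\<not> ?f dvd 1"
  proof
    assume "?f dvd 1"
    then obtain g where "1 = ?f * g" by (rule dvdE)
    then have "log_form n (\<lambda>i. 0) * meval g (\<lambda>i. 0) = (1::'a)"
      by (metis meval_log_mpoly meval_simps(2,7))
    moreover have "log_form n (\<lambda>i. 0) = (0::'a)"
      unfolding log_form_def fps_tail_def by (auto simp: fps_zero_def[symmetric] power_0_left intro!: sum.neutral)
    ultimately show False by simp
  qed
  fix g h assume gh: "?f = g * h"
  obtain a where a: "poly_in_var n ?f = [:a, mvar 0 ^ (n - 1):]"
    using poly_in_var_log_mpoly[OF n] by blast
  have "(mvar 0 ^ (n - 1) :: (nat, 'a) mpoly) \<noteq> 0"
    by (simp add: mvar_neq_0)
  \<comment> \<open>Degree 1 in the last variable cannot be shared, so one of the two factors is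
    free of it.\<close>
  then have "degree (poly_in_var n g * poly_in_var n h) = 1" "poly_in_var n g * poly_in_var n h \<noteq> 0"
    using a gh by (auto simp: poly_in_var_mult)
  then have "degree (poly_in_var n g) + degree (poly_in_var n h) = 1"
    by (metis degree_mult_eq mult_eq_0_iff)
  then consider "degree (poly_in_var n g) = 0" | "degree (poly_in_var n h) = 0" by linarith
  then show "g dvd 1 \<or> h dvd 1"
    using factor_of_log_mpoly_unit[OF n] gh by (metis mult.commute)
qed

section \<open>The closure of the exponential cone\<close>

lemma prod_linear_dvd_power:
  fixes q :: "'a::field poly"
  assumes "\<And>x. x \<in># A \<Longrightarrow> poly q x = 0"
  shows "(\<Prod>x\<in>#A. [:-x, 1:]) dvd q ^ size A"
  using assms
proof (induction A)
  case (add x A)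
  have "[:-x, 1:] dvd q"
    using add.prems by (simp add: poly_eq_0_iff_dvd)
  then have "[:-x, 1:] * (\<Prod>x\<in>#A. [:-x, 1:]) dvd q * q ^ size A"
    using add by (intro mult_dvd_mono) auto
  then show ?case by (simp only: image_mset_add_mset prod_mset.add_mset size_add_mset power_Suc)
qed simp

text \<open>A univariate Nullstellensatz: \<open>p\<close> splits into linear factors, each of which
  divides \<open>q\<close>, and the exponent \<open>degree p\<close> provides one copy of
  \<open>q\<close> per factor, whatever the multiplicities.\<close>

lemma dvd_power_degree_of_roots:
  fixes p q :: "'a::alg_closed_field poly"
  assumes "p \<noteq> 0" "\<And>x. poly p x = 0 \<Longrightarrow> poly q x = 0"
  shows "p dvd q ^ degree p"
proof -
  obtain A where A: "size A = degree p" "p = smult (lead_coeff p) (\<Prod>x\<in>#A. [:-x, 1:])"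
    using alg_closed_imp_factorization[OF assms(1)] by blast
  have "poly p x = 0" if "x \<in># A" for x
    by (subst A(2)) (use that in \<open>auto simp: poly_prod_mset\<close>)
  then have "(\<Prod>x\<in>#A. [:-x, 1:]) dvd q ^ degree p"
    using prod_linear_dvd_power[of A q] assms(2) A(1) by auto
  then show ?thesis
    using A(2) assms(1) by (metis leading_coeff_0_iff smult_dvd)
qed

text \<open>For \<open>\<epsilon> \<noteq> 0\<close> the specialization of \<open>F\<close> divides that of \<open>G\<^sup>n\<close>, so the remainder of \<open>G\<^sup>n\<close> modulo
  \<open>F\<close> vanishes for all \<open>\<epsilon> \<noteq> 0\<close>, hence identically.\<close>

lemma specialization_vanishes_if_vanishes_on_roots:
  fixes F G :: "'a::{alg_closed_field, field_char_0} poly poly"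
  assumes deg: "degree F = n" "n \<ge> 1" and lead: "coeff F n = [:c:]" "c \<noteq> 0"
    and van: "\<And>\<epsilon> y. \<epsilon> \<noteq> 0 \<Longrightarrow> poly (map_poly (\<lambda>p. poly p \<epsilon>) F) y = 0 \<Longrightarrow>
      poly (map_poly (\<lambda>p. poly p \<epsilon>) G) y = 0"
    and root: "poly (map_poly (\<lambda>p. poly p 0) F) y = 0"
  shows "poly (map_poly (\<lambda>p. poly p 0) G) y = 0"
proof -
  define s where "s \<epsilon> = map_poly (\<lambda>p. poly p \<epsilon>)" for \<epsilon> :: 'a
  have cs: "coeff (s \<epsilon> P) i = poly (coeff P i) \<epsilon>" for \<epsilon> P i
    by (simp add: s_def coeff_map_poly)
  interpret s: coeff_hom "s \<epsilon>" for \<epsilon>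
    by unfold_locales (auto simp: poly_eq_iff cs coeff_mult poly_sum coeff_1)
  have s_smult: "s \<epsilon> (smult a P) = smult (poly a \<epsilon>) (s \<epsilon> P)" for \<epsilon> a P
    by (simp add: poly_eq_iff cs)
  \<comment> \<open>A leading coefficient that is a nonzero constant survives every
    specialization.\<close>
  have degs: "degree (s \<epsilon> F) = n" for \<epsilon>
  proof (rule antisym)
    show "degree (s \<epsilon> F) \<le> n"
      using deg(1) by (auto intro!: degree_le simp: cs coeff_eq_0)
    show "n \<le> degree (s \<epsilon> F)"
      by (rule le_degree) (simp add: cs lead)
  qed
  \<comment> \<open>\<open>N\<close> is the exponent of the leading coefficient in pseudo-division.
    That coefficient is the constant \<open>c\<close>, so its power can be discarded at the
    end.\<close>
  define N where "N = Suc (degree (G ^ n)) - degree F"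
  obtain q r where qr: "pseudo_divmod (G ^ n) F = (q, r)" by force
  have F0: "F \<noteq> 0" using deg by auto
  have div: "smult ([:c:] ^ N) (G ^ n) = F * q + r" and r: "r = 0 \<or> degree r < n"
    using pseudo_divmod[OF F0 qr] deg lead by (simp_all add: N_def)
  have sdiv: "smult (c ^ N) (s \<epsilon> G ^ n) = s \<epsilon> F * s \<epsilon> q + s \<epsilon> r" for \<epsilon>
    using arg_cong[OF div, of "s \<epsilon>"] by (simp add: s_smult s.hom_add s.hom_mult s.hom_power poly_power)
  have "s \<epsilon> r = 0" if "\<epsilon> \<noteq> 0" for \<epsilon>
  proof (rule ccontr)
    assume *: "s \<epsilon> r \<noteq> 0"
    have "s \<epsilon> F \<noteq> 0" using degs[of \<epsilon>] deg(2) by auto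
    then have "s \<epsilon> F dvd s \<epsilon> G ^ n"
      using dvd_power_degree_of_roots[of "s \<epsilon> F" "s \<epsilon> G"] van[OF that] degs[of \<epsilon>]
      by (simp add: s_def)
    then have "s \<epsilon> F dvd smult (c ^ N) (s \<epsilon> G ^ n)"
      by (rule dvd_smult)
    then have "s \<epsilon> F dvd s \<epsilon> r"
      unfolding sdiv by (simp add: dvd_add_right_iff)
    then have "n \<le> degree (s \<epsilon> r)"
      using dvd_imp_degree_le[OF _ *] degs by metis
    moreover have "degree (s \<epsilon> r) \<le> degree r"
      by (auto intro!: degree_le simp: cs coeff_eq_0)
    ultimately show False using r * by (auto simp: s.hom_0)
  qed
  \<comment> \<open>The factor \<open>[:0, 1:]\<close> supplies the missing zero at \<epsilon> = 0,
    so that the product vanishes at all points of an infinite field.\<close>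
  then have "poly ([:0, 1:] * coeff r i) \<epsilon> = 0" for i \<epsilon>
    by (cases "\<epsilon> = 0") (auto simp flip: cs)
  then have "[:0, 1:] * coeff r i = 0" for i
    using poly_all_0_iff_0 by blast
  then have "coeff r i = 0" for i
    by (metis mult_eq_0_iff pCons_eq_0_iff one_neq_zero)
  then have "r = 0" by (intro poly_eqI) simp
  then have "smult (c ^ N) (s 0 G ^ n) = s 0 F * s 0 q"
    using sdiv[of 0] by (simp add: s.hom_0)
  then have "poly (smult (c ^ N) (s 0 G ^ n)) y = poly (s 0 F * s 0 q) y" by simp
  then show ?thesis
    using root lead deg(2) by (simp add: s_def poly_power)
qed

lemma degree_fps_tail_power_nth:
  fixes w :: "nat \<Rightarrow> 'a::comm_ring_1 poly"
  assumes "w 1 = [:0, 1:]" "\<And>i. i \<ge> 2 \<Longrightarrow> degree (w i) = 0"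
  shows "degree ((fps_tail w ^ k) $ m) \<le> k"
proof -
  have "degree ((fps_tail w ^ k) $ m) \<le> k * 1"
  proof (rule degree_fps_power_nth)
    fix i :: nat
    consider "i = 0" | "i = 1" | "i \<ge> 2" by linarith
    then show "degree (fps_tail w $ i) \<le> 1"
      using assms by cases (auto simp: fps_tail_def)
  qed
  then show ?thesis by simp
qed

text \<open>For \<open>z 0 = 0\<close> the factor \<open>z 0 ^ (n - k)\<close> kills every term
  except \<open>k = n\<close>.\<close>

lemma log_form_boundary:
  fixes z :: "nat \<Rightarrow> 'a::field_char_0"
  assumes "n \<ge> 1" "z 0 = 0"
  shows "log_form n z = (-1) ^ (n - 1) / of_nat n * z 1 ^ n"
proof -
  have "(fps_tail z ^ n) $ n = z 1 ^ n"
    by (subst startsby_zero_power_nth_same) (auto simp: fps_tail_def)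
  moreover have "log_form n z =
      (\<Sum>k=1..n. if k = n then (-1) ^ (n - 1) / of_nat n * (fps_tail z ^ n) $ n else 0)"
    unfolding log_form_def by (rule sum.cong) (use assms in \<open>auto simp: power_0_left\<close>)
  ultimately show ?thesis
    using assms by (simp add: sum.delta)
qed

text \<open>With \<open>z\<^sub>0 = \<epsilon>\<close>, \<open>z\<^sub>1 = Y\<close> and the other coordinates fixed, the equation becomes a polynomial in \<open>Y\<close>
  over \<open>\<K>[\<epsilon>]\<close> whose leading coefficient is constant.\<close>

lemma exp_cone_dense_at_boundary:
  fixes z :: "nat \<Rightarrow> 'a::{alg_closed_field, field_char_0}"
  assumes n: "n \<ge> 1" and z: "z \<in> aff_space (n + 1)" "z 0 = 0" "z 1 = 0" and g: "meval g z \<noteq> 0"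
  shows "\<exists>y\<in>exp_cone n. meval g y \<noteq> 0"
proof (rule ccontr)
  assume "\<not> ?thesis"
  then have van: "meval g v = 0" if "v \<in> aff_space (n + 1)" "v 0 \<noteq> 0" "log_form n v = 0" for v
    using that by (auto simp: exp_cone_eq[OF n])
  \<comment> \<open>The inner polynomial variable is \<epsilon> and the outer one is Y.\<close>
  define w :: "nat \<Rightarrow> 'a poly poly" where
    "w i = (if i = 0 then [:[:0, 1:]:] else if i = 1 then [:0, 1:] else [:[:z i:]:])" for i
  interpret cc: coeff_hom "\<lambda>c::'a. [:[:c:]:]"
    by unfold_locales (auto simp: mult.commute one_pCons)
  define ev where "ev p = mpoly_map_eval (\<lambda>c::'a. [:[:c:]:]) w p" for p
  have spec: "poly (map_poly (\<lambda>p. poly p \<epsilon>) (ev p)) y = meval p (z(0 := \<epsilon>, 1 := y))" for \<epsilon> p y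
  proof -
    interpret s: coeff_hom "\<lambda>P. poly (map_poly (\<lambda>p. poly p \<epsilon>) P) y"
    proof -
      have "coeff_hom (map_poly (\<lambda>p. poly p \<epsilon>))"
        by unfold_locales (auto simp: poly_eq_iff coeff_map_poly coeff_mult poly_sum coeff_1)
      then interpret t: coeff_hom "map_poly (\<lambda>p. poly p \<epsilon>)" .
      show "coeff_hom (\<lambda>P. poly (map_poly (\<lambda>p. poly p \<epsilon>) P) y)"
        by unfold_locales (simp_all add: t.hom_0 t.hom_1 t.hom_add t.hom_mult)
    qed
    have "(\<lambda>i. poly (map_poly (\<lambda>p. poly p \<epsilon>) (w i)) y) = z(0 := \<epsilon>, 1 := y)"
      by (auto simp: w_def map_poly_pCons)
    then show ?thesis
      unfolding ev_def s.hom_mpoly_map_eval by (simp add: meval_eq map_poly_pCons)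
  qed
  define T where "T k = [:[:(-1) ^ (k - 1) / of_nat k:]:] * w 0 ^ (n - k) * (fps_tail w ^ k) $ n" for k
  have evlog: "ev (log_mpoly n) = (\<Sum>k=1..n. T k)"
    by (simp add: ev_def log_mpoly_def cc.eval_simps cc.eval_fps_tail_power T_def)
  have dT: "degree (T k) \<le> k" for k
  proof -
    have "degree (w 0 ^ (n - k)) = 0" by (simp add: w_def const_poly_power)
    moreover have "degree ((fps_tail w ^ k) $ n) \<le> k"
      by (rule degree_fps_tail_power_nth) (auto simp: w_def)
    ultimately have "degree [:[:(-1) ^ (k - 1) / of_nat k :: 'a:]:] + degree (w 0 ^ (n - k)) +
        degree ((fps_tail w ^ k) $ n) \<le> k" by simp
    then show ?thesis
      unfolding T_def by (meson add_mono degree_mult_le le_refl order_trans)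
  qed
  define c where "c = (-1) ^ (n - 1) / (of_nat n :: 'a)"
  have c: "c \<noteq> 0" using n by (simp add: c_def)
  have Tn: "T n = [:[:c:]:] * [:0, 1:] ^ n"
    by (simp add: T_def c_def startsby_zero_power_nth_same fps_tail_def w_def)
  \<comment> \<open>\<open>T k\<close> has degree at most \<open>k\<close> in Y, so the leading term
    stems from \<open>T n\<close>, where \<epsilon> occurs to the power 0.\<close>
  have "coeff (T k) n = (if k = n then [:c:] else 0)" if "k \<in> {1..n}" for k
  proof (cases "k = n")
    case True
    then show ?thesis by (simp add: Tn flip: monom_altdef)
  next
    case False
    then show ?thesis using that dT[of k] by (simp add: coeff_eq_0)
  qed
  then have lead: "coeff (ev (log_mpoly n)) n = [:c:]"
    using n by (simp add: evlog coeff_sum sum.delta)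
  have deg: "degree (ev (log_mpoly n)) = n"
  proof (rule antisym)
    show "degree (ev (log_mpoly n)) \<le> n"
      unfolding evlog by (rule degree_sum_le) (auto intro: order_trans[OF dT])
    show "n \<le> degree (ev (log_mpoly n))"
      by (rule le_degree) (simp add: lead c)
  qed
  have z_eq: "z(0 := 0, 1 := 0) = z" using z by auto
  \<comment> \<open>The point \<open>z\<close> itself is the specialization \<epsilon> = 0 with root
    Y = 0, because \<open>z 0 = z 1 = 0\<close>.\<close>
  have "poly (map_poly (\<lambda>p. poly p 0) (ev g)) 0 = 0"
  proof (rule specialization_vanishes_if_vanishes_on_roots[OF deg n lead c])
    fix \<epsilon> y :: 'a
    assume "\<epsilon> \<noteq> 0" "poly (map_poly (\<lambda>p. poly p \<epsilon>) (ev (log_mpoly n))) y = 0"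
    then show "poly (map_poly (\<lambda>p. poly p \<epsilon>) (ev g)) y = 0"
      unfolding spec using z n by (intro van) (auto simp: aff_space_def meval_log_mpoly)
  next
    show "poly (map_poly (\<lambda>p. poly p 0) (ev (log_mpoly n))) 0 = 0"
      unfolding spec z_eq meval_log_mpoly using z n by (simp add: log_form_boundary)
  qed
  then show False
    using g unfolding spec z_eq by simp
qed

lemma mvars_subset_iff: "mvars f \<subseteq> V \<longleftrightarrow> f \<in> homogeneous_mpolys V {} 0"
  by (auto simp: mvars_def homogeneous_mpolys_def)

text \<open>The generating sets already form a base: the product of two polynomials defines the
  intersection of their nonvanishing sets.\<close>

lemma openin_zariski_affD:
  fixes z :: "nat \<Rightarrow> 'a::field"
  assumes "openin (zariski_aff N) T" "z \<in> T"
  shows "\<exists>g. mvars g \<subseteq> {..<N} \<and> meval g z \<noteq> 0 \<and> {y \<in> aff_space N. meval g y \<noteq> 0} \<subseteq> T"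
proof -
  have "generate_topology_on {{z \<in> aff_space N. meval f z \<noteq> 0} |f. mvars f \<subseteq> {..<N}} T"
    using assms(1) by (simp add: zariski_aff_def openin_topology_generated_by_iff)
  then show ?thesis
    using assms(2)
  proof (induction arbitrary: z)
    case (Int A B)
    then obtain f g where f: "mvars f \<subseteq> {..<N}" "meval f z \<noteq> 0" "{y \<in> aff_space N. meval f y \<noteq> 0} \<subseteq> A"
      and g: "mvars g \<subseteq> {..<N}" "meval g z \<noteq> 0" "{y \<in> aff_space N. meval g y \<noteq> 0} \<subseteq> B"
      by (meson IntD1 IntD2)
    have "mvars (f * g) \<subseteq> {..<N}"
      using f(1) g(1) homogeneous_mult[of f "{..<N}" "{}" 0 g 0] by (simp add: mvars_subset_iff)
    then show ?case
      using f g by (intro exI[of _ "f * g"]) (auto simp: meval_simps)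
  next
    case (UN K)
    then show ?case by (meson Union_iff Union_upper order_trans)
  qed auto
qed

lemma topspace_zariski_aff [simp]: "topspace (zariski_aff N :: (nat \<Rightarrow> 'a::comm_ring_1) topology) = aff_space N"
proof -
  have "mvars (1 :: (nat, 'a) mpoly) \<subseteq> {..<N}"
    by (simp add: mvars_def)
  moreover have "meval (1 :: (nat, 'a) mpoly) z \<noteq> 0" for z
    by (simp add: meval_simps)
  ultimately show ?thesis
    unfolding zariski_aff_def topology_generated_by_topspace by blast
qed

text \<open>Zeros with \<open>z 0 \<noteq> 0\<close> belong to the cone already. For the others
  \<open>log_form_boundary\<close> forces \<open>z 1 = 0\<close>, which is the situation of the
  density lemma.\<close>

lemma closure_exp_cone:
  assumes n: "n \<ge> 1"
  shows "zariski_aff (n + 1) closure_of exp_cone n =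
    {z \<in> aff_space (n + 1). log_form n z = (0 :: 'a::{alg_closed_field, field_char_0})}" (is "_ = ?V")
proof (rule equalityI)
  have "mvars (log_mpoly n :: (nat, 'a) mpoly) \<subseteq> {..<n + 1}"
    using log_mpoly_in_forms[of n] by (auto simp: forms_def)
  then have "openin (zariski_aff (n + 1)) {z \<in> aff_space (n + 1). meval (log_mpoly n) z \<noteq> (0::'a)}"
    unfolding zariski_aff_def by (intro topology_generated_by_Basis) blast
  also have "{z \<in> aff_space (n + 1). meval (log_mpoly n) z \<noteq> (0::'a)} = aff_space (n + 1) - ?V"
    by (auto simp: meval_log_mpoly)
  finally have "closedin (zariski_aff (n + 1)) ?V"
    by (auto simp: closedin_def)
  then show "zariski_aff (n + 1) closure_of exp_cone n \<subseteq> ?V"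
    by (rule closure_of_minimal[rotated]) (auto simp: exp_cone_eq[OF n])
  show "?V \<subseteq> zariski_aff (n + 1) closure_of exp_cone n"
  proof
    fix z assume z: "z \<in> ?V"
    have "\<exists>y\<in>exp_cone n. y \<in> T" if T: "z \<in> T" "openin (zariski_aff (n + 1)) T" for T
    proof -
      obtain g where g: "meval g z \<noteq> 0" "{y \<in> aff_space (n + 1). meval g y \<noteq> 0} \<subseteq> T"
        using openin_zariski_affD[OF T(2,1)] by blast
      have "\<exists>y\<in>exp_cone n. meval g y \<noteq> 0"
      proof (cases "z 0 = 0")
        case True
        then have "z 1 = 0" using z n by (auto simp: log_form_boundary)
        then show ?thesis
          using exp_cone_dense_at_boundary[OF n _ True _ g(1)] z by simp
      next
        case False
        then show ?thesis using z g(1) by (auto simp: exp_cone_eq[OF n])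
      qed
      then show ?thesis using g(2) by (auto simp: exp_cone_eq[OF n])
    qed
    then show "z \<in> zariski_aff (n + 1) closure_of exp_cone n"
      using z by (auto simp: in_closure_of)
  qed
qed

section \<open>The hypersurface and its additive action\<close>

lemma proj_pt_self [simp]: "z \<in> proj_pt z"
  unfolding proj_pt_def by (force intro: exI[of _ 1])

lemma proj_pt_scale:
  assumes "c \<noteq> 0"
  shows "proj_pt (\<lambda>i. c * z i) = proj_pt z"
proof (rule equalityI)
  show "proj_pt (\<lambda>i. c * z i) \<subseteq> proj_pt z"
  proof
    fix x assume "x \<in> proj_pt (\<lambda>i. c * z i)"
    then obtain d where "d \<noteq> 0" "x = (\<lambda>i. d * (c * z i))" by (auto simp: proj_pt_def)
    then have "d * c \<noteq> 0" "x = (\<lambda>i. d * c * z i)" using assms by (auto simp: mult.assoc)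
    then show "x \<in> proj_pt z" unfolding proj_pt_def by blast
  qed
  show "proj_pt z \<subseteq> proj_pt (\<lambda>i. c * z i)"
  proof
    fix x assume "x \<in> proj_pt z"
    then obtain d where "d \<noteq> 0" "x = (\<lambda>i. d * z i)" by (auto simp: proj_pt_def)
    then have "d / c \<noteq> 0" "x = (\<lambda>i. d / c * (c * z i))" using assms by auto
    then show "x \<in> proj_pt (\<lambda>i. c * z i)" unfolding proj_pt_def by blast
  qed
qed

lemma proj_ptE:
  assumes "w \<in> proj_pt z"
  obtains c where "c \<noteq> 0" "w = (\<lambda>i. c * z i)"
  using assms by (auto simp: proj_pt_def)

lemma proj_spaceI:
  assumes "z \<in> aff_space (n + 1)" "z \<noteq> (\<lambda>_. 0)"
  shows "proj_pt z \<in> proj_space n"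
  using assms by (auto simp: proj_space_def)

lemma proj_spaceD:
  assumes "p \<in> proj_space n" "z \<in> p"
  shows "p = proj_pt z" "z \<in> aff_space (n + 1)" "z \<noteq> (\<lambda>_. 0)"
proof -
  obtain y where y: "y \<in> aff_space (n + 1)" "y \<noteq> (\<lambda>_. 0)" "p = proj_pt y"
    using assms(1) by (auto simp: proj_space_def)
  then obtain c where c: "c \<noteq> 0" "z = (\<lambda>i. c * y i)"
    using assms(2) by (auto elim: proj_ptE)
  show "p = proj_pt z" using y c by (simp add: proj_pt_scale)
  show "z \<in> aff_space (n + 1)" "z \<noteq> (\<lambda>_. 0)"
    using y c by (auto simp: aff_space_def fun_eq_iff)
qed

lemma proj_space_nonempty: "p \<in> proj_space n \<Longrightarrow> \<exists>z. z \<in> p"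
  unfolding proj_space_def using proj_pt_self by blast

lemma ball_proj_pt_meval:
  assumes "f \<in> forms n d"
  shows "(\<forall>z\<in>proj_pt y. meval f z = 0) \<longleftrightarrow> meval f y = 0"
    and "(\<forall>z\<in>proj_pt y. meval f z \<noteq> 0) \<longleftrightarrow> meval f y \<noteq> 0"
proof -
  have "meval f z = 0 \<longleftrightarrow> meval f y = 0" if "z \<in> proj_pt y" for z
    using that assms by (auto elim!: proj_ptE simp: meval_scale)
  then show "(\<forall>z\<in>proj_pt y. meval f z = 0) \<longleftrightarrow> meval f y = 0"
    "(\<forall>z\<in>proj_pt y. meval f z \<noteq> 0) \<longleftrightarrow> meval f y \<noteq> 0"
    using proj_pt_self[of y] by blast+
qed

lemma log_form_proj_pt: "z \<in> proj_pt y \<Longrightarrow> log_form n z = 0 \<longleftrightarrow> log_form n y = 0"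
  by (auto elim!: proj_ptE simp: meval_scale[OF log_mpoly_in_forms] simp flip: meval_log_mpoly)

lemmas ball_proj_pt_log_form = ball_proj_pt_meval[OF log_mpoly_in_forms, unfolded meval_log_mpoly]

lemma exp_hypersurface_eq:
  assumes "n \<ge> 1"
  shows "exp_hypersurface n = {p \<in> proj_space n.
    \<forall>z\<in>p. meval (log_mpoly n) z = (0::'a::{alg_closed_field, field_char_0})}" (is "_ = ?X")
proof (rule equalityI)
  show "exp_hypersurface n \<subseteq> ?X"
    unfolding exp_hypersurface_def closure_exp_cone[OF assms]
    by (auto intro!: proj_spaceI simp: log_form_proj_pt meval_log_mpoly)
  show "?X \<subseteq> exp_hypersurface n"
  proof
    fix p assume p: "p \<in> ?X"
    then obtain z where z: "z \<in> p" using proj_space_nonempty by blast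
    then show "p \<in> exp_hypersurface n"
      using p proj_spaceD[of p n z]
      unfolding exp_hypersurface_def closure_exp_cone[OF assms]
      by (auto simp: meval_log_mpoly)
  qed
qed

lemma proj_pt_in_exp_hypersurface:
  fixes z :: "nat \<Rightarrow> 'a::{alg_closed_field, field_char_0}"
  assumes "n \<ge> 1" "z \<in> aff_space (n + 1)" "z \<noteq> (\<lambda>_. 0)"
  shows "proj_pt z \<in> exp_hypersurface n \<longleftrightarrow> log_form n z = 0"
  using assms proj_spaceI[OF assms(2,3)]
  by (simp add: exp_hypersurface_eq ball_proj_pt_log_form meval_log_mpoly)

lemma hypersurface_exp_hypersurface:
  assumes "n \<ge> 1"
  shows "hypersurface_of_degree n n (exp_hypersurface n :: (nat \<Rightarrow> 'a::{alg_closed_field, field_char_0}) set set)"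
  unfolding hypersurface_of_degree_def exp_hypersurface_eq[OF assms]
  using log_mpoly_in_forms irreducible_log_mpoly[OF assms] by blast

text \<open>The coordinate \<open>t i\<close> is the coefficient of x^(i+1). The shift identifies
  \<open>aff_space (n - 1)\<close>, indexed from 0, with \<open>U0 n\<close>, whose exponents run
  from 1 to n - 1.\<close>

definition shift_exp :: "(nat \<Rightarrow> 'a::field_char_0) \<Rightarrow> 'a fps" where
  "shift_exp t = fps_E (fps_X * Abs_fps t)"

definition exp_mult :: "nat \<Rightarrow> (nat \<Rightarrow> 'a::field_char_0) \<Rightarrow> (nat \<Rightarrow> 'a) \<Rightarrow> nat \<Rightarrow> 'a" where
  "exp_mult n t z = (\<lambda>j. if j \<le> n then (shift_exp t * Abs_fps z) $ j else 0)"

definition exp_action :: "nat \<Rightarrow> (nat \<Rightarrow> 'a::field_char_0) \<Rightarrow> (nat \<Rightarrow> 'a) set \<Rightarrow> (nat \<Rightarrow> 'a) set" where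
  "exp_action n t p = exp_mult n t ` p"

lemma shift_exp_0 [simp]: "shift_exp (\<lambda>_. 0) = 1"
  by (simp add: shift_exp_def flip: fps_zero_def)

lemma shift_exp_add: "shift_exp (\<lambda>i. s i + t i) = shift_exp s * shift_exp t"
proof -
  have "fps_X * Abs_fps (\<lambda>i. s i + t i) = fps_X * Abs_fps s + fps_X * Abs_fps t"
    by (simp add: fps_eq_iff)
  then show ?thesis by (simp add: shift_exp_def fps_E_add)
qed

lemma exp_mult_in_aff_space: "exp_mult n t z \<in> aff_space (n + 1)"
  by (simp add: exp_mult_def aff_space_def)

lemma exp_mult_zero: "z \<in> aff_space (n + 1) \<Longrightarrow> exp_mult n (\<lambda>_. 0) z = z"
  by (auto simp: exp_mult_def aff_space_def)

text \<open>Truncating the inner product at degree \<open>n\<close> is harmless, since coefficients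
  beyond \<open>n\<close> cannot reach degrees up to \<open>n\<close>.\<close>

lemma exp_mult_add: "exp_mult n (\<lambda>i. s i + t i) z = exp_mult n s (exp_mult n t z)"
proof
  fix j
  have "(shift_exp s * (shift_exp t * Abs_fps z)) $ j = (shift_exp s * Abs_fps (exp_mult n t z)) $ j"
    if "j \<le> n"
    by (rule fps_mult_nth_cong[OF _ _ that]) (auto simp: exp_mult_def)
  then show "exp_mult n (\<lambda>i. s i + t i) z j = exp_mult n s (exp_mult n t z) j"
    by (auto simp: exp_mult_def[of n s] exp_mult_def[of n "\<lambda>i. s i + t i"] shift_exp_add mult.assoc)
qed

lemma exp_mult_scale: "exp_mult n t (\<lambda>i. c * z i) = (\<lambda>j. c * exp_mult n t z j)"
proof -
  have "Abs_fps (\<lambda>i. c * z i) = fps_const c * Abs_fps z"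
    by (simp add: fps_eq_iff)
  then show ?thesis
    by (auto simp: exp_mult_def fun_eq_iff mult.left_commute)
qed

text \<open>Multiplication by the exponential of \<open>- t\<close> undoes the map.\<close>

lemma exp_mult_nonzero:
  fixes z :: "nat \<Rightarrow> 'a::field_char_0"
  assumes "z \<in> aff_space (n + 1)" "z \<noteq> (\<lambda>_. 0)"
  shows "exp_mult n t z \<noteq> (\<lambda>_. 0)"
proof
  assume *: "exp_mult n t z = (\<lambda>_. 0)"
  have "exp_mult n (\<lambda>i. - t i + t i) z = exp_mult n (\<lambda>i. - t i) (\<lambda>_. 0)"
    unfolding exp_mult_add * ..
  then have "z = exp_mult n (\<lambda>i. - t i) (\<lambda>_. 0)"
    using exp_mult_zero[OF assms(1)] by simp
  also have "\<dots> = (\<lambda>_. 0)"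
  proof -
    have "Abs_fps (\<lambda>_. 0) = (0 :: 'a fps)" by (simp add: fps_eq_iff)
    then show ?thesis by (auto simp: exp_mult_def)
  qed
  finally show False using assms by simp
qed

lemma exp_action_proj_pt:
  fixes z :: "nat \<Rightarrow> 'a::field_char_0"
  shows "exp_action n t (proj_pt z) = proj_pt (exp_mult n t z)"
proof -
  have proj_pt_image: "proj_pt y = (\<lambda>c i. c * y i) ` {c. c \<noteq> 0}" for y :: "nat \<Rightarrow> 'a"
    by (auto simp: proj_pt_def)
  show ?thesis
    unfolding exp_action_def proj_pt_image image_image exp_mult_scale ..
qed

lemma exp_mult_0: "exp_mult n t z 0 = z 0"
  by (simp add: exp_mult_def shift_exp_def)

lemma exp_mult_boundary: "n \<ge> 1 \<Longrightarrow> z 0 = 0 \<Longrightarrow> exp_mult n t z 1 = z 1"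
  by (simp add: exp_mult_def shift_exp_def fps_mult_nth_1)

lemma exp_mult_exp_cone:
  assumes n: "n \<ge> 1" and "t \<in> aff_space (n - 1)" "z \<in> exp_cone n"
  shows "exp_mult n t z \<in> exp_cone n"
proof -
  obtain c u where u: "z \<in> aff_space (n + 1)" "c \<noteq> 0" "u $ 0 = 0" "\<And>j. j \<ge> n \<Longrightarrow> u $ j = 0"
      "\<And>j. j \<le> n \<Longrightarrow> z j = c * fps_E u $ j"
    using assms(3) n by (rule exp_coneE) blast
  show ?thesis
  proof (rule exp_coneI[OF n exp_mult_in_aff_space u(2)])
    show "(fps_X * Abs_fps t + u) $ 0 = 0" "(fps_X * Abs_fps t + u) $ n = 0"
      using u n assms(2) by (auto simp: aff_space_def)
    fix j assume j: "j \<le> n"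
    have "(shift_exp t * Abs_fps z) $ j = (shift_exp t * (fps_const c * fps_E u)) $ j"
      by (rule fps_mult_nth_cong[OF _ _ j]) (auto simp: u)
    then show "exp_mult n t z j = c * fps_E (fps_X * Abs_fps t + u) $ j"
      using j u(3) by (simp add: exp_mult_def shift_exp_def fps_E_add mult.left_commute)
  qed
qed

text \<open>On the cone the exponents add, and neither has an x^n term. On the boundary z_0 = z_1 =
  0 is preserved because the multiplier has constant term 1.\<close>

lemma log_form_exp_mult:
  assumes n: "n \<ge> 1" and "t \<in> aff_space (n - 1)" "z \<in> aff_space (n + 1)" "log_form n z = 0"
  shows "log_form n (exp_mult n t z) = 0"
proof (cases "z 0 = 0")
  case True
  then have "z 1 = 0" using assms by (auto simp: log_form_boundary)
  then show ?thesis
    using True n by (simp add: log_form_boundary exp_mult_0 exp_mult_boundary[simplified])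
next
  case False
  then show ?thesis
    using exp_mult_exp_cone[OF n assms(2), of z] assms by (auto simp: exp_cone_eq[OF n])
qed

definition exp_mult_mpoly :: "nat \<Rightarrow> nat \<Rightarrow> (nat + nat, 'a::field_char_0) mpoly" where
  "exp_mult_mpoly n j =
    (Abs_fps (\<lambda>m. \<Sum>k=0..m. mconst (1 / fact k) *
        (Abs_fps (\<lambda>i. if 1 \<le> i \<and> i < n then mvar (Inl (i - 1)) else 0) ^ k) $ m) *
      Abs_fps (\<lambda>i. mvar (Inr i))) $ j"

lemma meval_exp_mult_mpoly:
  assumes "t \<in> aff_space (n - 1)" "j \<le> n"
  shows "meval (exp_mult_mpoly n j) (case_sum t z) = exp_mult n t z j"
proof -
  have "Abs_fps (\<lambda>i. mpoly_map_eval (\<lambda>c. c) (case_sum t z)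
      (if 1 \<le> i \<and> i < n then mvar (Inl (i - 1)) else 0)) = fps_X * Abs_fps t"
    using assms(1) by (auto simp: fps_eq_iff meval.eval_simps aff_space_def)
  then show ?thesis
    using assms(2) unfolding meval_eq
    by (simp add: exp_mult_mpoly_def exp_mult_def fps_mult_nth meval.eval_simps meval.eval_fps_power_nth
        shift_exp_def fps_E_def fps_compose_nth del: One_nat_def)
qed

lemma exp_mult_mpoly_in_relative_forms:
  assumes "j \<le> n"
  shows "exp_mult_mpoly n j \<in> (relative_forms (n - 1) n 1 :: (nat + nat, 'a::field_char_0) mpoly set)"
proof -
  let ?H = "homogeneous_mpolys ({..<n - 1} <+> {..n}) (Inr ` {..n}) :: nat \<Rightarrow> (nat + nat, 'a) mpoly set"
  have l: "mvar (Inl i) \<in> ?H 0" if "i < n - 1" for i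
    using homogeneous_var[of "Inl i" "{..<n - 1} <+> {..n}" "Inr ` {..n}"] that
    by (auto simp: image_iff InlI)
  have r: "mvar (Inr i) \<in> ?H 1" if "i \<le> n" for i
    using homogeneous_var[of "Inr i" "{..<n - 1} <+> {..n}" "Inr ` {..n}"] that by auto
  have "(Abs_fps (\<lambda>i. if 1 \<le> i \<and> i < n then mvar (Inl (i - 1)) else 0) ^ k) $ m \<in> ?H (k * 0)" for k m
    by (rule homogeneous_power_nth[of m]) (auto simp: homogeneous_0 intro!: l[simplified])
  then have "mconst (1 / fact k) *
      (Abs_fps (\<lambda>i. if 1 \<le> i \<and> i < n then mvar (Inl (i - 1)) else 0) ^ k) $ m \<in> ?H (0 + k * 0)" for k m
    by (rule homogeneous_mult[OF homogeneous_const])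
  then have s: "(\<Sum>k=0..m. mconst (1 / fact k) *
      (Abs_fps (\<lambda>i. if 1 \<le> i \<and> i < n then mvar (Inl (i - 1)) else 0) ^ k) $ m) \<in> ?H 0" for m
    by (intro homogeneous_sum) simp
  have "exp_mult_mpoly n j \<in> ?H (0 + 1)"
    unfolding exp_mult_mpoly_def fps_mult_nth fps_nth_Abs_fps
    by (intro homogeneous_sum homogeneous_mult s r) (use assms in auto)
  then show ?thesis by (simp add: relative_forms_eq)
qed

lemma regular_exp_action:
  fixes Y :: "(nat \<Rightarrow> 'a::field_char_0) set set"
  assumes "n \<ge> 1" "Y \<subseteq> proj_space n"
    and closed: "\<And>t p. t \<in> aff_space (n - 1) \<Longrightarrow> p \<in> Y \<Longrightarrow> exp_action n t p \<in> Y"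
  shows "regular_action (n - 1) n Y (exp_action n)"
proof -
  note D = proj_spaceD[OF subsetD[OF assms(2)]]
  have "is_morphism (n - 1) n Y (exp_action n)"
    unfolding is_morphism_def
  \<comment> \<open>One tuple of relative forms, linear in the homogeneous coordinates, works at
    every point; it has no common zero because multiplication by an exponential is
    invertible.\<close>
  proof (intro ballI, rule exI[of _ 1], rule exI[of _ "exp_mult_mpoly n"], intro conjI allI impI ballI)
    fix j assume "j \<le> n"
    then show "exp_mult_mpoly n j \<in> relative_forms (n - 1) n 1"
      by (rule exp_mult_mpoly_in_relative_forms)
  next
    fix t0 :: "nat \<Rightarrow> 'a" and p0 z
    assume t0: "t0 \<in> aff_space (n - 1)" and p0: "p0 \<in> Y"
    assume "z \<in> p0"
    then have "exp_mult n t0 z \<noteq> (\<lambda>_. 0)"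
      using D[OF p0] by (intro exp_mult_nonzero) auto
    then obtain j where "exp_mult n t0 z j \<noteq> 0" by auto
    then show "\<exists>j\<le>n. meval (exp_mult_mpoly n j) (case_sum t0 z) \<noteq> 0"
      using t0 by (intro exI[of _ j]) (auto simp: meval_exp_mult_mpoly exp_mult_def split: if_splits)
  next
    fix t :: "nat \<Rightarrow> 'a" and p z
    assume t: "t \<in> aff_space (n - 1)" and p: "p \<in> Y" "z \<in> p"
    have "(\<lambda>j. if j \<le> n then meval (exp_mult_mpoly n j) (case_sum t z) else 0) = exp_mult n t z"
      using t by (intro ext) (simp add: meval_exp_mult_mpoly, simp add: exp_mult_def)
    then show "exp_action n t p =
        proj_pt (\<lambda>j. if j \<le> n then meval (exp_mult_mpoly n j) (case_sum t z) else 0)"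
      by (subst D(1)[OF p]) (simp only: exp_action_proj_pt)
  qed
  moreover have "exp_action n (\<lambda>_. 0) p = p" if "p \<in> Y" for p
  proof -
    have "exp_mult n (\<lambda>_. 0) z = z" if "z \<in> p" for z
      by (rule exp_mult_zero) (rule D(2)[OF \<open>p \<in> Y\<close> that])
    then show ?thesis by (simp add: exp_action_def)
  qed
  moreover have "exp_action n (\<lambda>i. s i + t i) p = exp_action n s (exp_action n t p)" for s t p
    unfolding exp_action_def exp_mult_add image_image ..
  ultimately show ?thesis
    unfolding regular_action_def using closed by (intro conjI ballI) simp_all
qed

lemma exp_action_proj_space:
  assumes "p \<in> proj_space n"
  shows "exp_action n t p \<in> proj_space n"
proof -
  obtain z where z: "z \<in> p" using proj_space_nonempty[OF assms] by blast
  show ?thesis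
    unfolding proj_spaceD(1)[OF assms z] exp_action_proj_pt
    using proj_spaceD(2,3)[OF assms z] by (intro proj_spaceI exp_mult_in_aff_space exp_mult_nonzero)
qed

lemma exp_action_exp_hypersurface:
  fixes t :: "nat \<Rightarrow> 'a::{alg_closed_field, field_char_0}"
  assumes "n \<ge> 1" "t \<in> aff_space (n - 1)" "p \<in> exp_hypersurface n"
  shows "exp_action n t p \<in> exp_hypersurface n"
proof -
  have p: "p \<in> proj_space n" using assms(1,3) by (auto simp: exp_hypersurface_eq)
  obtain z where z: "z \<in> p" using proj_space_nonempty[OF p] by blast
  note D = proj_spaceD[OF p z]
  have "log_form n z = 0" using assms D by (simp add: proj_pt_in_exp_hypersurface)
  then show ?thesis
    unfolding D(1) exp_action_proj_pt
    using assms log_form_exp_mult[OF assms(1,2) D(2)]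
    by (subst proj_pt_in_exp_hypersurface[OF assms(1) exp_mult_in_aff_space exp_mult_nonzero[OF D(2,3)]])
qed

section \<open>The orbit of the unit of A\<close>

definition base_vec :: "nat \<Rightarrow> 'a::zero_neq_one" where
  "base_vec = (\<lambda>j. if j = 0 then 1 else 0)"

lemma Abs_fps_base_vec: "Abs_fps base_vec = 1"
  by (auto simp: fps_eq_iff base_vec_def)

lemma base_vec_in_exp_hypersurface:
  assumes "n \<ge> 1"
  shows "proj_pt (base_vec :: nat \<Rightarrow> 'a::{alg_closed_field, field_char_0}) \<in> exp_hypersurface n"
proof -
  have "(base_vec :: nat \<Rightarrow> 'a) \<in> exp_cone n"
    by (rule exp_coneI[OF assms, of _ 1 0]) (use assms in \<open>auto simp: base_vec_def aff_space_def\<close>)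
  then have "(base_vec :: nat \<Rightarrow> 'a) \<in> aff_space (n + 1)" "log_form n (base_vec :: nat \<Rightarrow> 'a) = 0"
    by (simp_all add: exp_cone_eq[OF assms])
  moreover have "(base_vec :: nat \<Rightarrow> 'a) \<noteq> (\<lambda>_. 0)"
    by (metis base_vec_def zero_neq_one)
  ultimately show ?thesis
    using assms by (subst proj_pt_in_exp_hypersurface)
qed

text \<open>The orbit consists of the lines spanned by the cone. Conversely, a point with z_0
  nonzero is a multiple of the exponential of some \<open>u\<close>, and dividing \<open>u\<close>
  by x yields the group element.\<close>

lemma exp_orbit:
  assumes n: "n \<ge> 1"
  shows "(\<lambda>t. exp_action n t (proj_pt base_vec)) ` aff_space (n - 1) =
    exp_hypersurface n \<inter> {p \<in> proj_space n. \<forall>z\<in>p. meval (mvar 0) z \<noteq> (0::'a::{alg_closed_field, field_char_0})}"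
    (is "?O = ?U")
proof (rule equalityI)
  show "?O \<subseteq> ?U"
  proof
    fix p assume "p \<in> ?O"
    then obtain t :: "nat \<Rightarrow> 'a" where t: "t \<in> aff_space (n - 1)" "p = exp_action n t (proj_pt base_vec)" by blast
    then have p: "p \<in> exp_hypersurface n"
      using exp_action_exp_hypersurface[OF n] base_vec_in_exp_hypersurface[OF n] by blast
    have "z 0 \<noteq> 0" if "z \<in> p" for z
      using that unfolding t(2) exp_action_proj_pt
      by (auto elim!: proj_ptE simp: exp_mult_0 base_vec_def)
    then show "p \<in> ?U"
      using p by (auto simp: exp_hypersurface_eq[OF n] meval_simps)
  qed
  show "?U \<subseteq> ?O"
  proof
    fix p assume p: "p \<in> ?U"
    then obtain z where z: "z \<in> p" using proj_space_nonempty by blast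
    have D: "p = proj_pt z" "z \<in> aff_space (n + 1)" "z \<noteq> (\<lambda>_. 0)"
      using p z proj_spaceD[of p n z] by auto
    have "z \<in> exp_cone n"
    proof -
      have "z 0 \<noteq> 0" using p z by (auto simp: meval_simps)
      moreover have "log_form n z = 0"
        using p D proj_pt_in_exp_hypersurface[OF n D(2,3)] by blast
      ultimately show ?thesis using D(2) by (simp add: exp_cone_eq[OF n])
    qed
    then obtain c u where "z \<in> aff_space (n + 1)" and
        u: "c \<noteq> 0" "u $ 0 = 0" "\<And>j. j \<ge> n \<Longrightarrow> u $ j = 0"
          "\<And>j. j \<le> n \<Longrightarrow> z j = c * fps_E u $ j"
      using n by (rule exp_coneE) blast
    define t where "t i = u $ (i + 1)" for i
    have t: "t \<in> aff_space (n - 1)"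
      using u(3) n by (auto simp: t_def aff_space_def)
    have "fps_X * Abs_fps t = u"
      using u(2) by (auto simp: t_def fps_eq_iff)
    then have "z = (\<lambda>i. c * exp_mult n t base_vec i)"
      using u(4) D(2) by (auto simp: exp_mult_def shift_exp_def Abs_fps_base_vec aff_space_def)
    then have "p = exp_action n t (proj_pt base_vec)"
      using D(1) u(1) by (simp add: exp_action_proj_pt proj_pt_scale)
    then show "p \<in> ?O" using t by blast
  qed
qed

text \<open>The stabilizer of the unit alone is trivial: comparing constant terms shows that the
  scalar is 1, and the exponential is injective modulo x^(n+1).\<close>

lemma exp_action_effective:
  assumes n: "n \<ge> 1" and t: "t \<in> aff_space (n - 1)"
    and fix_base: "exp_action n t (proj_pt base_vec) = proj_pt (base_vec :: nat \<Rightarrow> 'a::field_char_0)"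
  shows "t = (\<lambda>_. 0)"
proof -
  have "exp_mult n t base_vec \<in> proj_pt base_vec"
    using fix_base proj_pt_self by (metis exp_action_proj_pt)
  then obtain c where c: "exp_mult n t base_vec = (\<lambda>i. c * base_vec i)"
    by (auto elim: proj_ptE)
  have "c = 1"
    using fun_cong[OF c, of 0] by (simp add: exp_mult_0 base_vec_def)
  have E: "fps_E (fps_X * Abs_fps t) $ j = fps_E 0 $ j" if "j \<le> n" for j
  proof -
    have "fps_E (fps_X * Abs_fps t) $ j = c * base_vec j"
      using fun_cong[OF c, of j] that by (simp add: exp_mult_def shift_exp_def Abs_fps_base_vec)
    then show ?thesis by (simp add: \<open>c = 1\<close> base_vec_def)
  qed
  have "t i = 0" for i
  proof (cases "i < n")
    case True
    then have "(fps_X * Abs_fps t) $ (i + 1) = (0 :: 'a fps) $ (i + 1)"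
      by (intro fps_E_inj_nth[OF _ _ E]) auto
    then show ?thesis by simp
  next
    case False
    then show ?thesis using t by (auto simp: aff_space_def)
  qed
  then show ?thesis by auto
qed

lemma exp_hypersurface_additive_action:
  assumes n: "n \<ge> 1"
  shows "admits_induced_additive_action n (exp_hypersurface n :: (nat \<Rightarrow> 'a::{alg_closed_field, field_char_0}) set set)"
proof -
  let ?X = "exp_hypersurface n :: (nat \<Rightarrow> 'a) set set"
  have "?X \<subseteq> proj_space n"
    unfolding exp_hypersurface_eq[OF n] by blast
  then have "regular_action (n - 1) n ?X (exp_action n)"
    by (rule regular_exp_action[OF n]) (rule exp_action_exp_hypersurface[OF n])
  moreover have "\<forall>t\<in>aff_space (n - 1). (\<forall>p\<in>?X. exp_action n t p = p) \<longrightarrow> t = (\<lambda>_. 0)"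
    using exp_action_effective[OF n] base_vec_in_exp_hypersurface[OF n] by blast
  moreover have "openin (subtopology (zariski_proj n) ?X)
      ((\<lambda>t. exp_action n t (proj_pt base_vec)) ` aff_space (n - 1))"
  proof -
    have "mvar 0 \<in> (forms n 1 :: (nat, 'a) mpoly set)"
      using homogeneous_var[of 0 "{..n}" "{..n}"] by (simp add: forms_eq)
    then have "openin (zariski_proj n) {p \<in> proj_space n. \<forall>z\<in>p. meval (mvar 0) z \<noteq> (0::'a)}"
      unfolding zariski_proj_def by (intro topology_generated_by_Basis) blast
    then show ?thesis
      unfolding exp_orbit[OF n] by (rule openin_subtopology_Int2)
  qed
  ultimately have "additive_action (n - 1) n ?X (exp_action n)"
    unfolding additive_action_def using base_vec_in_exp_hypersurface[OF n] by (intro conjI bexI)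
  moreover have "regular_action (n - 1) n (proj_space n) (exp_action n :: _ \<Rightarrow> (nat \<Rightarrow> 'a) set \<Rightarrow> _)"
    by (rule regular_exp_action[OF n subset_refl]) (rule exp_action_proj_space)
  ultimately show ?thesis
    unfolding admits_induced_additive_action_def by (intro exI[of _ "exp_action n"]) simp
qed

section \<open>Local rings\<close>

lemma one_in_forms: "(1 :: (nat, 'a::comm_ring_1) mpoly) \<in> forms n 0"
  by (simp add: forms_eq homogeneous_1)

lemma mvar_in_forms: "i \<le> n \<Longrightarrow> mvar i \<in> forms n 1"
  using homogeneous_var[of i "{..n}" "{..n}"] by (simp add: forms_eq)

lemma mult_in_forms: "(f :: (nat, 'a::comm_ring_1) mpoly) \<in> forms n d \<Longrightarrow> g \<in> forms n e \<Longrightarrow> f * g \<in> forms n (d + e)"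
  by (simp add: forms_eq homogeneous_mult)

lemma topspace_zariski_proj [simp]: "topspace (zariski_proj n) = proj_space n"
proof -
  have "proj_space n \<in> {{p \<in> proj_space n. \<forall>z\<in>p. meval f z \<noteq> 0} |f d. f \<in> forms n d}"
    using one_in_forms[of n] by (force simp: meval_simps)
  then show ?thesis
    unfolding zariski_proj_def topology_generated_by_topspace by blast
qed

lemma openin_zariski_projD:
  fixes S :: "(nat \<Rightarrow> 'a::field) set set"
  assumes "openin (zariski_proj n) S" "p \<in> S"
  shows "\<exists>d. \<exists>f\<in>forms n d. (\<forall>z\<in>p. meval f z \<noteq> 0) \<and> {q \<in> proj_space n. \<forall>z\<in>q. meval f z \<noteq> 0} \<subseteq> S"
proof -
  have "generate_topology_on {{p \<in> proj_space n. \<forall>z\<in>p. meval f z \<noteq> 0} |f d. f \<in> forms n d} S"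
    using assms(1) unfolding zariski_proj_def openin_topology_generated_by_iff .
  then show ?thesis
    using assms(2)
  proof induction
    case (Int A B)
    then have "p \<in> A" "p \<in> B" by auto
    with Int.IH obtain d e f g where f: "f \<in> forms n d" "\<forall>z\<in>p. meval f z \<noteq> 0"
        "{q \<in> proj_space n. \<forall>z\<in>q. meval f z \<noteq> 0} \<subseteq> A"
      and g: "g \<in> forms n e" "\<forall>z\<in>p. meval g z \<noteq> 0"
        "{q \<in> proj_space n. \<forall>z\<in>q. meval g z \<noteq> 0} \<subseteq> B"
      by blast
    have "{q \<in> proj_space n. \<forall>z\<in>q. meval (f * g) z \<noteq> 0} \<subseteq> A \<inter> B"
      using f(3) g(3) by (auto simp: meval_simps)
    moreover have "\<forall>z\<in>p. meval (f * g) z \<noteq> 0"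
      using f(2) g(2) by (simp add: meval_simps)
    ultimately show ?case
      using mult_in_forms[OF f(1) g(1)] by blast
  next
    case (UN K)
    then obtain k where k: "k \<in> K" "p \<in> k" by blast
    then obtain d f where "f \<in> forms n d" "\<forall>z\<in>p. meval f z \<noteq> 0"
        "{q \<in> proj_space n. \<forall>z\<in>q. meval f z \<noteq> 0} \<subseteq> k"
      using UN by meson
    then show ?case using k(1) by (meson Union_upper order_trans)
  next
    case (Basis s)
    then show ?case by blast
  qed simp
qed

section \<open>Regular functions, germs and the ring structure on them\<close>

locale proj_subset_point =
  fixes n :: nat and X :: "(nat \<Rightarrow> 'a::field) set set" and p :: "(nat \<Rightarrow> 'a) set"
  assumes X_subset: "X \<subseteq> proj_space n" and p_in: "p \<in> X"
begin

abbreviation near :: "(nat \<Rightarrow> 'a) set filter" where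
  "near \<equiv> nhdsin (subtopology (zariski_proj n) X) p"

abbreviation "regular \<equiv> regular_at n X p"

abbreviation "\<G> \<equiv> germ n X p"

abbreviation "\<O> \<equiv> local_ring n X p"

text \<open>Principal open sets form a base of the topology, so a neighbourhood can be replaced by a
  single form that does not vanish at the point.\<close>

lemma eventually_near:
  "eventually P near \<longleftrightarrow> (\<exists>d. \<exists>f\<in>forms n d. (\<forall>z\<in>p. meval f z \<noteq> 0) \<and>
      (\<forall>q\<in>X. (\<forall>z\<in>q. meval f z \<noteq> 0) \<longrightarrow> P q))" (is "_ \<longleftrightarrow> ?R")
proof
  have top: "p \<in> topspace (subtopology (zariski_proj n) X)"
    using X_subset p_in by auto
  show ?R if "eventually P near"
  proof -
    obtain S where S: "openin (subtopology (zariski_proj n) X) S" "p \<in> S" "\<forall>x\<in>S. P x"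
      using \<open>eventually P near\<close> top unfolding eventually_nhdsin by blast
    then obtain T where T: "openin (zariski_proj n) T" "S = T \<inter> X"
      unfolding openin_subtopology by blast
    obtain d f where "f \<in> forms n d" "\<forall>z\<in>p. meval f z \<noteq> 0"
        "{q \<in> proj_space n. \<forall>z\<in>q. meval f z \<noteq> 0} \<subseteq> T"
      using openin_zariski_projD[OF T(1), of p] S(2) T(2) by blast
    then show ?R using S(3) T(2) X_subset by blast
  qed
  show "eventually P near" if ?R
  proof -
    obtain d f where f: "f \<in> forms n d" "\<forall>z\<in>p. meval f z \<noteq> 0"
        "\<forall>q\<in>X. (\<forall>z\<in>q. meval f z \<noteq> 0) \<longrightarrow> P q" using \<open>?R\<close> by blast
    define T where "T = {q \<in> proj_space n. \<forall>z\<in>q. meval f z \<noteq> 0}"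
    have "openin (zariski_proj n) T"
      unfolding T_def zariski_proj_def using f(1) by (intro topology_generated_by_Basis) blast
    then have "openin (subtopology (zariski_proj n) X) (X \<inter> T)"
      by (rule openin_subtopology_Int2)
    moreover have "p \<in> X \<inter> T" "\<forall>x\<in>X \<inter> T. P x"
      using f p_in X_subset by (auto simp: T_def)
    ultimately show ?thesis unfolding eventually_nhdsin by blast
  qed
qed

lemma eventually_near_imp: "eventually P near \<Longrightarrow> P p"
  unfolding eventually_near using p_in by blast

lemma regular_fraction:
  assumes "g \<in> forms n d" "h \<in> forms n d" "\<forall>z\<in>p. meval h z \<noteq> 0"
    and "\<And>q z. q \<in> X \<Longrightarrow> z \<in> q \<Longrightarrow> \<forall>z\<in>q. meval h z \<noteq> 0 \<Longrightarrow> \<phi> q = meval g z / meval h z"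
  shows "regular \<phi>"
  unfolding regular_at_def eventually_near using assms by blast

lemma regular_const: "regular (\<lambda>_. c)"
proof (rule regular_fraction)
  show "mconst c \<in> forms n 0" by (simp add: forms_eq homogeneous_const)
  show "(1 :: (nat, 'a) mpoly) \<in> forms n 0" by (rule one_in_forms)
qed (simp_all add: meval_simps)

lemma regular_add:
  assumes "regular \<phi>" "regular \<psi>"
  shows "regular (\<lambda>q. \<phi> q + \<psi> q)"
proof -
  obtain d g h where 1: "g \<in> forms n d" "h \<in> forms n d"
      "eventually (\<lambda>q. \<forall>z\<in>q. meval h z \<noteq> 0 \<and> \<phi> q = meval g z / meval h z) near"
    using assms(1) unfolding regular_at_def by blast
  obtain e k l where 2: "k \<in> forms n e" "l \<in> forms n e"
      "eventually (\<lambda>q. \<forall>z\<in>q. meval l z \<noteq> 0 \<and> \<psi> q = meval k z / meval l z) near"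
    using assms(2) unfolding regular_at_def by blast
  have "g * l + k * h \<in> forms n (d + e)"
    using mult_in_forms[OF 1(1) 2(2)] mult_in_forms[OF 2(1) 1(2)]
    by (simp add: forms_eq add.commute homogeneous_add)
  moreover have "h * l \<in> forms n (d + e)" using 1 2 by (simp add: mult_in_forms)
  moreover have "eventually (\<lambda>q. \<forall>z\<in>q. meval (h * l) z \<noteq> 0 \<and>
      \<phi> q + \<psi> q = meval (g * l + k * h) z / meval (h * l) z) near"
    using 1(3) 2(3)
  proof eventually_elim
    case (elim q)
    then show ?case by (auto simp: meval_simps add_frac_eq)
  qed
  ultimately show ?thesis unfolding regular_at_def by blast
qed

lemma regular_mult:
  assumes "regular \<phi>" "regular \<psi>"
  shows "regular (\<lambda>q. \<phi> q * \<psi> q)"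
proof -
  obtain d g h where 1: "g \<in> forms n d" "h \<in> forms n d"
      "eventually (\<lambda>q. \<forall>z\<in>q. meval h z \<noteq> 0 \<and> \<phi> q = meval g z / meval h z) near"
    using assms(1) unfolding regular_at_def by blast
  obtain e k l where 2: "k \<in> forms n e" "l \<in> forms n e"
      "eventually (\<lambda>q. \<forall>z\<in>q. meval l z \<noteq> 0 \<and> \<psi> q = meval k z / meval l z) near"
    using assms(2) unfolding regular_at_def by blast
  have "g * k \<in> forms n (d + e)" "h * l \<in> forms n (d + e)"
    using 1 2 by (simp_all add: mult_in_forms)
  moreover have "eventually (\<lambda>q. \<forall>z\<in>q. meval (h * l) z \<noteq> 0 \<and>
      \<phi> q * \<psi> q = meval (g * k) z / meval (h * l) z) near"
    using 1(3) 2(3)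
  proof eventually_elim
    case (elim q)
    then show ?case by (auto simp: meval_simps)
  qed
  ultimately show ?thesis unfolding regular_at_def by blast
qed

lemma regular_uminus: "regular \<phi> \<Longrightarrow> regular (\<lambda>q. - \<phi> q)"
  using regular_mult[OF regular_const[of "-1"]] by simp

lemma regular_sum: "(\<And>i. i \<in> S \<Longrightarrow> regular (F i)) \<Longrightarrow> regular (\<lambda>q. \<Sum>i\<in>S. F i q)"
  by (induction S rule: infinite_finite_induct) (auto simp: regular_const regular_add)

lemma regular_power: "regular \<phi> \<Longrightarrow> regular (\<lambda>q. \<phi> q ^ k)"
  by (induction k) (auto simp: regular_const regular_mult)

lemma regular_fps_power_nth:
  assumes "\<And>i. regular (F i)"
  shows "regular (\<lambda>q. (Abs_fps (\<lambda>i. F i q) ^ k) $ m)"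
proof (induction k arbitrary: m)
  case 0
  show ?case by (simp add: regular_const)
next
  case (Suc k)
  then show ?case by (simp add: fps_mult_nth regular_sum regular_mult assms)
qed

lemma germ_eq_iff: "\<G> \<phi> = \<G> \<psi> \<longleftrightarrow> eventually (\<lambda>q. \<phi> q = \<psi> q) near"
proof
  assume "\<G> \<phi> = \<G> \<psi>"
  then have "\<phi> \<in> \<G> \<psi>" by (auto simp: germ_def)
  then show "eventually (\<lambda>q. \<phi> q = \<psi> q) near" by (simp add: germ_def)
next
  assume *: "eventually (\<lambda>q. \<phi> q = \<psi> q) near"
  show "\<G> \<phi> = \<G> \<psi>"
    unfolding germ_def
  proof (intro Collect_cong eventually_subst)
    fix \<chi>
    show "eventually (\<lambda>q. (\<chi> q = \<phi> q) = (\<chi> q = \<psi> q)) near"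
      using * by eventually_elim simp
  qed
qed

text \<open>Operations on germs do not depend on representatives; hence all members of the unions in
  \<open>local_ring\<close> coincide and the unions collapse.\<close>

lemma germ_cong2:
  assumes "\<phi>' \<in> \<G> \<phi>" "\<psi>' \<in> \<G> \<psi>"
  shows "\<G> (\<lambda>q. F (\<phi>' q) (\<psi>' q)) = \<G> (\<lambda>q. F (\<phi> q) (\<psi> q))"
proof -
  have "eventually (\<lambda>q. \<phi>' q = \<phi> q) near" "eventually (\<lambda>q. \<psi>' q = \<psi> q) near"
    using assms by (simp_all add: germ_def)
  then have "eventually (\<lambda>q. F (\<phi>' q) (\<psi>' q) = F (\<phi> q) (\<psi> q)) near"
    by eventually_elim simp
  then show ?thesis by (simp add: germ_eq_iff)
qed

lemma germ_self: "\<phi> \<in> \<G> \<phi>"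
  by (simp add: germ_def)

lemma local_ring_mult: "\<G> \<phi> \<otimes>\<^bsub>\<O>\<^esub> \<G> \<psi> = \<G> (\<lambda>q. \<phi> q * \<psi> q)"
proof -
  have "(\<Union>\<phi>'\<in>\<G> \<phi>. \<Union>\<psi>'\<in>\<G> \<psi>. \<G> (\<lambda>q. \<phi>' q * \<psi>' q)) = (\<Union>\<phi>'\<in>\<G> \<phi>. \<Union>\<psi>'\<in>\<G> \<psi>. \<G> (\<lambda>q. \<phi> q * \<psi> q))"
    by (intro SUP_cong refl germ_cong2)
  also have "\<dots> = \<G> (\<lambda>q. \<phi> q * \<psi> q)"
    using germ_self by blast
  finally show ?thesis by (simp add: local_ring_def)
qed

lemma local_ring_add: "\<G> \<phi> \<oplus>\<^bsub>\<O>\<^esub> \<G> \<psi> = \<G> (\<lambda>q. \<phi> q + \<psi> q)"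
proof -
  have "(\<Union>\<phi>'\<in>\<G> \<phi>. \<Union>\<psi>'\<in>\<G> \<psi>. \<G> (\<lambda>q. \<phi>' q + \<psi>' q)) = (\<Union>\<phi>'\<in>\<G> \<phi>. \<Union>\<psi>'\<in>\<G> \<psi>. \<G> (\<lambda>q. \<phi> q + \<psi> q))"
    by (intro SUP_cong refl germ_cong2)
  also have "\<dots> = \<G> (\<lambda>q. \<phi> q + \<psi> q)"
    using germ_self by blast
  finally show ?thesis by (simp add: local_ring_def)
qed

lemma local_ring_one: "\<one>\<^bsub>\<O>\<^esub> = \<G> (\<lambda>_. 1)" and local_ring_zero: "\<zero>\<^bsub>\<O>\<^esub> = \<G> (\<lambda>_. 0)"
  by (simp_all add: local_ring_def)

lemma local_ring_carrier: "A \<in> carrier \<O> \<longleftrightarrow> (\<exists>\<phi>. regular \<phi> \<and> A = \<G> \<phi>)"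
  by (auto simp: local_ring_def)

lemma germ_in_carrier: "regular \<phi> \<Longrightarrow> \<G> \<phi> \<in> carrier \<O>"
  by (auto simp: local_ring_carrier)

lemmas local_ring_ops = local_ring_mult local_ring_add local_ring_one local_ring_zero

lemma cring_local_ring: "cring \<O>"
proof (rule cringI)
  show "abelian_group \<O>"
  proof (rule abelian_groupI)
    fix A B C
    assume "A \<in> carrier \<O>" "B \<in> carrier \<O>" "C \<in> carrier \<O>"
    then obtain \<phi> \<psi> \<chi> where *: "A = \<G> \<phi>" "B = \<G> \<psi>" "C = \<G> \<chi>"
      unfolding local_ring_carrier by blast
    show "A \<oplus>\<^bsub>\<O>\<^esub> B \<oplus>\<^bsub>\<O>\<^esub> C = A \<oplus>\<^bsub>\<O>\<^esub> (B \<oplus>\<^bsub>\<O>\<^esub> C)"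
      by (simp add: * local_ring_ops add.assoc)
  next
    fix A B
    assume "A \<in> carrier \<O>" "B \<in> carrier \<O>"
    then obtain \<phi> \<psi> where *: "A = \<G> \<phi>" "B = \<G> \<psi>" "regular \<phi>" "regular \<psi>"
      unfolding local_ring_carrier by blast
    show "A \<oplus>\<^bsub>\<O>\<^esub> B \<in> carrier \<O>"
      using * by (simp add: local_ring_ops germ_in_carrier regular_add)
    show "A \<oplus>\<^bsub>\<O>\<^esub> B = B \<oplus>\<^bsub>\<O>\<^esub> A"
      by (simp add: * local_ring_ops add.commute)
  next
    show "\<zero>\<^bsub>\<O>\<^esub> \<in> carrier \<O>"
      by (simp add: local_ring_ops germ_in_carrier regular_const)
  next
    fix A assume "A \<in> carrier \<O>"
    then obtain \<phi> where *: "A = \<G> \<phi>" "regular \<phi>"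
      unfolding local_ring_carrier by blast
    show "\<zero>\<^bsub>\<O>\<^esub> \<oplus>\<^bsub>\<O>\<^esub> A = A"
      by (simp add: * local_ring_ops)
    show "\<exists>B\<in>carrier \<O>. B \<oplus>\<^bsub>\<O>\<^esub> A = \<zero>\<^bsub>\<O>\<^esub>"
      by (rule bexI[OF _ germ_in_carrier[OF regular_uminus[OF *(2)]]]) (simp add: * local_ring_ops)
  qed
  show "comm_monoid \<O>"
  proof (rule comm_monoidI)
    fix A B C
    assume "A \<in> carrier \<O>" "B \<in> carrier \<O>" "C \<in> carrier \<O>"
    then obtain \<phi> \<psi> \<chi> where *: "A = \<G> \<phi>" "B = \<G> \<psi>" "C = \<G> \<chi>"
      unfolding local_ring_carrier by blast
    show "A \<otimes>\<^bsub>\<O>\<^esub> B \<otimes>\<^bsub>\<O>\<^esub> C = A \<otimes>\<^bsub>\<O>\<^esub> (B \<otimes>\<^bsub>\<O>\<^esub> C)"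
      by (simp add: * local_ring_ops mult.assoc)
  next
    fix A B
    assume "A \<in> carrier \<O>" "B \<in> carrier \<O>"
    then obtain \<phi> \<psi> where *: "A = \<G> \<phi>" "B = \<G> \<psi>" "regular \<phi>" "regular \<psi>"
      unfolding local_ring_carrier by blast
    show "A \<otimes>\<^bsub>\<O>\<^esub> B \<in> carrier \<O>"
      using * by (simp add: local_ring_ops germ_in_carrier regular_mult)
    show "A \<otimes>\<^bsub>\<O>\<^esub> B = B \<otimes>\<^bsub>\<O>\<^esub> A"
      by (simp add: * local_ring_ops mult.commute)
  next
    show "\<one>\<^bsub>\<O>\<^esub> \<in> carrier \<O>"
      by (simp add: local_ring_ops germ_in_carrier regular_const)
  next
    fix A assume "A \<in> carrier \<O>"
    then obtain \<phi> where *: "A = \<G> \<phi>"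
      unfolding local_ring_carrier by blast
    show "\<one>\<^bsub>\<O>\<^esub> \<otimes>\<^bsub>\<O>\<^esub> A = A"
      by (simp add: * local_ring_ops)
  qed
  fix A B C
  assume "A \<in> carrier \<O>" "B \<in> carrier \<O>" "C \<in> carrier \<O>"
  then obtain \<phi> \<psi> \<chi> where *: "A = \<G> \<phi>" "B = \<G> \<psi>" "C = \<G> \<chi>"
    unfolding local_ring_carrier by blast
  show "(A \<oplus>\<^bsub>\<O>\<^esub> B) \<otimes>\<^bsub>\<O>\<^esub> C = A \<otimes>\<^bsub>\<O>\<^esub> C \<oplus>\<^bsub>\<O>\<^esub> B \<otimes>\<^bsub>\<O>\<^esub> C"
    by (simp add: * local_ring_ops distrib_right)
qed

sublocale \<O>: cring "local_ring n X p"
  by (rule cring_local_ring)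

lemma local_ring_power: "\<G> \<phi> [^]\<^bsub>\<O>\<^esub> (k::nat) = \<G> (\<lambda>q. \<phi> q ^ k)"
  by (induction k) (simp_all add: local_ring_ops mult.commute)

lemma local_ring_finsum:
  assumes "finite S" "\<And>i. i \<in> S \<Longrightarrow> regular (F i)"
  shows "finsum \<O> (\<lambda>i. \<G> (F i)) S = \<G> (\<lambda>q. \<Sum>i\<in>S. F i q)"
  using assms
proof (induction S)
  case empty
  then show ?case by (simp add: local_ring_zero)
next
  case (insert x S)
  then have "finsum \<O> (\<lambda>i. \<G> (F i)) (insert x S) = \<G> (F x) \<oplus>\<^bsub>\<O>\<^esub> finsum \<O> (\<lambda>i. \<G> (F i)) S"
    by (intro \<O>.finsum_insert) (auto intro!: germ_in_carrier)
  then show ?case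
    using insert by (simp add: local_ring_add)
qed

text \<open>Ring operations on germs are pointwise operations on representatives, so integral
  closedness can be applied to functions that satisfy the equation only near the point.\<close>

lemma integrally_closed_local_ringD:
  assumes "integrally_closed_domain \<O>" "regular \<alpha>" "regular \<beta>"
    and "\<not> eventually (\<lambda>q. \<beta> q = 0) near"
    and "\<And>i. i < k \<Longrightarrow> regular (\<gamma> i)"
    and "eventually (\<lambda>q. \<alpha> q ^ k + (\<Sum>i<k. \<gamma> i q * \<alpha> q ^ i * \<beta> q ^ (k - i)) = 0) near"
  obtains \<rho> where "regular \<rho>" "eventually (\<lambda>q. \<alpha> q = \<rho> q * \<beta> q) near"
proof -
  have reg: "regular (\<lambda>q. \<gamma> i q * \<alpha> q ^ i * \<beta> q ^ (k - i))" if "i < k" for i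
    using that assms by (intro regular_mult regular_power)
  have "\<G> \<alpha> [^]\<^bsub>\<O>\<^esub> k \<oplus>\<^bsub>\<O>\<^esub>
      (\<Oplus>\<^bsub>\<O>\<^esub>i\<in>{..<k}. \<G> (\<gamma> i) \<otimes>\<^bsub>\<O>\<^esub> \<G> \<alpha> [^]\<^bsub>\<O>\<^esub> i \<otimes>\<^bsub>\<O>\<^esub> \<G> \<beta> [^]\<^bsub>\<O>\<^esub> (k - i)) =
      \<G> (\<lambda>q. \<alpha> q ^ k + (\<Sum>i<k. \<gamma> i q * \<alpha> q ^ i * \<beta> q ^ (k - i)))"
    unfolding local_ring_power local_ring_mult
    by (subst local_ring_finsum) (simp_all add: reg local_ring_add)
  also have "\<dots> = \<zero>\<^bsub>\<O>\<^esub>"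
    using assms(6) by (simp add: local_ring_zero germ_eq_iff)
  finally have eq: "\<G> \<alpha> [^]\<^bsub>\<O>\<^esub> k \<oplus>\<^bsub>\<O>\<^esub>
      (\<Oplus>\<^bsub>\<O>\<^esub>i\<in>{..<k}. \<G> (\<gamma> i) \<otimes>\<^bsub>\<O>\<^esub> \<G> \<alpha> [^]\<^bsub>\<O>\<^esub> i \<otimes>\<^bsub>\<O>\<^esub> \<G> \<beta> [^]\<^bsub>\<O>\<^esub> (k - i)) = \<zero>\<^bsub>\<O>\<^esub>" .
  have \<gamma>: "(\<lambda>i. \<G> (\<gamma> i)) \<in> {..<k} \<rightarrow> carrier \<O>"
    using assms(5) by (auto intro!: germ_in_carrier)
  have \<alpha>: "\<G> \<alpha> \<in> carrier \<O>" and \<beta>: "\<G> \<beta> \<in> carrier \<O> - {\<zero>\<^bsub>\<O>\<^esub>}"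
    using assms(2-4) by (auto simp: germ_in_carrier local_ring_zero germ_eq_iff)
  have "\<exists>r\<in>carrier \<O>. \<G> \<alpha> = r \<otimes>\<^bsub>\<O>\<^esub> \<G> \<beta>"
    by (rule assms(1)[unfolded integrally_closed_domain_def, THEN conjunct2, rule_format, OF \<alpha> \<beta>])
      (rule exI[of _ k], rule bexI[of _ "\<lambda>i. \<G> (\<gamma> i)"], rule eq, rule \<gamma>)
  then obtain \<rho> where "regular \<rho>" "\<G> \<alpha> = \<G> (\<lambda>q. \<rho> q * \<beta> q)"
    by (auto simp: local_ring_carrier local_ring_mult)
  then show thesis using that by (simp add: germ_eq_iff)
qed

end

text \<open>If \<open>b = s \<otimes> a\<close>, cancelling the power of \<open>a\<close> from the
  monic equation leaves 1 + s e = 0. So \<open>s\<close> is a unit, and \<open>a\<close> is a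
  multiple of \<open>b\<close> after all.\<close>

lemma valuation_domain_integrally_closed:
  fixes R (structure)
  assumes "domain R"
    and val: "\<And>a b. a \<in> carrier R \<Longrightarrow> b \<in> carrier R \<Longrightarrow>
      (\<exists>r\<in>carrier R. a = r \<otimes> b) \<or> (\<exists>r\<in>carrier R. b = r \<otimes> a)"
  shows "integrally_closed_domain R"
  unfolding integrally_closed_domain_def
proof (intro conjI ballI impI)
  interpret domain R by fact
  fix a b
  assume a: "a \<in> carrier R" and b: "b \<in> carrier R - {\<zero>}"
    and "\<exists>k::nat. \<exists>c\<in>{..<k} \<rightarrow> carrier R.
      a [^] k \<oplus> (\<Oplus>i\<in>{..<k}. c i \<otimes> a [^] i \<otimes> b [^] (k - i)) = \<zero>"
  then obtain k :: nat and c where c: "c \<in> {..<k} \<rightarrow> carrier R"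
    and eq: "a [^] k \<oplus> (\<Oplus>i\<in>{..<k}. c i \<otimes> a [^] i \<otimes> b [^] (k - i)) = \<zero>" by blast
  show "\<exists>r\<in>carrier R. a = r \<otimes> b"
  proof (cases "a = \<zero>")
    case True
    then show ?thesis using b by (intro bexI[of _ \<zero>]) auto
  next
    case False
    from val[OF a, of b] b consider "\<exists>r\<in>carrier R. a = r \<otimes> b" | s where "s \<in> carrier R" "b = s \<otimes> a"
      by blast
    then show ?thesis
    proof cases
      case (2 s)
      note s = 2(1)
      have ci: "c i \<in> carrier R" if "i < k" for i using c that by auto
      \<comment> \<open>After substituting \<open>s \<otimes> a\<close> for \<open>b\<close>, each
        term with \<open>i < k\<close> contains \<open>a [^] k\<close> and at least one factor
        \<open>s\<close>; \<open>e\<close> collects what remains.\<close>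
      define e where "e = (\<Oplus>i\<in>{..<k}. c i \<otimes> s [^] (k - i - 1))"
      have e: "e \<in> carrier R" unfolding e_def using ci s by (intro finsum_closed) auto
      have term_eq: "c i \<otimes> a [^] i \<otimes> b [^] (k - i) = (a [^] k \<otimes> s) \<otimes> (c i \<otimes> s [^] (k - i - 1))"
        if "i < k" for i
      proof -
        have "b [^] (k - i) = s [^] (k - i) \<otimes> a [^] (k - i)"
          unfolding 2(2) using s a by (rule nat_pow_distrib)
        moreover have "s [^] (k - i) = s \<otimes> s [^] (k - i - 1)"
          using that s nat_pow_Suc2[OF s, of "k - i - 1"] by (simp add: Suc_diff_Suc)
        moreover have "a [^] k = a [^] i \<otimes> a [^] (k - i)"
          using that a nat_pow_mult[OF a, of i "k - i"] by simp
        ultimately show ?thesis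
          using ci[OF that] s a by (simp add: m_ac)
      qed
      have "(\<Oplus>i\<in>{..<k}. c i \<otimes> a [^] i \<otimes> b [^] (k - i)) =
          (\<Oplus>i\<in>{..<k}. (a [^] k \<otimes> s) \<otimes> (c i \<otimes> s [^] (k - i - 1)))"
        using ci s a term_eq by (intro finsum_cong') auto
      also have "\<dots> = (a [^] k \<otimes> s) \<otimes> e"
        unfolding e_def using ci s a by (intro finsum_rdistr[symmetric]) auto
      finally have "a [^] k \<otimes> (\<one> \<oplus> s \<otimes> e) = \<zero>"
        using eq a s e by (simp add: r_distr m_assoc)
      moreover have "a [^] k \<noteq> \<zero>"
        using False a nat_pow_zero by (induction k) (auto simp: integral_iff)
      ultimately have "\<one> \<oplus> s \<otimes> e = \<zero>"
        using integral_iff[of "a [^] k" "\<one> \<oplus> s \<otimes> e"] a s e by auto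
      then have "s \<otimes> (\<ominus> e) = \<one>"
        using s e by (metis m_closed minus_equality one_closed r_minus minus_minus)
      then have "a = (\<ominus> e) \<otimes> b"
        unfolding 2(2) using a s e by (metis a_inv_closed l_one m_assoc m_comm)
      then show ?thesis using e by blast
    qed
  qed
qed (rule assms(1))

section \<open>Degree at least three: failure of normality\<close>

definition poly_curve :: "(nat \<Rightarrow> 'a::field poly) \<Rightarrow> 'a \<Rightarrow> (nat \<Rightarrow> 'a) set" where
  "poly_curve w t = proj_pt (\<lambda>i. poly (w i) t)"

abbreviation curve_pullback :: "(nat \<Rightarrow> 'a::field poly) \<Rightarrow> (nat, 'a) mpoly \<Rightarrow> 'a poly" where
  "curve_pullback w f \<equiv> mpoly_map_eval (\<lambda>c. [:c:]) w f"

lemma ball_poly_curve: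
  assumes "f \<in> forms n d"
  shows "(\<forall>z\<in>poly_curve w t. meval f z \<noteq> 0) \<longleftrightarrow> poly (curve_pullback w f) t \<noteq> 0"
  unfolding poly_curve_def ball_proj_pt_meval(2)[OF assms] meval_poly_curve ..

text \<open>The form defining a neighbourhood pulls back to a univariate polynomial
  \<open>H\<close>, so a local property holds on the curve away from the zeros of \<open>H\<close>,
  and \<open>t0\<close> is not among these.\<close>

lemma eventually_on_curve:
  assumes X: "X \<subseteq> proj_space n" and on: "\<And>t. poly_curve w t \<in> X"
    and ev: "eventually P (nhdsin (subtopology (zariski_proj n) X) (poly_curve w t0))"
  obtains H where "poly H t0 \<noteq> 0" "\<And>t. poly H t \<noteq> 0 \<Longrightarrow> P (poly_curve w t)"
proof -
  interpret proj_subset_point n X "poly_curve w t0"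
    by unfold_locales (use X on in auto)
  obtain d f where f: "f \<in> forms n d" "\<forall>z\<in>poly_curve w t0. meval f z \<noteq> 0"
      "\<forall>q\<in>X. (\<forall>z\<in>q. meval f z \<noteq> 0) \<longrightarrow> P q"
    using ev unfolding eventually_near by blast
  show thesis
  proof (rule that)
    show "poly (curve_pullback w f) t0 \<noteq> 0"
      using f(2) unfolding ball_poly_curve[OF f(1)] .
    show "P (poly_curve w t)" if "poly (curve_pullback w f) t \<noteq> 0" for t
      using f(3) on that unfolding ball_poly_curve[OF f(1), symmetric] by blast
  qed
qed

lemma regular_on_curve:
  assumes X: "X \<subseteq> proj_space n" and on: "\<And>t. poly_curve w t \<in> X"
    and reg: "regular_at n X (poly_curve w t0) \<phi>"
  obtains d g h H where "g \<in> forms n d" "h \<in> forms n d" "poly H t0 \<noteq> 0"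
    "poly (curve_pullback w h) t0 \<noteq> 0"
    "\<And>t. poly H t \<noteq> 0 \<Longrightarrow> poly (curve_pullback w h) t \<noteq> 0 \<and>
      \<phi> (poly_curve w t) = poly (curve_pullback w g) t / poly (curve_pullback w h) t"
proof -
  obtain d g h where gh: "g \<in> forms n d" "h \<in> forms n d"
      "eventually (\<lambda>q. \<forall>z\<in>q. meval h z \<noteq> 0 \<and> \<phi> q = meval g z / meval h z)
        (nhdsin (subtopology (zariski_proj n) X) (poly_curve w t0))"
    using reg unfolding regular_at_def by blast
  obtain H where H: "poly H t0 \<noteq> 0" "\<And>t. poly H t \<noteq> 0 \<Longrightarrow>
      \<forall>z\<in>poly_curve w t. meval h z \<noteq> 0 \<and> \<phi> (poly_curve w t) = meval g z / meval h z"
    using eventually_on_curve[OF X on gh(3)] by blast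
  have *: "poly (curve_pullback w h) t \<noteq> 0 \<and>
      \<phi> (poly_curve w t) = poly (curve_pullback w g) t / poly (curve_pullback w h) t"
    if "poly H t \<noteq> 0" for t
    using bspec[OF H(2)[OF that], of "\<lambda>i. poly (w i) t"] by (simp add: poly_curve_def meval_poly_curve)
  show thesis
    by (rule that[OF gh(1,2) H(1)]) (use * H(1) in auto)
qed

lemma poly_eq_0_if_mult_vanishes:
  fixes p q :: "'a::field_char_0 poly"
  assumes "\<And>t. poly q t \<noteq> 0 \<Longrightarrow> poly p t = 0" "q \<noteq> 0"
  shows "p = 0"
proof -
  have "poly (p * q) t = 0" for t using assms(1)[of t] by auto
  then have "p * q = 0" using poly_all_0_iff_0 by blast
  then show ?thesis using assms(2) by simp
qed

text \<open>The derivative of x^n + 1 vanishes at most at 0, which is not a root, so all roots are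
  simple; algebraic closedness then provides as many roots as the degree.\<close>

lemma card_roots_of_minus_one:
  assumes "n \<ge> 1"
  shows "card {x :: 'a::{alg_closed_field, field_char_0}. x ^ n = -1} = n"
proof -
  define P :: "'a poly" where "P = monom 1 n + 1"
  have coeff_P: "coeff P i = (if i = n then 1 else 0) + (if i = 0 then 1 else 0)" for i
    by (auto simp: P_def)
  have deg: "degree P = n"
  proof (rule antisym)
    show "degree P \<le> n" by (rule degree_le) (simp add: coeff_P)
    show "n \<le> degree P" by (rule le_degree) (use assms in \<open>simp add: coeff_P\<close>)
  qed
  then have P0: "P \<noteq> 0" using assms by auto
  have pP: "poly P x = x ^ n + 1" for x by (simp add: P_def poly_monom)
  have "rsquarefree P"
    unfolding rsquarefree_roots
  proof (intro allI notI)
    fix a assume a: "poly P a = 0 \<and> poly (pderiv P) a = 0"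
    have "poly (pderiv P) a = of_nat n * a ^ (n - 1)"
      by (simp add: P_def pderiv_add pderiv_monom poly_monom)
    then have "a ^ (n - 1) = 0" using a assms by simp
    then have "a ^ n = 0" using assms by (cases n) auto
    then show False using a assms by (simp add: pP power_0_left)
  qed
  then have ord: "order x P = 1" if "x \<in># proots P" for x
    using that P0 by (intro rsquarefree_root_order) auto
  obtain A where A: "size A = degree P" "P = smult (lead_coeff P) (\<Prod>x\<in>#A. [:-x, 1:])"
    using alg_closed_imp_factorization[OF P0] by blast
  have "proots P = proots (\<Prod>x\<in>#A. [:-x, 1:])"
    by (subst A(2)) (use P0 in simp)
  also have "\<dots> = A"
  proof (induction A)
    case (add x A)
    have "(\<Prod>x\<in>#A. [:-x, 1:]) \<noteq> 0"
      by (auto simp: prod_mset_zero_iff)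
    then have "proots ([:-x, 1:] * (\<Prod>x\<in>#A. [:-x, 1:])) = proots [:-x, 1:] + proots (\<Prod>x\<in>#A. [:-x, 1:])"
      by (intro proots_mult) auto
    then show ?case
      by (simp only: add.IH image_mset_add_mset prod_mset.add_mset proots_linear_factor) simp
  qed simp
  finally have "size (proots P) = n" using A(1) deg by simp
  moreover have "size (proots P) = (\<Sum>x\<in>set_mset (proots P). 1)"
    unfolding size_multiset_overloaded_eq
    by (rule sum.cong) (use ord P0 in \<open>simp_all\<close>)
  moreover have "set_mset (proots P) = {x. x ^ n = -1}"
    using P0 by (auto simp: pP eq_neg_iff_add_eq_0)
  ultimately show ?thesis by simp
qed

section \<open>The branches through the non-normal point\<close>

definition e2 :: "nat \<Rightarrow> 'a::zero_neq_one" where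
  "e2 = (\<lambda>j. if j = 2 then 1 else 0)"

definition branch :: "'a::field \<Rightarrow> nat \<Rightarrow> 'a poly" where
  "branch \<zeta> i = (if i = 0 then [:0, 0, 1:] else if i = 1 then [:0, 1 + \<zeta>:] else if i = 2 then [:\<zeta>:] else 0)"

lemma fps_L_linear_nth:
  assumes "n \<ge> 1"
  shows "fps_L (1 + fps_const a * fps_X) $ n = (-1) ^ (n - 1) / of_nat n * a ^ n"
proof -
  have "fps_L (1 + fps_const a * fps_X) $ n = (\<Sum>k=0..n. fps_ln 1 $ k * ((fps_const a * fps_X) ^ k) $ n)"
    by (simp add: fps_L_def fps_compose_nth)
  also have "\<dots> = (\<Sum>k=0..n. if k = n then (-1) ^ (n - 1) / of_nat n * a ^ n else 0)"
    by (rule sum.cong) (use assms in \<open>auto simp: power_mult_distrib fps_const_power fps_ln_nth\<close>)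
  also have "\<dots> = (-1) ^ (n - 1) / of_nat n * a ^ n"
    by (simp add: sum.delta)
  finally show ?thesis .
qed

text \<open>The logarithm of (1 + ax)(1 + bx) has x^n coefficient (-1)^(n-1) (a^n + b^n) / n. With a
  = \<zeta>/t and b = 1/t it vanishes exactly because \<zeta>^n = -1. At t = 0 the curve meets the
  boundary.\<close>

lemma log_form_branch:
  fixes \<zeta> :: "'a::field_char_0"
  assumes n: "n \<ge> 2" and \<zeta>: "\<zeta> ^ n = -1"
  shows "log_form n (\<lambda>i. poly (branch \<zeta> i) t) = 0"
proof (cases "t = 0")
  case True
  then show ?thesis using n by (simp add: log_form_boundary branch_def)
next
  case False
  define z where "z = (\<lambda>i. poly (branch \<zeta> i) t)"
  define P Q :: "'a fps" where "P = 1 + fps_const (\<zeta> / t) * fps_X" and "Q = 1 + fps_const (1 / t) * fps_X"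
  define u where "u = fps_L P + fps_L Q"
  have z0: "z 0 = t ^ 2" by (simp add: z_def branch_def power2_eq_square)
  have E: "fps_E u = P * Q"
    unfolding u_def by (subst fps_E_add) (simp_all add: fps_E_L P_def Q_def)
  have PQ: "P * Q = 1 + fps_const ((1 + \<zeta>) / t) * fps_X + fps_const (\<zeta> / t ^ 2) * fps_X ^ 2"
  proof -
    have "P * Q = 1 + (fps_const (\<zeta> / t) + fps_const (1 / t)) * fps_X +
        fps_const (\<zeta> / t) * fps_const (1 / t) * fps_X ^ 2"
      unfolding P_def Q_def by (simp only: power2_eq_square ring_distribs mult_1_left mult_1_right ac_simps)
    then show ?thesis by (simp add: power2_eq_square add_divide_distrib add.commute)
  qed
  have z_coeff: "z j = t ^ 2 * fps_E u $ j" for j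
  proof -
    consider "j = 0" | "j = 1" | "j = 2" | "j \<ge> 3" by linarith
    then show ?thesis
      unfolding E PQ z_def branch_def using False
      by cases (simp_all add: fps_X_power_nth power2_eq_square)
  qed
  have un: "u $ n = 0"
    using n False by (simp add: u_def P_def Q_def fps_L_linear_nth power_divide \<zeta> flip: distrib_left add_divide_distrib)
  have "z \<in> aff_space (n + 1)"
    using n by (auto simp: aff_space_def z_def branch_def)
  then have "z \<in> exp_cone n"
    using n False un z_coeff by (intro exp_coneI[where c = "t ^ 2" and u = u]) (auto simp: u_def)
  then show ?thesis
    using n by (simp add: exp_cone_eq z_def)
qed

lemma branch_at_0: "(\<lambda>i. poly (branch \<zeta> i) 0) = (\<lambda>i. \<zeta> * e2 i)"
  by (auto simp: branch_def e2_def)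

lemma poly_curve_branch_0: "\<zeta> \<noteq> 0 \<Longrightarrow> poly_curve (branch \<zeta>) 0 = proj_pt e2"
  by (simp add: poly_curve_def branch_at_0 proj_pt_scale)

lemma poly_curve_branch_in:
  fixes \<zeta> :: "'a::{alg_closed_field, field_char_0}"
  assumes n: "n \<ge> 2" and \<zeta>: "\<zeta> ^ n = -1"
  shows "poly_curve (branch \<zeta>) t \<in> exp_hypersurface n"
proof -
  let ?z = "\<lambda>i. poly (branch \<zeta> i) t"
  have "?z 2 \<noteq> 0"
    using \<zeta> n by (auto simp: branch_def power_0_left)
  then have "?z \<noteq> (\<lambda>_. 0)" by metis
  moreover have "?z \<in> aff_space (n + 1)"
    using n by (auto simp: aff_space_def branch_def)
  ultimately show ?thesis
    unfolding poly_curve_def using n log_form_branch[OF n \<zeta>]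
    by (subst proj_pt_in_exp_hypersurface) auto
qed

section \<open>The integral equation\<close>

definition log_coeff :: "nat \<Rightarrow> nat \<Rightarrow> (nat \<Rightarrow> 'a::field_char_0) \<Rightarrow> 'a" where
  "log_coeff n k v = (\<Sum>i\<in>{i. i \<le> k \<and> 2 * k \<le> i + n}. of_nat (k choose i) * v 1 ^ (i + n - 2 * k) *
     (Abs_fps (\<lambda>m. v (m + 2)) ^ (k - i)) $ (i + n - 2 * k))"

text \<open>Split the tail as z_1 x + x^2 V. A product of i copies of the first summand and k - i of
  the second starts in degree i + 2(k - i), so it contributes to x^n only if i + n \<ge> 2k.
  Together with the factor z_1^n it then contains z_1^(2k), and \<open>log_coeff\<close> is the
  quotient.\<close>

lemma log_coeff_eq:
  assumes "k \<ge> 1"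
  shows "v 1 ^ n * (fps_tail v ^ k) $ n = log_coeff n k v * (v 1 ^ 2) ^ k"
proof -
  define V where "V = Abs_fps (\<lambda>m. v (m + 2))"
  have tail: "fps_tail v = fps_const (v 1) * fps_X + fps_X ^ 2 * V"
  proof (rule fps_ext)
    fix j :: nat
    consider "j = 0" | "j = 1" | i where "j = i + 2"
      by (metis One_nat_def add_2_eq_Suc' not0_implies_Suc)
    then show "fps_tail v $ j = (fps_const (v 1) * fps_X + fps_X ^ 2 * V) $ j"
      by cases (auto simp: fps_tail_def V_def fps_X_power_mult_nth)
  qed
  have term_nth: "(of_nat (k choose i) * (fps_const (v 1) * fps_X) ^ i * (fps_X ^ 2 * V) ^ (k - i)) $ n =
      (if 2 * k \<le> i + n then of_nat (k choose i) * v 1 ^ i * (V ^ (k - i)) $ (i + n - 2 * k) else 0)"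
    if "i \<le> k" for i
  proof -
    have eq: "of_nat (k choose i) * (fps_const (v 1) * fps_X) ^ i * (fps_X ^ 2 * V) ^ (k - i) =
        fps_const (of_nat (k choose i) * v 1 ^ i) * (fps_X ^ (i + 2 * (k - i)) * V ^ (k - i))"
      unfolding power_mult_distrib fps_const_power power_mult[symmetric] power_add
        fps_of_nat[symmetric] fps_const_mult[symmetric]
      by (simp only: ac_simps)
    have "(n < i + 2 * (k - i)) = (\<not> 2 * k \<le> i + n)" "n - (i + 2 * (k - i)) = i + n - 2 * k"
      using that by auto
    then show ?thesis
      unfolding eq fps_mult_left_const_nth fps_X_power_mult_nth by simp
  qed
  have "(fps_tail v ^ k) $ n = (\<Sum>i\<le>k. (of_nat (k choose i) * (fps_const (v 1) * fps_X) ^ i *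
      (fps_X ^ 2 * V) ^ (k - i)) $ n)"
    unfolding tail binomial_ring by (simp add: fps_sum_nth)
  also have "\<dots> = (\<Sum>i\<le>k. if 2 * k \<le> i + n
      then of_nat (k choose i) * v 1 ^ i * (V ^ (k - i)) $ (i + n - 2 * k) else 0)"
    by (rule sum.cong[OF refl]) (rule term_nth, simp)
  also have "\<dots> = (\<Sum>i\<in>{i. i \<le> k \<and> 2 * k \<le> i + n}.
      of_nat (k choose i) * v 1 ^ i * (V ^ (k - i)) $ (i + n - 2 * k))"
    by (rule sum.mono_neutral_cong_right) auto
  finally have "v 1 ^ n * (fps_tail v ^ k) $ n = (\<Sum>i\<in>{i. i \<le> k \<and> 2 * k \<le> i + n}.
      v 1 ^ n * (of_nat (k choose i) * v 1 ^ i * (V ^ (k - i)) $ (i + n - 2 * k)))"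
    by (simp add: sum_distrib_left)
  also have "\<dots> = (\<Sum>i\<in>{i. i \<le> k \<and> 2 * k \<le> i + n}.
      of_nat (k choose i) * v 1 ^ (i + n - 2 * k) * (V ^ (k - i)) $ (i + n - 2 * k) * (v 1 ^ 2) ^ k)"
  proof (rule sum.cong)
    fix i assume i: "i \<in> {i. i \<le> k \<and> 2 * k \<le> i + n}"
    then have eq: "v 1 ^ n * v 1 ^ i = v 1 ^ (i + n - 2 * k) * (v 1 ^ 2) ^ k"
      by (simp add: add.commute flip: power_add power_mult)
    have "v 1 ^ n * (of_nat (k choose i) * v 1 ^ i * (V ^ (k - i)) $ (i + n - 2 * k)) =
        of_nat (k choose i) * (V ^ (k - i)) $ (i + n - 2 * k) * (v 1 ^ n * v 1 ^ i)"
      by (simp only: mult_ac)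
    then show "v 1 ^ n * (of_nat (k choose i) * v 1 ^ i * (V ^ (k - i)) $ (i + n - 2 * k)) =
        of_nat (k choose i) * v 1 ^ (i + n - 2 * k) * (V ^ (k - i)) $ (i + n - 2 * k) * (v 1 ^ 2) ^ k"
      unfolding eq by (simp only: mult_ac)
  qed simp
  finally show ?thesis
    by (simp add: log_coeff_def V_def sum_distrib_right)
qed

text \<open>Coefficients, in coordinates with \<open>z\<^sub>2 = 1\<close>, of the monic equation for \<open>z\<^sub>1\<^sup>2 / z\<^sub>0\<close> that results from
  multiplying \<open>log_form n v = 0\<close> by \<open>v 1 ^ n\<close> and the inverse of the coefficient of \<open>v 1 ^ n\<close>.\<close>

definition integral_coeff :: "nat \<Rightarrow> nat \<Rightarrow> (nat \<Rightarrow> 'a::field_char_0) \<Rightarrow> 'a" where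
  "integral_coeff n k v =
    (if k = 0 then 0 else of_nat n * (-1) ^ (n - 1) * ((-1) ^ (k - 1) / of_nat k) * log_coeff n k v)"

lemma integral_equation:
  fixes v :: "nat \<Rightarrow> 'a::field_char_0"
  assumes n: "n \<ge> 1" and v: "log_form n v = 0"
  shows "(v 1 ^ 2) ^ n + (\<Sum>k<n. integral_coeff n k v * (v 1 ^ 2) ^ k * v 0 ^ (n - k)) = 0"
proof -
  define T where "T k = of_nat n * (-1) ^ (n - 1) * v 1 ^ n *
      ((-1) ^ (k - 1) / of_nat k * v 0 ^ (n - k) * (fps_tail v ^ k) $ n)" for k
  have "0 = of_nat n * (-1) ^ (n - 1) * v 1 ^ n * log_form n v"
    by (simp add: v)
  also have "\<dots> = (\<Sum>k=1..n. T k)"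
    by (simp add: log_form_def T_def sum_distrib_left)
  also have "{1..n} = insert n {1..<n}" using n by auto
  also have "(\<Sum>k\<in>insert n {1..<n}. T k) = T n + (\<Sum>k=1..<n. T k)"
    by (subst sum.insert) auto
  also have "T n = (v 1 ^ 2) ^ n"
  proof -
    have "(fps_tail v ^ n) $ n = v 1 ^ n"
      by (subst startsby_zero_power_nth_same) (auto simp: fps_tail_def)
    moreover have "(-1) ^ (n - 1) * (-1) ^ (n - 1) = (1 :: 'a)"
      by (simp flip: power_mult_distrib)
    ultimately show ?thesis
      using n by (simp add: T_def power_mult_distrib power2_eq_square mult_ac)
  qed
  also have "(\<Sum>k=1..<n. T k) = (\<Sum>k=1..<n. integral_coeff n k v * (v 1 ^ 2) ^ k * v 0 ^ (n - k))"
  proof (rule sum.cong)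
    fix k assume "k \<in> {1..<n}"
    then have k: "k \<ge> 1" by simp
    have "T k = of_nat n * (-1) ^ (n - 1) * ((-1) ^ (k - 1) / of_nat k) * v 0 ^ (n - k) *
        (v 1 ^ n * (fps_tail v ^ k) $ n)"
      unfolding T_def by (simp only: mult_ac)
    also have "\<dots> = integral_coeff n k v * (v 1 ^ 2) ^ k * v 0 ^ (n - k)"
    proof -
      have "k \<noteq> 0" using k by simp
      then show ?thesis
        unfolding log_coeff_eq[OF k] integral_coeff_def if_not_P[OF \<open>k \<noteq> 0\<close>] by (simp only: mult_ac)
    qed
    finally show "T k = integral_coeff n k v * (v 1 ^ 2) ^ k * v 0 ^ (n - k)" .
  qed simp
  \<comment> \<open>The added term \<open>k = 0\<close> is zero by the definition of
    \<open>integral_coeff\<close>; the range now matches that of a monic equation.\<close>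
  also have "\<dots> = (\<Sum>k<n. integral_coeff n k v * (v 1 ^ 2) ^ k * v 0 ^ (n - k))"
    by (rule sum.mono_neutral_left) (auto simp: integral_coeff_def not_le)
  finally show ?thesis by simp
qed

text \<open>A function of points needs a chosen representative; scaling cancels in the quotient, so
  the choice does not matter. Where the coordinate \<open>e\<close> vanishes, the value is 0 by
  convention for division.\<close>

definition coord_ratio :: "nat \<Rightarrow> nat \<Rightarrow> (nat \<Rightarrow> 'a::field) set \<Rightarrow> 'a" where
  "coord_ratio e i q = (SOME z. z \<in> q) i / (SOME z. z \<in> q) e"

lemma coord_ratio_eq:
  assumes "q \<in> proj_space n" "z \<in> q"
  shows "coord_ratio e i q = z i / z e"
proof -
  have "(SOME z. z \<in> q) \<in> proj_pt z"
    using someI[of "\<lambda>z. z \<in> q", OF assms(2)] proj_spaceD(1)[OF assms] by simp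
  then obtain c where "c \<noteq> 0" "(SOME z. z \<in> q) = (\<lambda>i. c * z i)"
    by (rule proj_ptE)
  then show ?thesis by (simp add: coord_ratio_def)
qed

lemma (in proj_subset_point) regular_coord_ratio:
  assumes "e \<le> n" "\<forall>z\<in>p. z e \<noteq> 0"
  shows "regular (coord_ratio e i)"
proof -
  \<comment> \<open>Coordinates beyond \<open>n\<close> are zero on projective space, so the
    numerator 0 represents them.\<close>
  define g :: "(nat, 'a) mpoly" where "g = (if i \<le> n then mvar i else 0)"
  have "g \<in> forms n 1"
    using mvar_in_forms[of i n, where 'a = 'a] by (auto simp: g_def forms_eq homogeneous_0)
  moreover have "coord_ratio e i q = meval g z / meval (mvar e) z" if "q \<in> X" "z \<in> q" for q z
  proof -
    have q: "q \<in> proj_space n" using that(1) X_subset by blast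
    have "meval g z = z i"
      using proj_spaceD(2)[OF q that(2)] by (auto simp: g_def meval_simps aff_space_def)
    then show ?thesis by (simp add: coord_ratio_eq[OF q that(2)] meval_simps)
  qed
  ultimately show ?thesis
    using assms by (intro regular_fraction[OF _ mvar_in_forms]) (auto simp: meval_simps)
qed

lemma regular_integral_coeff:
  fixes X :: "(nat \<Rightarrow> 'a::field_char_0) set set"
  assumes "proj_subset_point n X p" "\<And>i. regular_at n X p (\<phi> i)"
  shows "regular_at n X p (\<lambda>q. integral_coeff m k (\<lambda>i. \<phi> i q))"
proof (cases "k = 0")
  interpret proj_subset_point n X p by fact
  case True
  then show ?thesis by (simp add: integral_coeff_def regular_const)
next
  interpret proj_subset_point n X p by fact
  case False
  have "regular (\<lambda>q. log_coeff m k (\<lambda>i. \<phi> i q))"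
    unfolding log_coeff_def
    by (intro regular_sum regular_mult regular_const regular_power regular_fps_power_nth assms(2))
  then show ?thesis
    using False by (simp only: integral_coeff_def if_False) (intro regular_mult regular_const)
qed

lemma not_normal_exp_hypersurface:
  assumes n: "n \<ge> 3"
  shows "\<not> normal_variety n (exp_hypersurface n :: (nat \<Rightarrow> 'a::{alg_closed_field, field_char_0}) set set)"
proof
  let ?X = "exp_hypersurface n :: (nat \<Rightarrow> 'a) set set"
  let ?p = "proj_pt e2 :: (nat \<Rightarrow> 'a) set"
  assume normal: "normal_variety n ?X"
  have n1: "n \<ge> 1" and n2: "n \<ge> 2" using n by auto
  have X: "?X \<subseteq> proj_space n"
    unfolding exp_hypersurface_eq[OF n1] by blast
  obtain \<zeta>0 :: 'a where \<zeta>0: "\<zeta>0 ^ n = -1"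
    using nth_root_exists[of n "-1"] n by auto
  have nz: "\<zeta> \<noteq> 0" if "\<zeta> ^ n = -1" for \<zeta> :: 'a
    using that n by (auto simp: power_0_left)
  have on: "poly_curve (branch \<zeta>) t \<in> ?X" if "\<zeta> ^ n = -1" for \<zeta> t
    using n2 that by (rule poly_curve_branch_in)
  have p0: "?p = poly_curve (branch \<zeta>) 0" if "\<zeta> ^ n = -1" for \<zeta>
    using poly_curve_branch_0[OF nz[OF that]] by simp
  have p: "?p \<in> ?X" using on[OF \<zeta>0, of 0] p0[OF \<zeta>0] by simp
  interpret proj_subset_point n ?X ?p
    by unfold_locales (use X p in auto)
  let ?\<phi> = "coord_ratio 2 :: nat \<Rightarrow> (nat \<Rightarrow> 'a) set \<Rightarrow> 'a"
  have "\<forall>z\<in>?p. z 2 \<noteq> 0"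
    by (auto elim!: proj_ptE simp: e2_def)
  then have reg: "regular (?\<phi> i)" for i
    using n2 by (intro regular_coord_ratio)
  have \<phi>_curve: "?\<phi> i (poly_curve (branch \<zeta>) t) = poly (branch \<zeta> i) t / \<zeta>" if "\<zeta> ^ n = -1" for i \<zeta> t
    using coord_ratio_eq[of "poly_curve (branch \<zeta>) t" n "\<lambda>i. poly (branch \<zeta> i) t" 2 i] on[OF that, of t] X
    by (auto simp: poly_curve_def branch_def)
  \<comment> \<open>In the chart z_2 = 1 this is the equation of integrality for the fraction with
    numerator \<open>?\<phi> 1 q ^ 2\<close> and denominator \<open>?\<phi> 0 q\<close>.\<close>
  have int: "eventually (\<lambda>q. (?\<phi> 1 q ^ 2) ^ n +
      (\<Sum>k<n. integral_coeff n k (\<lambda>i. ?\<phi> i q) * (?\<phi> 1 q ^ 2) ^ k * ?\<phi> 0 q ^ (n - k)) = 0) near"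
    unfolding eventually_near
  proof (intro exI bexI conjI ballI impI)
    show "mvar 2 \<in> (forms n 1 :: (nat, 'a) mpoly set)" using n2 by (rule mvar_in_forms)
    show "meval (mvar 2) z \<noteq> 0" if "z \<in> ?p" for z
      using that by (auto elim!: proj_ptE simp: e2_def meval_simps)
    fix q assume q: "q \<in> ?X" "\<forall>z\<in>q. meval (mvar 2) z \<noteq> 0"
    then have qP: "q \<in> proj_space n" using X by blast
    then obtain z where z: "z \<in> q" using proj_space_nonempty by blast
    have z2: "z 2 \<noteq> 0" using q(2) z by (simp add: meval_simps)
    have "log_form n z = 0"
      using q(1) proj_spaceD[OF qP z] n1 by (simp add: proj_pt_in_exp_hypersurface)
    moreover have "(\<lambda>i. ?\<phi> i q) \<in> proj_pt z"
      unfolding proj_pt_def using z2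
      by (intro CollectI exI[of _ "1 / z 2"]) (simp add: coord_ratio_eq[OF qP z])
    ultimately have "log_form n (\<lambda>i. ?\<phi> i q) = 0"
      by (simp add: log_form_proj_pt)
    then show "(?\<phi> 1 q ^ 2) ^ n +
        (\<Sum>k<n. integral_coeff n k (\<lambda>i. ?\<phi> i q) * (?\<phi> 1 q ^ 2) ^ k * ?\<phi> 0 q ^ (n - k)) = 0"
      by (rule integral_equation[OF n1])
  qed
  \<comment> \<open>Along a branch the denominator equals t^2 / \<zeta>, which is not the zero
    function.\<close>
  have \<beta>: "\<not> eventually (\<lambda>q. ?\<phi> 0 q = 0) near"
  proof
    assume ev: "eventually (\<lambda>q. ?\<phi> 0 q = 0) near"
    obtain H where H: "poly H 0 \<noteq> 0" "\<And>t. poly H t \<noteq> 0 \<Longrightarrow> ?\<phi> 0 (poly_curve (branch \<zeta>0) t) = 0"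
      using eventually_on_curve[OF X on[OF \<zeta>0] ev[unfolded p0[OF \<zeta>0]]] by blast
    have "[:0, 0, 1::'a:] = 0"
    proof (rule poly_eq_0_if_mult_vanishes[of H])
      show "poly [:0, 0, 1:] t = 0" if "poly H t \<noteq> 0" for t
        using H(2)[OF that] nz[OF \<zeta>0] by (simp add: \<phi>_curve[OF \<zeta>0] branch_def)
    qed (use H(1) in auto)
    then show False by simp
  qed
  have "integrally_closed_domain \<O>"
    using normal p unfolding normal_variety_def by blast
  then obtain \<rho> where \<rho>: "regular \<rho>" "eventually (\<lambda>q. ?\<phi> 1 q ^ 2 = \<rho> q * ?\<phi> 0 q) near"
    by (rule integrally_closed_local_ringD[OF _ regular_power[OF reg] reg \<beta> regular_integral_coeff[OF proj_subset_point_axioms reg] int])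
  obtain d g h where gh: "g \<in> forms n d" "h \<in> forms n d"
      "eventually (\<lambda>q. \<forall>z\<in>q. meval h z \<noteq> 0 \<and> \<rho> q = meval g z / meval h z) near"
    using \<rho>(1) unfolding regular_at_def by blast
  \<comment> \<open>If the fraction were regular, its value at the point would be
    \<open>a / b\<close>; each branch will force a condition on it.\<close>
  define a b where "a = meval g e2" and "b = meval h e2"
  have b: "b \<noteq> 0"
    using eventually_near_imp[OF gh(3)] by (simp add: b_def)
  have quad: "(1 + \<zeta>) ^ 2 * b = \<zeta> * a" if \<zeta>: "\<zeta> ^ n = -1" for \<zeta>
  proof -
    let ?C = "poly_curve (branch \<zeta>)" and ?g = "curve_pullback (branch \<zeta>) g"
      and ?h = "curve_pullback (branch \<zeta>) h"
    have ev: "eventually (\<lambda>q. ?\<phi> 1 q ^ 2 = \<rho> q * ?\<phi> 0 q \<and>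
        (\<forall>z\<in>q. meval h z \<noteq> 0 \<and> \<rho> q = meval g z / meval h z)) near"
      using \<rho>(2) gh(3) by eventually_elim blast
    obtain H where H0: "poly H 0 \<noteq> 0" and H: "\<And>t. poly H t \<noteq> 0 \<Longrightarrow>
        ?\<phi> 1 (?C t) ^ 2 = \<rho> (?C t) * ?\<phi> 0 (?C t) \<and>
        (\<forall>z\<in>?C t. meval h z \<noteq> 0 \<and> \<rho> (?C t) = meval g z / meval h z)"
      using eventually_on_curve[OF X on[OF \<zeta>] ev[unfolded p0[OF \<zeta>]]] by blast
    \<comment> \<open>The factor t^2 is the coordinate z_0 on the branch. The relation is
      established as an identity of polynomials, so that t^2 can be cancelled before setting t =
      0.\<close>
    have "[:0, 0, 1:] * (smult ((1 + \<zeta>) ^ 2) ?h - smult \<zeta> ?g) = 0"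
    proof (rule poly_eq_0_if_mult_vanishes[of H])
      fix t assume t: "poly H t \<noteq> 0"
      have "poly ?h t \<noteq> 0" "\<rho> (?C t) = poly ?g t / poly ?h t"
        using bspec[OF conjunct2[OF H[OF t]], of "\<lambda>i. poly (branch \<zeta> i) t"]
        by (simp_all add: poly_curve_def meval_poly_curve)
      then have g_eq: "poly ?g t = \<rho> (?C t) * poly ?h t" by simp
      have "t ^ 2 * (1 + \<zeta>) ^ 2 = \<zeta> ^ 2 * (t * (1 + \<zeta>) / \<zeta>) ^ 2"
        using nz[OF \<zeta>] by (simp add: power_divide power_mult_distrib)
      also have "(t * (1 + \<zeta>) / \<zeta>) ^ 2 = \<rho> (?C t) * (t * t / \<zeta>)"
        using conjunct1[OF H[OF t]] by (simp add: \<phi>_curve[OF \<zeta>] branch_def)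
      also have "\<zeta> ^ 2 * (\<rho> (?C t) * (t * t / \<zeta>)) = \<rho> (?C t) * t ^ 2 * \<zeta>"
        using nz[OF \<zeta>] by (simp add: power2_eq_square)
      finally have t_eq: "t ^ 2 * (1 + \<zeta>) ^ 2 = \<rho> (?C t) * t ^ 2 * \<zeta>" .
      have "poly ([:0, 0, 1:] * (smult ((1 + \<zeta>) ^ 2) ?h - smult \<zeta> ?g)) t =
          (t ^ 2 * (1 + \<zeta>) ^ 2) * poly ?h t - \<zeta> * t ^ 2 * poly ?g t"
        by (simp add: power2_eq_square[of t] right_diff_distrib mult_ac)
      also have "\<dots> = 0"
        unfolding t_eq g_eq by (simp add: mult_ac)
      finally show "poly ([:0, 0, 1:] * (smult ((1 + \<zeta>) ^ 2) ?h - smult \<zeta> ?g)) t = 0" .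
    qed (use H0 in auto)
    then have "smult ((1 + \<zeta>) ^ 2) ?h = smult \<zeta> ?g" by simp
    then have "(1 + \<zeta>) ^ 2 * poly ?h 0 = \<zeta> * poly ?g 0"
      by (metis poly_smult)
    \<comment> \<open>At t = 0 the branch passes through \<zeta> times \<open>e2\<close>. Both forms
      have degree \<open>d\<close>, so the factor \<zeta>^d appears on both sides and
      cancels.\<close>
    then have "(1 + \<zeta>) ^ 2 * (\<zeta> ^ d * b) = \<zeta> * (\<zeta> ^ d * a)"
      unfolding meval_poly_curve branch_at_0 meval_scale[OF gh(1)] meval_scale[OF gh(2)] a_def b_def .
    then show ?thesis using nz[OF \<zeta>] by (simp add: mult.left_commute)
  qed
  \<comment> \<open>\<open>Q\<close> is b (1 + \<zeta>)^2 - a \<zeta> expanded in \<zeta>; it is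
    nonzero because \<open>b\<close> is.\<close>
  define Q where "Q = [:b, 2 * b - a, b:]"
  have "Q \<noteq> 0" "degree Q \<le> 2" using b by (auto simp: Q_def)
  have "{\<zeta>. \<zeta> ^ n = -1} \<subseteq> {\<zeta>. poly Q \<zeta> = 0}"
    using quad by (auto simp: Q_def power2_eq_square algebra_simps)
  then have "card {\<zeta> :: 'a. \<zeta> ^ n = -1} \<le> card {\<zeta>. poly Q \<zeta> = 0}"
    by (intro card_mono poly_roots_finite \<open>Q \<noteq> 0\<close>)
  also have "\<dots> \<le> 2"
    using card_poly_roots_bound[OF \<open>Q \<noteq> 0\<close>] \<open>degree Q \<le> 2\<close> by linarith
  finally show False
    using card_roots_of_minus_one[OF n1, where ?'a = 'a] n by simp
qed

section \<open>Degree two: the smooth conic\<close>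

text \<open>The part of \<open>X\<close> with z_e nonzero is an affine line with coordinate z_1 /
  z_e. The normalization \<open>w e = 1\<close> and \<open>w 1 = [:0, 1:]\<close> allows every
  univariate polynomial to be lifted to a form in these two variables.\<close>

locale affine_line_chart =
  fixes n :: nat and X :: "(nat \<Rightarrow> 'a::field_char_0) set set" and w :: "nat \<Rightarrow> 'a poly" and e :: nat
  assumes X_subset: "X \<subseteq> proj_space n" and bounds: "1 \<le> n" "e \<le> n"
    and w_e: "w e = 1" and w_1: "w 1 = [:0, 1:]"
    and on: "poly_curve w t \<in> X"
    and cover: "x \<in> X \<Longrightarrow> z \<in> x \<Longrightarrow> z e \<noteq> 0 \<Longrightarrow> \<exists>t. x = poly_curve w t"
begin

text \<open>The target degree \<open>d\<close> is a free parameter, so that numerator and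
  denominator of a fraction can be lifted to forms of equal degree.\<close>

definition homogenize :: "nat \<Rightarrow> 'a poly \<Rightarrow> (nat, 'a) mpoly" where
  "homogenize d H = (\<Sum>i\<le>d. mconst (coeff H i) * mvar 1 ^ i * mvar e ^ (d - i))"

lemma homogenize_in_forms: "homogenize d H \<in> forms n d"
  unfolding homogenize_def forms_eq
proof (rule homogeneous_sum)
  fix i assume i: "i \<in> {..d}"
  let ?F = "homogeneous_mpolys {..n} {..n} :: nat \<Rightarrow> (nat, 'a) mpoly set"
  have v: "(mvar j :: (nat, 'a) mpoly) \<in> ?F 1" if "j \<le> n" for j
    using mvar_in_forms[OF that] by (simp add: forms_eq)
  have "mconst (coeff H i) * mvar 1 ^ i * mvar e ^ (d - i) \<in> ?F (0 + i * 1 + (d - i) * 1)"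
    by (intro homogeneous_mult homogeneous_const homogeneous_power v bounds)
  then show "mconst (coeff H i) * mvar 1 ^ i * mvar e ^ (d - i) \<in> ?F d"
    using i by simp
qed

lemma pullback_homogenize:
  assumes "degree H \<le> d"
  shows "poly (curve_pullback w (homogenize d H)) t = poly H t"
proof -
  have "poly H t = (\<Sum>i\<le>d. coeff H i * t ^ i)"
    unfolding poly_altdef
    by (rule sum.mono_neutral_left) (use assms in \<open>auto simp: coeff_eq_0\<close>)
  then show ?thesis
    unfolding homogenize_def pconst.eval_simps w_e w_1 by (simp add: poly_sum)
qed

lemma eventually_chart:
  "eventually P (nhdsin (subtopology (zariski_proj n) X) (poly_curve w t0)) \<longleftrightarrow>
    (\<exists>H. poly H t0 \<noteq> 0 \<and> (\<forall>t. poly H t \<noteq> 0 \<longrightarrow> P (poly_curve w t)))" (is "?L \<longleftrightarrow> ?R")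
proof
  assume ?L
  then show ?R using eventually_on_curve[OF X_subset on, of P t0] by metis
next
  assume ?R
  then obtain H where H: "poly H t0 \<noteq> 0" "\<And>t. poly H t \<noteq> 0 \<Longrightarrow> P (poly_curve w t)" by blast
  interpret proj_subset_point n X "poly_curve w t0"
    by unfold_locales (use X_subset on in auto)
  \<comment> \<open>The extra factor \<open>mvar e\<close> keeps the neighbourhood inside the chart,
    where every point lies on the curve.\<close>
  define f where "f = mvar e * homogenize (degree H) H"
  have f: "f \<in> forms n (1 + degree H)"
    unfolding f_def by (intro mult_in_forms mvar_in_forms homogenize_in_forms bounds)
  have pf: "poly (curve_pullback w f) t = poly H t" for t
    unfolding f_def pconst.eval_mult pconst.eval_var w_e by (simp add: pullback_homogenize)
  show ?L
    unfolding eventually_near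
  proof (rule exI[of _ "1 + degree H"], rule bexI[OF _ f], rule conjI)
    show "\<forall>z\<in>poly_curve w t0. meval f z \<noteq> 0"
      using H(1) unfolding ball_poly_curve[OF f] pf .
    show "\<forall>q\<in>X. (\<forall>z\<in>q. meval f z \<noteq> 0) \<longrightarrow> P q"
    proof (intro ballI impI)
      fix q assume q: "q \<in> X" "\<forall>z\<in>q. meval f z \<noteq> 0"
      then obtain z where z: "z \<in> q" using X_subset proj_space_nonempty by blast
      then have "z e \<noteq> 0" using q(2) by (auto simp: f_def meval_simps)
      then obtain t where t: "q = poly_curve w t" using cover[OF q(1) z] by blast
      then show "P q"
        using q(2) H(2)[of t] unfolding t ball_poly_curve[OF f] pf by blast
    qed
  qed
qed

text \<open>The germ is described by a fraction G/H with H nonzero at \<open>t0\<close>. Equality of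
  germs becomes equality of fractions, which identifies the local ring with the localization of the
  polynomial ring at t - t0.\<close>

definition represents :: "'a \<Rightarrow> ((nat \<Rightarrow> 'a) set \<Rightarrow> 'a) \<Rightarrow> 'a poly \<Rightarrow> 'a poly \<Rightarrow> bool" where
  "represents t0 \<phi> G H \<longleftrightarrow> poly H t0 \<noteq> 0 \<and>
     (\<forall>t. poly H t \<noteq> 0 \<longrightarrow> \<phi> (poly_curve w t) = poly G t / poly H t)"

lemma regular_iff_represents:
  "regular_at n X (poly_curve w t0) \<phi> \<longleftrightarrow> (\<exists>G H. represents t0 \<phi> G H)"
proof
  assume "regular_at n X (poly_curve w t0) \<phi>"
  then obtain d g h H where *: "g \<in> forms n d" "h \<in> forms n d" "poly H t0 \<noteq> 0"
    "poly (curve_pullback w h) t0 \<noteq> 0"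
    "\<And>t. poly H t \<noteq> 0 \<Longrightarrow> poly (curve_pullback w h) t \<noteq> 0 \<and>
      \<phi> (poly_curve w t) = poly (curve_pullback w g) t / poly (curve_pullback w h) t"
    by (rule regular_on_curve[OF X_subset on]) blast
  then have "represents t0 \<phi> (curve_pullback w g * H) (curve_pullback w h * H)"
    by (simp add: represents_def)
  then show "\<exists>G H. represents t0 \<phi> G H" by blast
next
  assume "\<exists>G H. represents t0 \<phi> G H"
  then obtain G H where GH: "poly H t0 \<noteq> 0"
      "\<And>t. poly H t \<noteq> 0 \<Longrightarrow> \<phi> (poly_curve w t) = poly G t / poly H t"
    unfolding represents_def by blast
  define d where "d = max (degree G) (degree H)"
  define g h where "g = homogenize d G" and "h = homogenize d H"
  have gh: "g \<in> forms n d" "h \<in> forms n d"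
    by (simp_all add: g_def h_def homogenize_in_forms)
  have ev: "meval g (\<lambda>i. poly (w i) t) = poly G t" "meval h (\<lambda>i. poly (w i) t) = poly H t" for t
    unfolding meval_poly_curve[symmetric] g_def h_def by (simp_all add: pullback_homogenize d_def)
  have "meval h z \<noteq> 0 \<and> \<phi> (poly_curve w t) = meval g z / meval h z"
    if t: "poly H t \<noteq> 0" and z: "z \<in> poly_curve w t" for t z
  proof -
    obtain c where c: "c \<noteq> 0" "z = (\<lambda>i. c * poly (w i) t)"
      using z unfolding poly_curve_def by (rule proj_ptE)
    then show ?thesis
      using GH(2)[OF t] t by (simp add: meval_scale[OF gh(1)] meval_scale[OF gh(2)] ev)
  qed
  then have "eventually (\<lambda>q. \<forall>z\<in>q. meval h z \<noteq> 0 \<and> \<phi> q = meval g z / meval h z)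
      (nhdsin (subtopology (zariski_proj n) X) (poly_curve w t0))"
    unfolding eventually_chart using GH(1) by blast
  then show "regular_at n X (poly_curve w t0) \<phi>"
    unfolding regular_at_def using gh by blast
qed

lemma inj_poly_curve: "inj (poly_curve w)"
proof (rule injI)
  fix s t assume st: "poly_curve w s = poly_curve w t"
  have "(\<lambda>i. poly (w i) s) \<in> proj_pt (\<lambda>i. poly (w i) s)" by simp
  then have "(\<lambda>i. poly (w i) s) \<in> proj_pt (\<lambda>i. poly (w i) t)"
    using st unfolding poly_curve_def by simp
  then obtain c where c: "(\<lambda>i. poly (w i) s) = (\<lambda>i. c * poly (w i) t)"
    by (rule proj_ptE)
  have "c = 1" using fun_cong[OF c, of e] by (simp add: w_e)
  then show "s = t" using fun_cong[OF c, of 1] by (simp only: w_1) simp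
qed

text \<open>The parameter is recovered from the point by inverting the injective curve; the values
  off the curve are arbitrary.\<close>

lemma represents_exists:
  assumes "poly H t0 \<noteq> 0"
  shows "\<exists>\<phi>. represents t0 \<phi> G H"
proof -
  have "represents t0 (\<lambda>q. poly G (inv_into UNIV (poly_curve w) q) / poly H (inv_into UNIV (poly_curve w) q)) G H"
    using assms by (simp add: represents_def inv_f_f[OF inj_poly_curve])
  then show ?thesis by blast
qed

lemma represents_mult:
  assumes "represents t0 \<phi> G H" "represents t0 \<psi> G' H'"
  shows "represents t0 (\<lambda>q. \<phi> q * \<psi> q) (G * G') (H * H')"
  using assms by (simp add: represents_def)

lemma represents_eventually_eq_iff:
  assumes "represents t0 \<phi> G H" "represents t0 \<psi> G' H'"
  shows "eventually (\<lambda>q. \<phi> q = \<psi> q) (nhdsin (subtopology (zariski_proj n) X) (poly_curve w t0)) \<longleftrightarrow>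
    G * H' = G' * H" (is "?L \<longleftrightarrow> ?R")
proof
  have H0: "poly H t0 \<noteq> 0" "poly H' t0 \<noteq> 0" using assms by (simp_all add: represents_def)
  assume ?L
  then obtain E where E: "poly E t0 \<noteq> 0" "\<And>t. poly E t \<noteq> 0 \<Longrightarrow> \<phi> (poly_curve w t) = \<psi> (poly_curve w t)"
    unfolding eventually_chart by blast
  have "G * H' - G' * H = 0"
  proof (rule poly_eq_0_if_mult_vanishes[of "E * H * H'"])
    fix t assume "poly (E * H * H') t \<noteq> 0"
    then have t: "poly E t \<noteq> 0" "poly H t \<noteq> 0" "poly H' t \<noteq> 0" by auto
    then have "poly G t / poly H t = poly G' t / poly H' t"
      using E(2)[OF t(1)] assms by (simp add: represents_def)
    then show "poly (G * H' - G' * H) t = 0" using t by (simp add: frac_eq_eq)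
  next
    show "E * H * H' \<noteq> 0" using E(1) H0 by auto
  qed
  then show ?R by simp
next
  have H0: "poly (H * H') t0 \<noteq> 0" using assms by (simp add: represents_def)
  assume R: ?R
  have "\<phi> (poly_curve w t) = \<psi> (poly_curve w t)" if "poly (H * H') t \<noteq> 0" for t
  proof -
    have "poly G t * poly H' t = poly G' t * poly H t"
      using R by (metis poly_mult)
    then show ?thesis
      using that assms by (simp add: represents_def frac_eq_eq)
  qed
  then show ?L unfolding eventually_chart using H0 by blast
qed

text \<open>Up to units every nonzero germ is a power of t - t0, so of two germs the one with the
  larger order of vanishing is a multiple of the other.\<close>

lemma integrally_closed_local_ring:
  "integrally_closed_domain (local_ring n X (poly_curve w t0))"
proof -
  interpret proj_subset_point n X "poly_curve w t0"
    by unfold_locales (use X_subset on in auto)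
  have zero: "represents t0 (\<lambda>_. 0) 0 1" and one: "represents t0 (\<lambda>_. 1) 1 1"
    by (simp_all add: represents_def)
  have germ_eq: "\<G> \<phi> = \<G> \<psi> \<longleftrightarrow> G * H' = G' * H" if "represents t0 \<phi> G H" "represents t0 \<psi> G' H'"
    for \<phi> \<psi> G H G' H'
    unfolding germ_eq_iff by (rule represents_eventually_eq_iff[OF that])
  have carrierE: "\<exists>\<phi> G H. A = \<G> \<phi> \<and> represents t0 \<phi> G H" if "A \<in> carrier \<O>" for A
    using that unfolding local_ring_carrier regular_iff_represents by blast
  have carrierI: "\<G> \<phi> \<in> carrier \<O>" if "represents t0 \<phi> G H" for \<phi> G H
    using that unfolding local_ring_carrier regular_iff_represents by blast
  have "domain \<O>"
  proof (intro domain.intro domain_axioms.intro cring_local_ring)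
    show "\<one>\<^bsub>\<O>\<^esub> \<noteq> \<zero>\<^bsub>\<O>\<^esub>"
      unfolding local_ring_one local_ring_zero germ_eq[OF one zero] by simp
    fix A B assume AB: "A \<otimes>\<^bsub>\<O>\<^esub> B = \<zero>\<^bsub>\<O>\<^esub>" "A \<in> carrier \<O>" "B \<in> carrier \<O>"
    obtain \<phi> G H where A: "A = \<G> \<phi>" "represents t0 \<phi> G H" using carrierE[OF AB(2)] by blast
    obtain \<psi> G' H' where B: "B = \<G> \<psi>" "represents t0 \<psi> G' H'" using carrierE[OF AB(3)] by blast
    have "G * G' = 0"
      using AB(1) germ_eq[OF represents_mult[OF A(2) B(2)] zero]
      unfolding A(1) B(1) local_ring_mult local_ring_zero by simp
    then show "A = \<zero>\<^bsub>\<O>\<^esub> \<or> B = \<zero>\<^bsub>\<O>\<^esub>"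
      unfolding A(1) B(1) local_ring_zero germ_eq[OF A(2) zero] germ_eq[OF B(2) zero] by simp
  qed
  moreover have divides: "\<exists>r\<in>carrier \<O>. \<G> \<phi> = r \<otimes>\<^bsub>\<O>\<^esub> \<G> \<psi>"
    if \<phi>: "represents t0 \<phi> ([:-t0, 1:] ^ j * U) H" and \<psi>: "represents t0 \<psi> ([:-t0, 1:] ^ k * V) H'"
      and "k \<le> j" "poly V t0 \<noteq> 0" for \<phi> \<psi> j k U V H H'
  proof -
    have "poly (H * V) t0 \<noteq> 0" using \<phi> \<open>poly V t0 \<noteq> 0\<close> by (simp add: represents_def)
    \<comment> \<open>This is the quotient of the two fractions after cancelling (t - t0)^k; its
      denominator is nonzero at \<open>t0\<close>.\<close>
    then obtain \<rho> where \<rho>: "represents t0 \<rho> ([:-t0, 1:] ^ (j - k) * U * H') (H * V)"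
      using represents_exists by blast
    have "[:-t0, 1:] ^ j = [:-t0, 1:] ^ (j - k) * [:-t0, 1:] ^ k"
      using \<open>k \<le> j\<close> by (simp flip: power_add)
    then have "\<G> \<phi> = \<G> (\<lambda>q. \<rho> q * \<psi> q)"
      unfolding germ_eq[OF \<phi> represents_mult[OF \<rho> \<psi>]] by (simp only: mult_ac)
    then show ?thesis
      by (intro bexI[OF _ carrierI[OF \<rho>]]) (simp only: local_ring_mult)
  qed
  ultimately show ?thesis
  proof (intro valuation_domain_integrally_closed)
    fix A B assume AB: "A \<in> carrier \<O>" "B \<in> carrier \<O>"
    obtain \<phi> G H where A: "A = \<G> \<phi>" "represents t0 \<phi> G H" using carrierE[OF AB(1)] by blast
    obtain \<psi> G' H' where B: "B = \<G> \<psi>" "represents t0 \<psi> G' H'" using carrierE[OF AB(2)] by blast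
    have zero_mult: "\<zero>\<^bsub>\<O>\<^esub> = \<zero>\<^bsub>\<O>\<^esub> \<otimes>\<^bsub>\<O>\<^esub> C" if "C \<in> carrier \<O>" for C
      using that by simp
    consider "G = 0" | "G' = 0" | "G \<noteq> 0" "G' \<noteq> 0" by blast
    then show "(\<exists>r\<in>carrier \<O>. A = r \<otimes>\<^bsub>\<O>\<^esub> B) \<or> (\<exists>r\<in>carrier \<O>. B = r \<otimes>\<^bsub>\<O>\<^esub> A)"
    proof cases
      case 1
      then have "A = \<zero>\<^bsub>\<O>\<^esub>" unfolding A(1) local_ring_zero germ_eq[OF A(2) zero] by simp
      then show ?thesis using zero_mult[OF AB(2)] \<O>.zero_closed by metis
    next
      case 2
      then have "B = \<zero>\<^bsub>\<O>\<^esub>" unfolding B(1) local_ring_zero germ_eq[OF B(2) zero] by simp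
      then show ?thesis using zero_mult[OF AB(1)] \<O>.zero_closed by metis
    next
      case 3
      obtain U where U: "G = [:-t0, 1:] ^ order t0 G * U" "\<not> [:-t0, 1:] dvd U"
        using order_decomp[OF 3(1)] by blast
      obtain V where V: "G' = [:-t0, 1:] ^ order t0 G' * V" "\<not> [:-t0, 1:] dvd V"
        using order_decomp[OF 3(2)] by blast
      have UV: "poly U t0 \<noteq> 0" "poly V t0 \<noteq> 0"
        using U(2) V(2) by (simp_all add: poly_eq_0_iff_dvd)
      have A': "represents t0 \<phi> ([:-t0, 1:] ^ order t0 G * U) H"
        and B': "represents t0 \<psi> ([:-t0, 1:] ^ order t0 G' * V) H'"
        using A(2) B(2) by (simp_all only: U(1)[symmetric] V(1)[symmetric])
      show ?thesis
      proof (cases "order t0 G' \<le> order t0 G")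
        case True
        then show ?thesis unfolding A(1) B(1) using divides[OF A' B' _ UV(2)] by blast
      next
        case False
        then show ?thesis unfolding A(1) B(1) using divides[OF B' A' _ UV(1)] by simp
      qed
    qed
  qed
qed

end

lemma log_form_2: "log_form 2 z = z 0 * z 2 - z 1 ^ 2 / 2"
proof -
  have "(fps_tail z ^ 2) $ 2 = z 1 ^ 2"
    by (subst startsby_zero_power_nth_same) (auto simp: fps_tail_def)
  moreover have "{1..2::nat} = {1, 2}" by auto
  ultimately show ?thesis
    unfolding log_form_def by (simp add: fps_tail_def)
qed

lemma normal_exp_hypersurface_2:
  "normal_variety 2 (exp_hypersurface 2 :: (nat \<Rightarrow> 'a::{alg_closed_field, field_char_0}) set set)"
  unfolding normal_variety_def
proof
  let ?X = "exp_hypersurface 2 :: (nat \<Rightarrow> 'a) set set"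
  have X: "?X = {p \<in> proj_space 2. \<forall>z\<in>p. meval (log_mpoly 2) z = 0}"
    by (rule exp_hypersurface_eq) simp
  have X_sub: "?X \<subseteq> proj_space 2" unfolding X by blast
  have eq: "z 0 * z 2 = z 1 ^ 2 / 2" if "x \<in> ?X" "z \<in> x" for x z
    using that unfolding X by (simp add: meval_log_mpoly log_form_2)
  have memI: "proj_pt z \<in> ?X"
    if "z \<in> aff_space 3" "z \<noteq> (\<lambda>_. 0)" "z 0 * z 2 = z 1 ^ 2 / 2" for z
    using that by (subst proj_pt_in_exp_hypersurface) (auto simp: log_form_2)
  \<comment> \<open>The equation is z_0 z_2 = z_1^2 / 2, so the charts z_0 = 1 and z_2 = 1 are
    parametrized by (1, t, t^2/2) and (t^2/2, t, 1). They cover the conic, because z_0 = z_2 = 0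
    would force z_1 = 0.\<close>
  define w0 w2 :: "nat \<Rightarrow> 'a poly" where
    "w0 = (\<lambda>i. if i = 0 then 1 else if i = 1 then [:0, 1:] else if i = 2 then [:0, 0, 1 / 2:] else 0)" and
    "w2 = (\<lambda>i. if i = 2 then 1 else if i = 1 then [:0, 1:] else if i = 0 then [:0, 0, 1 / 2:] else 0)"
  have outside: "z i = 0" if "x \<in> ?X" "z \<in> x" "i \<noteq> 0" "i \<noteq> 1" "i \<noteq> 2" for x z and i :: nat
    using proj_spaceD(2)[OF subsetD[OF X_sub that(1)] that(2)] that(3-5) by (auto simp: aff_space_def)
  have on0: "poly_curve w0 t \<in> ?X" for t
    unfolding poly_curve_def
  proof (rule memI)
    show "(\<lambda>i. poly (w0 i) t) \<noteq> (\<lambda>_. 0)"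
      by (auto simp: w0_def fun_eq_iff intro!: exI[of _ 0])
  qed (auto simp: w0_def aff_space_def power2_eq_square)
  have on2: "poly_curve w2 t \<in> ?X" for t
    unfolding poly_curve_def
  proof (rule memI)
    show "(\<lambda>i. poly (w2 i) t) \<noteq> (\<lambda>_. 0)"
      by (auto simp: w2_def fun_eq_iff intro!: exI[of _ 2])
  qed (auto simp: w2_def aff_space_def power2_eq_square)
  have cover0: "\<exists>t. x = poly_curve w0 t" if x: "x \<in> ?X" "z \<in> x" "z 0 \<noteq> 0" for x z
  proof
    have "z = (\<lambda>i. z 0 * poly (w0 i) (z 1 / z 0))"
      using eq[OF x(1,2)] x(3) outside[OF x(1,2)]
      by (auto simp: w0_def fun_eq_iff field_simps power2_eq_square)
    then have "proj_pt z = proj_pt (\<lambda>i. z 0 * poly (w0 i) (z 1 / z 0))" by (rule arg_cong)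
    then show "x = poly_curve w0 (z 1 / z 0)"
      unfolding poly_curve_def proj_pt_scale[OF x(3)]
      using proj_spaceD(1)[OF subsetD[OF X_sub x(1)] x(2)] by simp
  qed
  have cover2: "\<exists>t. x = poly_curve w2 t" if x: "x \<in> ?X" "z \<in> x" "z 2 \<noteq> 0" for x z
  proof
    have "z = (\<lambda>i. z 2 * poly (w2 i) (z 1 / z 2))"
      using eq[OF x(1,2)] x(3) outside[OF x(1,2)]
      by (auto simp: w2_def fun_eq_iff field_simps power2_eq_square)
    then have "proj_pt z = proj_pt (\<lambda>i. z 2 * poly (w2 i) (z 1 / z 2))" by (rule arg_cong)
    then show "x = poly_curve w2 (z 1 / z 2)"
      unfolding poly_curve_def proj_pt_scale[OF x(3)]
      using proj_spaceD(1)[OF subsetD[OF X_sub x(1)] x(2)] by simp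
  qed
  interpret c0: affine_line_chart 2 ?X w0 0
  proof unfold_locales
    show "w0 0 = 1" "w0 1 = [:0, 1:]" by (simp_all add: w0_def)
  qed (use X_sub on0 cover0 in auto)
  interpret c2: affine_line_chart 2 ?X w2 2
  proof unfold_locales
    show "w2 2 = 1" "w2 1 = [:0, 1:]" by (simp_all add: w2_def)
  qed (use X_sub on2 cover2 in auto)
  fix p assume p: "p \<in> ?X"
  then obtain z where z: "z \<in> p" using X_sub proj_space_nonempty by blast
  show "integrally_closed_domain (local_ring 2 ?X p)"
  proof (cases "z 0 = 0")
    case False
    then show ?thesis using cover0[OF p z] c0.integrally_closed_local_ring by auto
  next
    case True
    have "z 2 \<noteq> 0"
    proof
      assume "z 2 = 0"
      moreover have "z 1 = 0" using eq[OF p z] True by simp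
      ultimately have "z i = 0" for i
        using True outside[OF p z, of i] by (cases "i = 0"; cases "i = 1"; cases "i = 2") auto
      then have "z = (\<lambda>_. 0)" by blast
      then show False using proj_spaceD(3)[OF subsetD[OF X_sub p] z] by simp
    qed
    then show ?thesis using cover2[OF p z] c2.integrally_closed_local_ring by auto
  qed
qed

theorem mainTheorem10:
  fixes n :: nat
    and X :: "(nat \<Rightarrow> 'a :: {alg_closed_field, field_char_0}) set set"
  assumes "n \<ge> 2"
    and "X = exp_hypersurface n"
  shows "hypersurface_of_degree n n X \<and> admits_induced_additive_action n X \<and>
         (normal_variety n X \<longleftrightarrow> n \<le> 2)"
proof (intro conjI)
  show "hypersurface_of_degree n n X" "admits_induced_additive_action n X"
    using assms by (simp_all add: hypersurface_exp_hypersurface exp_hypersurface_additive_action)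
  show "normal_variety n X \<longleftrightarrow> n \<le> 2"
  proof
    show "n \<le> 2" if "normal_variety n X"
      using that not_normal_exp_hypersurface[of n] assms(2) by fastforce
    show "normal_variety n X" if "n \<le> 2"
      using that assms normal_exp_hypersurface_2 by (metis le_antisym)
  qed
qed

end
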